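(* There exists $\varepsilon>0$ such that the following holds. Let $u_0\in B\mathcal X\cap L^1(\mathbb R^2)$ satisfy $\|u_0\|_{B\mathcal X}<\varepsilon$ and $\int_{\mathbb R^2}u_0(x)\,dx=M$ with $M>0$. Let $u\in\mathscr X$ be the unique global mild solution of the Debye system with initial datum $u_0$ satisfying $\sup_{t>0}t^{1/4}\|u(t)\|_{4/3}<2\varepsilon$, and let $U_M$ be the unique self-similar solution of the Debye system with $\int_{\mathbb R^2}U_M(x,1)\,dx=M$. Then $$\lim_{t\to\infty}t^{1/4}\|u(\cdot,t)-U_M(\cdot,t)\|_{4/3}=0.$$
   Context: $\|\cdot\|_p$ is the norm of $L^p(\mathbb R^2)$. $S(t)$ is the heat semigroup on $\mathbb R^2$: $S(t)f=G(\cdot,t)*f$ with $G(x,t)=\frac1{4\pi t}e^{-|x|^2/(4t)}$, defined for $f\in\mathscr S'(\mathbb R^2)$. The Debye system is $u_t=\Delta u+\nabla\cdot(u\nabla\phi_u)$, $\phi_u=-E_2*u$ in $\mathbb R^2$, $u(x,0)=u_0(x)$, with $E_2(z)=\frac1{2\pi}\log|z|$; thus $\nabla\phi_u=-(\nabla E_2)*u$, i.e. $\nabla\phi_u(x)=-\frac1{2\pi}\int_{\mathbb R^2}\frac{x-y}{|x-y|^2}u(y)\,dy$. A mild solution with initial datum $u_0$ is a function satisfying, for all $t>0$, $u(t)=S(t)u_0+\int_0^tS(t-\tau)\,\nabla\cdot(u\nabla\phi_u)(\tau)\,d\tau$ (divergence in the sense of distributions). $B\mathcal X=\{u\in\mathscr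 S'(\mathbb R^2):\ \|u\|_{B\mathcal X}:=\sup_{t>0}t^{1/4}\|S(t)u\|_{4/3}<\infty\}$. For given $u_0$, $\mathscr X$ is the set of measurable functions $f:[0,\infty)\to B\mathcal X$ belonging to $L^\infty([0,\infty);B\mathcal X)$, attaining $u_0$ as $t\to0^+$ in the sense of tempered distributions, and such that $f(t)\in L^{4/3}(\mathbb R^2)$ for $t>0$ with $\sup_{t>0}t^{1/4}\|f(t)\|_{4/3}<\infty$. It is known that for all sufficiently small $\varepsilon>0$, each $u_0$ with $\|u_0\|_{B\mathcal X}<\varepsilon$ admits exactly one mild solution in $\mathscr X$ with $\sup_{t>0}t^{1/4}\|u(t)\|_{4/3}<2\varepsilon$. Self-similar means invariant under the scaling $u(x,t)\mapsto\lambda^2u(\lambda x,\lambda^2t)$, $\lambda>0$. $U_M$ is the radially symmetric self-similar solution (with initial datum $M\delta_0$) obtained by the integrated density method: $\int_{\{|x|\le r\}}U_M(x,t)\,dx=2\pi\xi(r^2/t)$, i.e. $U_M(x,t)=\frac2t\,\xi'\big(|x|^2/t\big)$, where $\xi\in C^1([0,\infty))\cap C^2((0,\infty))$ is the unique solution of $\xi''(y)+\frac14\xi'(y)-\frac1{2y}\xi(y)\xi'(y)=0$ for $y>0$ with $\xi(0)=0$ and $\lim_{y\to\infty}\xi(y)=M/(2\pi)$. *)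

theory Defs
  imports "HOL-Analysis.Analysis"
begin

section \<open>Tempered distributions on the plane\<close>

type_synonym plane = "real ^ 2"

definition pd :: "2 \<Rightarrow> (plane \<Rightarrow> real) \<Rightarrow> plane \<Rightarrow> real" where
  "pd i f x = frechet_derivative f (at x) (axis i 1)"

definition pds :: "2 list \<Rightarrow> (plane \<Rightarrow> real) \<Rightarrow> plane \<Rightarrow> real" where
  "pds js f = foldr pd js f"

definition schwartz :: "(plane \<Rightarrow> real) set" where
  "schwartz = {\<phi>. \<forall>js. (\<forall>x. pds js \<phi> differentiable (at x)) \<and>
                      (\<forall>k::nat. bounded (range (\<lambda>x. norm x ^ k * pds js \<phi> x)))}"

definition schwartz_seminorm :: "nat \<Rightarrow> 2 list \<Rightarrow> (plane \<Rightarrow> real) \<Rightarrow> real" where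
  "schwartz_seminorm k js \<phi> = (SUP x. norm x ^ k * \<bar>pds js \<phi> x\<bar>)"

text \<open>A distribution is a functional whose values matter only on Schwartz functions. All notions
  below evaluate it only there, so two functionals that agree on Schwartz functions are never
  distinguished.\<close>

type_synonym distr = "(plane \<Rightarrow> real) \<Rightarrow> real"

definition tempered :: "distr \<Rightarrow> bool" where
  "tempered T \<longleftrightarrow>
     (\<forall>\<phi>\<in>schwartz. \<forall>\<psi>\<in>schwartz. \<forall>a b. T (\<lambda>x. a * \<phi> x + b * \<psi> x) = a * T \<phi> + b * T \<psi>) \<and>
     (\<exists>C N. \<forall>\<phi>\<in>schwartz.
        \<bar>T \<phi>\<bar> \<le> C * (\<Sum>k\<le>N. \<Sum>js\<in>{js. length js \<le> N}. schwartz_seminorm k js \<phi>))"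

definition distr_of :: "(plane \<Rightarrow> real) \<Rightarrow> distr" where
  "distr_of g \<phi> = (LINT x|lborel. g x * \<phi> x)"

definition has_density :: "distr \<Rightarrow> (plane \<Rightarrow> real) \<Rightarrow> bool" where
  "has_density T g \<longleftrightarrow> g \<in> borel_measurable borel \<and>
     (\<forall>\<phi>\<in>schwartz. integrable lborel (\<lambda>x. g x * \<phi> x) \<and> T \<phi> = distr_of g \<phi>)"

text \<open>A density is determined up to a Lebesgue null set, which is all that is used of it.\<close>

definition density_of :: "distr \<Rightarrow> plane \<Rightarrow> real" where
  "density_of T = (SOME g. has_density T g)"

text \<open>The \<open>L\<^sup>p\<close> norm for finite \<open>p\<close>, with value \<open>\<infinity>\<close> off \<open>L\<^sup>p\<close>.\<close>

definition Lp_norm :: "real \<Rightarrow> (plane \<Rightarrow> real) \<Rightarrow> ennreal" where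
  "Lp_norm p g =
     (if g \<in> borel_measurable borel \<and> integrable lborel (\<lambda>x. \<bar>g x\<bar> powr p)
      then ennreal ((LINT x|lborel. \<bar>g x\<bar> powr p) powr (1 / p)) else \<infinity>)"

section \<open>The heat semigroup and the space \<open>B\<X>\<close>\<close>

definition heat_kernel :: "real \<Rightarrow> plane \<Rightarrow> real" where
  "heat_kernel t x = 1 / (4 * pi * t) * exp (- (norm x)\<^sup>2 / (4 * t))"

text \<open>\<open>S(t)T = G(\<cdot>,t) * T\<close>: for \<open>t > 0\<close> the convolution of a tempered distribution with a
  Schwartz function is a smooth function.\<close>

definition heat :: "real \<Rightarrow> distr \<Rightarrow> plane \<Rightarrow> real" where
  "heat t T x = T (\<lambda>y. heat_kernel t (x - y))"

definition BX_norm :: "distr \<Rightarrow> ennreal" where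
  "BX_norm T = (SUP t\<in>{0<..}. ennreal (t powr (1/4)) * Lp_norm (4/3) (heat t T))"

definition BX :: "distr set" where
  "BX = {T. tempered T \<and> BX_norm T < \<infinity>}"

definition BX_open :: "distr set \<Rightarrow> bool" where
  "BX_open V \<longleftrightarrow> V \<subseteq> BX \<and>
     (\<forall>T\<in>V. \<exists>r>0. \<forall>T'\<in>BX. BX_norm (\<lambda>\<phi>. T' \<phi> - T \<phi>) < ennreal r \<longrightarrow> T' \<in> V)"

section \<open>The class of solutions\<close>

definition L43_decay_norm :: "(real \<Rightarrow> distr) \<Rightarrow> ennreal" where
  "L43_decay_norm u = (SUP t\<in>{0<..}. ennreal (t powr (1/4)) * Lp_norm (4/3) (density_of (u t)))"

text \<open>Measurability into \<open>B\<X>\<close> is with respect to Lebesgue sets of times and the Borel sets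
  of the norm topology of \<open>B\<X>\<close>. Values of \<open>u\<close> at negative times are ignored.\<close>

definition solution_space :: "distr \<Rightarrow> (real \<Rightarrow> distr) set" where
  "solution_space u0 = {u.
     (\<forall>t\<ge>0. u t \<in> BX) \<and>
     (\<forall>V. BX_open V \<longrightarrow> {t. 0 \<le> t \<and> u t \<in> V} \<in> sets lebesgue) \<and>
     (\<exists>C::real. AE t in lebesgue. 0 \<le> t \<longrightarrow> BX_norm (u t) \<le> ennreal C) \<and>
     (\<forall>\<phi>\<in>schwartz. ((\<lambda>t. u t \<phi>) \<longlongrightarrow> u0 \<phi>) (at_right 0)) \<and>
     (\<forall>t>0. \<exists>g. has_density (u t) g \<and> Lp_norm (4/3) g < \<infinity>) \<and>
     L43_decay_norm u < \<infinity>}"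

section \<open>Mild solutions of the Debye system\<close>

definition grad_potential :: "(plane \<Rightarrow> real) \<Rightarrow> plane \<Rightarrow> plane" where
  "grad_potential v x =
     - (1 / (2 * pi)) *\<^sub>R (LINT y|lborel. (v y / (norm (x - y))\<^sup>2) *\<^sub>R (x - y))"

definition div_distr :: "(plane \<Rightarrow> plane) \<Rightarrow> distr" where
  "div_distr F \<psi> = - (\<Sum>i\<in>UNIV. LINT y|lborel. F y $ i * pd i \<psi> y)"

definition debye_flux :: "(plane \<Rightarrow> real) \<Rightarrow> plane \<Rightarrow> plane" where
  "debye_flux v x = v x *\<^sub>R grad_potential v x"

text \<open>The mild formulation is an identity of tempered distributions, the time integral being
  taken in the weak sense (tested against Schwartz functions).\<close>

definition duhamel_integrand :: "(real \<Rightarrow> distr) \<Rightarrow> real \<Rightarrow> real \<Rightarrow> distr" where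
  "duhamel_integrand u t \<tau> =
     distr_of (heat (t - \<tau>) (div_distr (debye_flux (density_of (u \<tau>)))))"

definition mild_solution :: "distr \<Rightarrow> (real \<Rightarrow> distr) \<Rightarrow> bool" where
  "mild_solution u0 u \<longleftrightarrow>
     (\<forall>t>0. \<forall>\<phi>\<in>schwartz.
        set_integrable lebesgue {0<..<t} (\<lambda>\<tau>. duhamel_integrand u t \<tau> \<phi>) \<and>
        u t \<phi> = distr_of (heat t u0) \<phi> +
          (LINT \<tau>:{0<..<t}|lebesgue. duhamel_integrand u t \<tau> \<phi>))"

section \<open>The self-similar solution of mass \<open>M\<close>\<close>

text \<open>The profile \<open>\<xi>\<close> of class \<open>C\<^sup>1\<close> on \<open>[0,\<infinity>)\<close> and \<open>C\<^sup>2\<close> on \<open>(0,\<infinity>)\<close>, together with its derivative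
  \<open>\<xi>'\<close> (one-sided at \<open>0\<close>); both are irrelevant at negative arguments.\<close>

definition debye_profile :: "real \<Rightarrow> (real \<Rightarrow> real) \<Rightarrow> (real \<Rightarrow> real) \<Rightarrow> bool" where
  "debye_profile M \<xi> \<xi>' \<longleftrightarrow>
     (\<forall>y\<ge>0. (\<xi> has_real_derivative \<xi>' y) (at y within {0..})) \<and>
     continuous_on {0..} \<xi>' \<and>
     (\<exists>\<xi>''. continuous_on {0<..} \<xi>'' \<and>
        (\<forall>y>0. (\<xi>' has_real_derivative \<xi>'' y) (at y) \<and>
               \<xi>'' y + 1/4 * \<xi>' y - 1 / (2 * y) * \<xi> y * \<xi>' y = 0)) \<and>
     \<xi> 0 = 0 \<and>
     (\<xi> \<longlongrightarrow> M / (2 * pi)) at_top"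

text \<open>The radial self-similar solution with datum \<open>M \<delta>\<^sub>0\<close>: its mass in the disc of radius \<open>r\<close>
  at time \<open>t\<close> is \<open>2 \<pi> \<xi>(r\<^sup>2 / t)\<close>, so differentiating in \<open>r\<close> gives the density below.\<close>

definition debye_self_similar :: "real \<Rightarrow> (real \<Rightarrow> plane \<Rightarrow> real) \<Rightarrow> bool" where
  "debye_self_similar M U \<longleftrightarrow>
     (\<exists>\<xi> \<xi>'. debye_profile M \<xi> \<xi>' \<and>
        (\<forall>t>0. \<forall>x. U t x = 2 / t * \<xi>' ((norm x)\<^sup>2 / t)))"

lemma debye_self_similar_scaling:
  assumes "debye_self_similar M U" "l > 0" "t > 0"
  shows "l\<^sup>2 * U (l\<^sup>2 * t) (l *\<^sub>R x) = U t x"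
  using assms by (auto simp: debye_self_similar_def power_mult_distrib)

end

theory Submission
  imports Defs
begin

text \<open>The bilinear term gains from smallness: by the Hardy--Littlewood--Sobolev inequality the flux
  \<open>u \<nabla>\<phi>\<^sub>u\<close> is quadratic from \<open>L\<^bsup>4/3\<^esup>\<close> to \<open>L\<^sup>1\<close>, and \<open>\<parallel>\<nabla>G\<^sub>t\<parallel>\<^bsub>4/3\<^esub> \<le> C t\<^bsup>-3/4\<^esup>\<close>. The profile \<open>\<xi>\<close> satisfies
  \<open>0 \<le> \<xi>' \<le> M/(8\<pi>)\<close>, so \<open>U\<^sub>M\<close> obeys the bounds of a heat kernel of mass \<open>M\<close>, and the hypothesis on \<open>u\<^sub>0\<close>
  forces \<open>M \<le> 8\<epsilon>\<close>. By Newton's theorem the flux of \<open>U\<^sub>M\<close> is \<open>-\<nabla>U\<^sub>M - x U\<^sub>M/(2t)\<close>, from which \<open>U\<^sub>M\<close>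
  satisfies the Duhamel formula with initial datum \<open>M \<delta>\<^sub>0\<close>. Subtracting the two formulas, \<open>w = u - U\<^sub>M\<close>
  satisfies
  \<open>\<parallel>w(t)\<parallel>\<^bsub>4/3\<^esub> \<le> \<parallel>S(t)u\<^sub>0 - M G\<^sub>t\<parallel>\<^bsub>4/3\<^esub> + C \<epsilon> \<integral>\<^sub>0\<^sup>t (t-\<tau>)\<^bsup>-3/4\<^esup> \<tau>\<^bsup>-1/4\<^esup> \<parallel>w(\<tau>)\<parallel>\<^bsub>4/3\<^esub> d\<tau>\<close>. The first term is
  \<open>o(t\<^bsup>-1/4\<^esup>)\<close>, hence an eventual bound \<open>\<parallel>w(t)\<parallel>\<^bsub>4/3\<^esub> \<le> b t\<^bsup>-1/4\<^esup>\<close> improves to \<open>3/4 b\<close>, and one iterates.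
  The inequality is used only in weak form, tested against Schwartz functions, because \<open>\<tau> \<mapsto> w(\<tau>)\<close> need
  not be jointly measurable.\<close>

section \<open>Radial integrals\<close>

text \<open>Working only with tested identities has a price: the L^(4/3) norm of w must be recovered
  by duality with L^4, so every constant may depend on the test function psi only through its L^4
  norm and must be uniform in the mollification parameter s. This is why the gradient of the kernel
  is measured in L^(4/3) and paired with psi. The datum M delta_0 is never handled as a
  distribution. Substituting y = sqrt(tau) z freezes the density of U_M at time 1 and moves all
  dependence on tau into the test function. At tau = 0 that function is evaluated at the origin
  only, and the mass M factors out. The iteration closes because the integral of (t - tau)^(-3/4)
  tau^(-1/2) over (0, t) is of order t^(-1/4), while times before a fixed T contribute o(t^(-1/4));
  only the eventual bound b is fed back. The smallness 1/30000 is the room that the flux constant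
  108, the sizes 2 epsilon + 8 epsilon and the integral constant 12 require; constants are rounded
  up generously on the way.\<close>

lemma distr_norm_sq:
  "distr lborel borel (\<lambda>x::plane. (norm x)\<^sup>2) = density lborel (\<lambda>s. ennreal pi * indicator {0..} s)"
\<comment> \<open>Half-lines generate the Borel sets, and for nonnegative \<open>a\<close> the
  preimage of \<open>{..a}\<close> is a disc of area pi a; hence the constant density pi.\<close>
proof (rule measure_eqI_generator_eq[where E="range (\<lambda>a::real. {..a})" and \<Omega>=UNIV and A="\<lambda>i. {..real i}"])
  show "Int_stable (range (\<lambda>a::real. {..a}))"
    by (auto simp: Int_stable_def)
  fix X assume "X \<in> range (\<lambda>a::real. {..a})"
  then obtain a where X: "X = {..a}" by auto
  show "emeasure (distr lborel borel (\<lambda>x::plane. (norm x)\<^sup>2)) X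
      = emeasure (density lborel (\<lambda>s. ennreal pi * indicator {0..} s)) X"
  proof (cases "a \<ge> 0")
    case True
    have "(\<lambda>x::plane. (norm x)\<^sup>2) -` {..a} = cball 0 (sqrt a)"
      using True by (auto simp: real_le_rsqrt sqrt_ge_absD real_sqrt_le_iff 
          real_sqrt_unique norm_eq_sqrt_inner power2_norm_eq_inner real_sqrt_le_mono)
    then have "emeasure (distr lborel borel (\<lambda>x::plane. (norm x)\<^sup>2)) X = ennreal (pi * a)"
      unfolding X using True
      by (subst emeasure_distr) (auto simp: emeasure_cball unit_ball_vol_2)
    moreover have "emeasure (density lborel (\<lambda>s. ennreal pi * indicator {0..} s)) X
        = (\<integral>\<^sup>+s. ennreal pi * indicator {0..a} s \<partial>lborel)"
      unfolding X by (subst emeasure_density)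
        (auto intro!: nn_integral_cong split: split_indicator)
    ultimately show ?thesis using True
      by (simp add: nn_integral_cmult ennreal_mult)
  next
    case False
    then have "(\<lambda>x::plane. (norm x)\<^sup>2) -` {..a} = {}"
      by (auto simp: not_le) (smt (verit) zero_le_power2)
    then have "emeasure (distr lborel borel (\<lambda>x::plane. (norm x)\<^sup>2)) X = 0"
      unfolding X by (subst emeasure_distr) auto
    moreover have "(\<lambda>s. ennreal pi * indicator {0..} s * indicator {..a} s) = (\<lambda>_. 0)"
      using False by (auto split: split_indicator)
    then have "emeasure (density lborel (\<lambda>s. ennreal pi * indicator {0..} s)) X = 0"
      unfolding X by (subst emeasure_density) (simp_all only: nn_integral_const, auto)
    ultimately show ?thesis by simp
  qed
next
  show "sets (distr lborel borel (\<lambda>x::plane. (norm x)\<^sup>2)) = sigma_sets UNIV (range (\<lambda>a::real. {..a}))"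
    by (simp add: borel_eq_atMost)
  show "sets (density lborel (\<lambda>s. ennreal pi * indicator {0..} s)) = sigma_sets UNIV (range (\<lambda>a::real. {..a}))"
    by (simp add: borel_eq_atMost)
  show "range (\<lambda>i. {..real i}) \<subseteq> range (\<lambda>a::real. {..a})" by auto
  show "(\<Union>i. {..real i}) = UNIV"
    by (auto simp: real_arch_simple)
  show "emeasure (distr lborel borel (\<lambda>x::plane. (norm x)\<^sup>2)) {..real i} \<noteq> \<infinity>" for i
  proof -
    have "(\<lambda>x::plane. (norm x)\<^sup>2) -` {..real i} = cball 0 (sqrt (real i))"
      by (auto simp: real_le_rsqrt sqrt_ge_absD norm_eq_sqrt_inner power2_norm_eq_inner)
    then show ?thesis
      by (subst emeasure_distr) (auto simp: emeasure_cball)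
  qed
qed auto

lemma nn_integral_radial:
  assumes [measurable]: "F \<in> borel_measurable borel"
  shows "(\<integral>\<^sup>+x. F ((norm (x::plane))\<^sup>2) \<partial>lborel) = ennreal pi * (\<integral>\<^sup>+s. F s * indicator {0..} s \<partial>lborel)"
proof -
  have "(\<integral>\<^sup>+x. F ((norm (x::plane))\<^sup>2) \<partial>lborel) = (\<integral>\<^sup>+s. F s \<partial>distr lborel borel (\<lambda>x::plane. (norm x)\<^sup>2))"
    by (subst nn_integral_distr) auto
  also have "\<dots> = (\<integral>\<^sup>+s. ennreal pi * (F s * indicator {0..} s) \<partial>lborel)"
    unfolding distr_norm_sq by (subst nn_integral_density) (auto intro!: nn_integral_cong simp: mult_ac)
  finally show ?thesis by (simp add: nn_integral_cmult)
qed

lemma nn_integral_exp_neg: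
  assumes "k > 0"
  shows "(\<integral>\<^sup>+s. ennreal (exp (- k * s)) * indicator {0..} s \<partial>lborel) = ennreal (1 / k)"
proof -
  have "(\<integral>\<^sup>+s. ennreal (exp (- k * s)) * indicator {0..} s \<partial>lborel) = ennreal (0 - (- exp (- k * 0) / k))"
  proof (rule nn_integral_FTC_atLeast)
    show "((\<lambda>x. - exp (- k * x) / k) \<longlongrightarrow> 0) at_top"
    proof -
      have "filterlim (\<lambda>x. - k * x) at_bot at_top"
        using assms by (intro filterlim_tendsto_neg_mult_at_bot[OF tendsto_const _ filterlim_ident]) auto
      then have "((\<lambda>x. exp (- k * x)) \<longlongrightarrow> 0) at_top"
        using exp_at_bot filterlim_compose by blast
      from tendsto_mult_right[OF this, of "- 1 / k"] show ?thesis by simp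
    qed
  qed (use assms in \<open>auto intro!: derivative_eq_intros\<close>)
  then show ?thesis by simp
qed

lemma nn_integral_lborel_translate:
  fixes a :: "'a::euclidean_space"
  assumes [measurable]: "F \<in> borel_measurable borel"
  shows "(\<integral>\<^sup>+x. F (x - a) \<partial>lborel) = (\<integral>\<^sup>+x. F x \<partial>lborel)"
proof -
  have "(\<integral>\<^sup>+x. F (x - a) \<partial>lborel) = (\<integral>\<^sup>+x. F (x - a) \<partial>distr lborel borel ((+) a))"
    by (simp add: lborel_distr_plus)
  also have "\<dots> = (\<integral>\<^sup>+x. F x \<partial>lborel)"
    by (subst nn_integral_distr) auto
  finally show ?thesis .
qed

lemma nn_integral_gaussian:
  assumes "k > 0"
  shows "(\<integral>\<^sup>+x. ennreal (exp (- k * (norm (x - a :: plane))\<^sup>2)) \<partial>lborel) = ennreal (pi / k)"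
proof -
  have "(\<integral>\<^sup>+x. ennreal (exp (- k * (norm (x - a :: plane))\<^sup>2)) \<partial>lborel)
     = (\<integral>\<^sup>+x. ennreal (exp (- k * (norm (x :: plane))\<^sup>2)) \<partial>lborel)"
    by (rule nn_integral_lborel_translate) auto
  also have "\<dots> = ennreal pi * ennreal (1 / k)"
    using nn_integral_radial[of "\<lambda>s. ennreal (exp (- k * s))"] nn_integral_exp_neg[OF assms] by simp
  finally show ?thesis using assms by (simp add: ennreal_mult[symmetric])
qed

section \<open>The Hardy--Littlewood--Sobolev inequality\<close>

definition L43_bound :: "(plane \<Rightarrow> real) \<Rightarrow> real \<Rightarrow> bool" where
  "L43_bound f A \<longleftrightarrow> f \<in> borel_measurable borel \<and>
     (\<integral>\<^sup>+x. ennreal (\<bar>f x\<bar> powr (4/3)) \<partial>lborel) \<le> ennreal (A powr (4/3))"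

text \<open>A direct proof of the diagonal Hardy--Littlewood--Sobolev inequality for \<open>1/\<bar>x - y\<bar>\<close>: if \<open>a\<close> or
  \<open>b\<close> exceeds \<open>r\<^bsup>-3/2\<^esup>\<close>, apply Young's inequality with exponents \<open>4/3\<close> and \<open>4\<close> to \<open>ab \<cdot> (1/r)\<close>, and
  otherwise \<open>ab \<le> (a\<^sup>2 + b\<^sup>2)/2\<close>. In both cases the error depends on one of the two functions only and
  can be integrated out in the other variable.\<close>

definition hls_kernel :: "real \<Rightarrow> real \<Rightarrow> real" where
  "hls_kernel a r = min (a\<^sup>2 / r) (1 / r ^ 4) / 2"

lemma hls_kernel_nonneg: "r \<ge> 0 \<Longrightarrow> hls_kernel a r \<ge> 0"
  by (simp add: hls_kernel_def)

lemma hls_pointwise: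
  assumes "a \<ge> 0" "b \<ge> 0" "r \<ge> 0"
  shows "a * b / r \<le> 3/4 * (a powr (4/3) * b powr (4/3)) + hls_kernel a r + hls_kernel b r"
proof (cases "r = 0")
  case False
  with assms have r: "r > 0" by simp
  show ?thesis
  proof (cases "a\<^sup>2 / r \<le> 1 / r ^ 4 \<and> b\<^sup>2 / r \<le> 1 / r ^ 4")
    case True
    have "a * b / r \<le> (a\<^sup>2 + b\<^sup>2) / 2 / r"
      using r sum_squares_bound[of a b] by (intro divide_right_mono) auto
    also have "\<dots> = hls_kernel a r + hls_kernel b r"
      using True by (simp add: hls_kernel_def min_def add_divide_distrib)
    moreover have "0 \<le> 3/4 * (a powr (4/3) * b powr (4/3))" by simp
    ultimately show ?thesis by linarith
  next
    case False
    have "a * b * (1 / r) \<le> (a * b) powr (4/3) / (4/3) + (1 / r) powr 4 / 4"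
      using assms r by (intro Youngs_inequality) auto
    also have "(1 / r) powr 4 = 1 / r ^ 4"
      using r by (simp add: powr_divide)
    finally have *: "a * b / r \<le> 3/4 * (a powr (4/3) * b powr (4/3)) + 1 / r ^ 4 / 4"
      using assms by (simp add: powr_mult)
    define q where "q = 1 / r ^ 4"
    \<comment> \<open>Whichever of \<open>a\<close>, \<open>b\<close> exceeds the threshold has its
      minimum equal to \<open>q\<close>, so its kernel alone is \<open>q / 2\<close>, more than the
      \<open>q / 4\<close> left by Young's inequality.\<close>
    have "q / 2 \<le> hls_kernel a r + hls_kernel b r"
      using False r hls_kernel_nonneg[of r a] hls_kernel_nonneg[of r b]
      by (auto simp: hls_kernel_def min_def q_def)
    moreover have "q \<ge> 0" using r by (simp add: q_def)
    ultimately show ?thesis using *[folded q_def] by linarith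
  qed
\<comment> \<open>For \<open>r = 0\<close> the left side is 0, because division by zero yields 0;
  the diagonal needs no separate treatment later.\<close>
qed (use hls_kernel_nonneg[of r] assms in simp)

text \<open>Near the origin the branch \<open>a\<^sup>2 / r\<close> is integrable, far away
  \<open>1 / r ^ 4\<close> is. Scaling then forces the power 4/3 of \<open>a\<close>, exactly the
  one integrated in the L^(4/3) norm.\<close>

lemma nn_integral_hls_kernel:
  assumes "a \<ge> 0"
  shows "(\<integral>\<^sup>+z. ennreal (hls_kernel a (norm (z::plane))) \<partial>lborel) \<le> ennreal (3 * pi / 2 * a powr (4/3))"
proof (cases "a = 0")
  case True
  then show ?thesis by (simp add: hls_kernel_def min_def)
next
  case False
  with assms have a: "a > 0" by simp
  \<comment> \<open>Square of the radius a^(-2/3) at which the two branches of the minimum agree;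
    squared because the radial integral runs over s = |z|^2.\<close>
  define \<rho> where "\<rho> = a powr (- 4/3)"
  have \<rho>: "\<rho> > 0" using a by (simp add: \<rho>_def)
  have [measurable]: "(\<lambda>s. hls_kernel a (sqrt s)) \<in> borel_measurable borel"
    unfolding hls_kernel_def by measurable
  have i1: "(\<integral>\<^sup>+s. indicator {0..\<rho>} s * ennreal (a\<^sup>2 / 2 * s powr (-1/2)) \<partial>lborel)
      = ennreal (a\<^sup>2 / 2 * (\<rho> powr (-1/2 + 1) / (-1/2 + 1)))"
    using nn_integral_has_integral_lebesgue[of "{0..\<rho>}" "\<lambda>s. a\<^sup>2 / 2 * s powr (-1/2)" "a\<^sup>2 / 2 * (\<rho> powr (-1/2 + 1) / (-1/2 + 1))"]
      has_integral_mult_right[OF has_integral_powr_from_0[of "-1/2" \<rho>], of "a\<^sup>2 / 2"] \<rho>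
    by (auto simp: indicator_mult_ennreal mult.commute)
  have i2: "(\<integral>\<^sup>+s. ennreal (1 / (2 * s\<^sup>2)) * indicator {\<rho>..} s \<partial>lborel) = ennreal (0 - (- 1 / (2 * \<rho>)))"
  proof (rule nn_integral_FTC_atLeast)
    show "((\<lambda>x::real. - 1 / (2 * x)) \<longlongrightarrow> 0) at_top"
      by real_asymp
  qed (use \<rho> in \<open>auto intro!: derivative_eq_intros simp: power2_eq_square field_simps\<close>)
  have "(\<integral>\<^sup>+z. ennreal (hls_kernel a (norm (z::plane))) \<partial>lborel)
      = (\<integral>\<^sup>+z. ennreal (hls_kernel a (sqrt ((norm (z::plane))\<^sup>2))) \<partial>lborel)"
    by simp
  also have "\<dots> = ennreal pi * (\<integral>\<^sup>+s. ennreal (hls_kernel a (sqrt s)) * indicator {0..} s \<partial>lborel)"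
    by (rule nn_integral_radial) measurable
  also have "\<dots> \<le> ennreal pi * (\<integral>\<^sup>+s. indicator {0..\<rho>} s * ennreal (a\<^sup>2 / 2 * s powr (-1/2))
       + ennreal (1 / (2 * s\<^sup>2)) * indicator {\<rho>..} s \<partial>lborel)"
  proof (intro mult_left_mono nn_integral_mono)
    fix s :: real
    show "ennreal (hls_kernel a (sqrt s)) * indicator {0..} s
      \<le> indicator {0..\<rho>} s * ennreal (a\<^sup>2 / 2 * s powr (-1/2)) + ennreal (1 / (2 * s\<^sup>2)) * indicator {\<rho>..} s"
    proof (cases "s \<ge> 0")
      case s: True
      have 1: "hls_kernel a (sqrt s) \<le> a\<^sup>2 / 2 * s powr (-1/2)"
        using s by (auto simp: hls_kernel_def powr_minus powr_half_sqrt field_simps intro: min.coboundedI1)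
      have "sqrt s ^ 4 = s\<^sup>2"
        using s by (metis mult_2 numeral_Bit0 power_mult real_sqrt_pow2 power_add power2_eq_square)
      then have 2: "hls_kernel a (sqrt s) \<le> 1 / (2 * s\<^sup>2)"
        by (simp add: hls_kernel_def)
      show ?thesis
        using s 1 2 by (cases "s \<le> \<rho>") (auto simp: ennreal_leI add_increasing2)
    qed simp
  qed simp
  also have "\<dots> = ennreal pi * (ennreal (a\<^sup>2 / 2 * (\<rho> powr (-1/2 + 1) / (-1/2 + 1))) + ennreal (0 - (- 1 / (2 * \<rho>))))"
    by (subst nn_integral_add) (simp_all add: i1[simplified] i2[simplified])
  also have "\<dots> = ennreal (pi * (a\<^sup>2 * \<rho> powr (1/2) + 1 / (2 * \<rho>)))"
  proof -
    have "ennreal pi * (ennreal p + ennreal q) = ennreal (pi * (p + q))" if "p \<ge> 0" "q \<ge> 0" for p q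
      using that by (subst ennreal_plus[symmetric]) (auto simp: ennreal_mult simp del: ennreal_plus)
    from this[of "a\<^sup>2 * \<rho> powr (1/2)" "1 / (2 * \<rho>)"] show ?thesis using \<rho> by simp
  qed
  also have "a\<^sup>2 * \<rho> powr (1/2) = a powr (4/3)"
    using a by (simp add: \<rho>_def powr_powr flip: powr_numeral powr_add)
  also have "1 / (2 * \<rho>) = a powr (4/3) / 2"
    using a by (simp add: \<rho>_def powr_minus field_simps)
  finally show ?thesis by (simp add: field_simps)
qed

definition hls_form :: "(plane \<Rightarrow> real) \<Rightarrow> (plane \<Rightarrow> real) \<Rightarrow> ennreal" where
  "hls_form f g = (\<integral>\<^sup>+x. \<integral>\<^sup>+y. ennreal (\<bar>f x\<bar> * \<bar>g y\<bar> / norm (x - y)) \<partial>lborel \<partial>lborel)"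

text \<open>The product term contributes at most 3/4. Each kernel term depends on one function only,
  so integrating out the other variable leaves at most 3 pi / 2, twice.\<close>

lemma hls_form_normalized:
  assumes "L43_bound f 1" "L43_bound g 1"
  shows "hls_form f g \<le> ennreal (3/4 + 3 * pi)"
proof -
  have [measurable]: "f \<in> borel_measurable borel" "g \<in> borel_measurable borel"
    using assms by (auto simp: L43_bound_def)
  have f1: "(\<integral>\<^sup>+x. ennreal (\<bar>f x\<bar> powr (4/3)) \<partial>lborel) \<le> 1"
    and g1: "(\<integral>\<^sup>+x. ennreal (\<bar>g x\<bar> powr (4/3)) \<partial>lborel) \<le> 1"
    using assms by (auto simp: L43_bound_def)
  have [measurable]: "(\<lambda>x. hls_kernel (h x) (k x)) \<in> borel_measurable M"
    if "h \<in> borel_measurable M" "k \<in> borel_measurable M" for h k and M :: "'x measure"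
    using that unfolding hls_kernel_def by measurable
  let ?T1 = "\<lambda>x y. ennreal (3/4) * (ennreal (\<bar>f x\<bar> powr (4/3)) * ennreal (\<bar>g y\<bar> powr (4/3)))"
  let ?T2 = "\<lambda>x y. ennreal (hls_kernel \<bar>f x\<bar> (norm (y - x)))"
  let ?T3 = "\<lambda>x y. ennreal (hls_kernel \<bar>g y\<bar> (norm (x - y)))"
  have ker: "(\<integral>\<^sup>+y. ennreal (hls_kernel \<bar>a\<bar> (norm (y - x :: plane))) \<partial>lborel) \<le> ennreal (3 * pi / 2) * ennreal (\<bar>a\<bar> powr (4/3))"
    for a x using nn_integral_hls_kernel[of "\<bar>a\<bar>"]
      nn_integral_lborel_translate[of "\<lambda>z. ennreal (hls_kernel \<bar>a\<bar> (norm z))" x]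
    by (subst ennreal_mult[symmetric]) auto
  have "hls_form f g \<le> (\<integral>\<^sup>+x. \<integral>\<^sup>+y. ?T1 x y + ?T2 x y + ?T3 x y \<partial>lborel \<partial>lborel)"
    unfolding hls_form_def
  proof (intro nn_integral_mono)
    fix x y
    show "ennreal (\<bar>f x\<bar> * \<bar>g y\<bar> / norm (x - y)) \<le> ?T1 x y + ?T2 x y + ?T3 x y"
      using hls_pointwise[of "\<bar>f x\<bar>" "\<bar>g y\<bar>" "norm (x - y)"] hls_kernel_nonneg
      by (simp add: norm_minus_commute ennreal_leI flip: ennreal_mult ennreal_plus)
  qed
  also have "\<dots> = (\<integral>\<^sup>+x. \<integral>\<^sup>+y. ?T1 x y \<partial>lborel \<partial>lborel) + (\<integral>\<^sup>+x. \<integral>\<^sup>+y. ?T2 x y \<partial>lborel \<partial>lborel)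
      + (\<integral>\<^sup>+x. \<integral>\<^sup>+y. ?T3 x y \<partial>lborel \<partial>lborel)"
    by (simp add: nn_integral_add)
  also have "(\<integral>\<^sup>+x. \<integral>\<^sup>+y. ?T3 x y \<partial>lborel \<partial>lborel) = (\<integral>\<^sup>+y. \<integral>\<^sup>+x. ?T3 x y \<partial>lborel \<partial>lborel)"
    by (rule lborel_pair.Fubini') measurable
  also have "\<dots> \<le> (\<integral>\<^sup>+y. ennreal (3 * pi / 2) * ennreal (\<bar>g y\<bar> powr (4/3)) \<partial>lborel)"
    by (intro nn_integral_mono ker)
  also have "\<dots> = ennreal (3 * pi / 2) * (\<integral>\<^sup>+y. ennreal (\<bar>g y\<bar> powr (4/3)) \<partial>lborel)"
    by (rule nn_integral_cmult) measurable
  also have "\<dots> \<le> ennreal (3 * pi / 2) * 1"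
    by (rule mult_left_mono[OF g1]) simp
  also have "(\<integral>\<^sup>+x. \<integral>\<^sup>+y. ?T2 x y \<partial>lborel \<partial>lborel) \<le> (\<integral>\<^sup>+x. ennreal (3 * pi / 2) * ennreal (\<bar>f x\<bar> powr (4/3)) \<partial>lborel)"
    by (intro nn_integral_mono ker)
  also have "\<dots> = ennreal (3 * pi / 2) * (\<integral>\<^sup>+y. ennreal (\<bar>f y\<bar> powr (4/3)) \<partial>lborel)"
    by (rule nn_integral_cmult) measurable
  also have "\<dots> \<le> ennreal (3 * pi / 2) * 1"
    by (rule mult_left_mono[OF f1]) simp
  also have "(\<integral>\<^sup>+x. \<integral>\<^sup>+y. ?T1 x y \<partial>lborel \<partial>lborel)
      = ennreal (3/4) * ((\<integral>\<^sup>+x. ennreal (\<bar>f x\<bar> powr (4/3)) \<partial>lborel) * (\<integral>\<^sup>+x. ennreal (\<bar>g x\<bar> powr (4/3)) \<partial>lborel))"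
    by (simp add: nn_integral_cmult nn_integral_multc)
  also have "\<dots> \<le> ennreal (3/4) * (1 * 1)"
    by (intro mult_left_mono mult_mono f1 g1) auto
  finally show ?thesis
    by (simp add: add_right_mono add_left_mono add.commute flip: ennreal_plus)
qed

lemma L43_bound_scale:
  assumes "L43_bound f A" "c \<ge> 0" "A \<ge> 0"
  shows "L43_bound (\<lambda>x. c * f x) (c * A)"
proof -
  have [measurable]: "f \<in> borel_measurable borel" using assms by (auto simp: L43_bound_def)
  have "(\<integral>\<^sup>+x. ennreal (\<bar>c * f x\<bar> powr (4/3)) \<partial>lborel) = ennreal (c powr (4/3)) * (\<integral>\<^sup>+x. ennreal (\<bar>f x\<bar> powr (4/3)) \<partial>lborel)"
    using assms by (simp add: abs_mult powr_mult ennreal_mult nn_integral_cmult)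
  also have "\<dots> \<le> ennreal (c powr (4/3)) * ennreal (A powr (4/3))"
    using assms by (intro mult_left_mono) (auto simp: L43_bound_def)
  also have "\<dots> = ennreal ((c * A) powr (4/3))"
    using assms by (simp add: powr_mult ennreal_mult)
  finally show ?thesis by (simp add: L43_bound_def)
qed

text \<open>The pointwise inequality behind the normalized case is not homogeneous in each function,
  so homogeneity is restored by rescaling both to unit norm.\<close>

lemma hardy_littlewood_sobolev:
  assumes "L43_bound f A" "L43_bound g B" "A > 0" "B > 0"
  shows "hls_form f g \<le> ennreal ((3/4 + 3 * pi) * A * B)"
proof -
  have [measurable]: "f \<in> borel_measurable borel" "g \<in> borel_measurable borel"
    using assms by (auto simp: L43_bound_def)
  have "L43_bound (\<lambda>x. 1 / A * f x) 1" "L43_bound (\<lambda>x. 1 / B * g x) 1"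
    using L43_bound_scale[OF assms(1), of "1 / A"] L43_bound_scale[OF assms(2), of "1 / B"] assms
    by auto
  then have "hls_form (\<lambda>x. 1 / A * f x) (\<lambda>x. 1 / B * g x) \<le> ennreal (3/4 + 3 * pi)"
    by (rule hls_form_normalized)
  then have *: "ennreal (A * B) * hls_form (\<lambda>x. 1 / A * f x) (\<lambda>x. 1 / B * g x) \<le> ennreal (A * B) * ennreal (3/4 + 3 * pi)"
    by (intro mult_left_mono) auto
  have "hls_form f g = (\<integral>\<^sup>+x. \<integral>\<^sup>+y. ennreal (A * B) * ennreal (\<bar>1 / A * f x\<bar> * \<bar>1 / B * g y\<bar> / norm (x - y)) \<partial>lborel \<partial>lborel)"
    unfolding hls_form_def using assms(3,4)
    by (intro nn_integral_cong) (simp add: abs_mult flip: ennreal_mult)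
  also have "\<dots> = ennreal (A * B) * hls_form (\<lambda>x. 1 / A * f x) (\<lambda>x. 1 / B * g x)"
    unfolding hls_form_def by (simp add: nn_integral_cmult)
  finally have "hls_form f g \<le> ennreal (A * B) * ennreal (3/4 + 3 * pi)"
    using * by simp
  also have "\<dots> = ennreal ((3/4 + 3 * pi) * A * B)"
    using assms(3,4) by (subst ennreal_mult[symmetric]) (auto simp: mult_ac)
  finally show ?thesis .
qed

section \<open>Schwartz functions and the heat kernel\<close>

text \<open>A bound on \<open>f'\<close> over a whole neighbourhood, rather than at
  \<open>x0\<close> alone, controls the difference quotients through the mean value inequality;
  dominated convergence along sequences does the rest.\<close>

lemma has_derivative_integral:
  fixes f :: "'x::real_normed_vector \<Rightarrow> 'y \<Rightarrow> real"
  assumes U: "open U" "x0 \<in> U"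
    and int: "\<And>x. x \<in> U \<Longrightarrow> integrable M (f x)"
    and der: "\<And>x y. x \<in> U \<Longrightarrow> y \<in> space M \<Longrightarrow> ((\<lambda>x. f x y) has_derivative f' x y) (at x)"
    and bound: "\<And>x y h. x \<in> U \<Longrightarrow> y \<in> space M \<Longrightarrow> \<bar>f' x y h\<bar> \<le> B y * norm h"
    and B: "integrable M B"
    and meas [measurable]: "\<And>h. (\<lambda>y. f' x0 y h) \<in> borel_measurable M"
  shows "((\<lambda>x. \<integral>y. f x y \<partial>M) has_derivative (\<lambda>h. \<integral>y. f' x0 y h \<partial>M)) (at x0)"
proof -
  \<comment> \<open>Only a nonzero increment turns the bound on \<open>f'\<close> into a sign for
    \<open>B\<close>. The trivial space is excluded later by the nonzero terms of the
    sequence.\<close>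
  have B0: "0 \<le> B y" if y: "y \<in> space M" and nz: "(UNIV :: 'x set) \<noteq> {0}" for y
  proof -
    obtain h :: 'x where "h \<noteq> 0" using nz by auto
    then show ?thesis using bound[OF U(2) y, of h]
      by (smt (verit) mult_neg_pos zero_less_norm_iff)
  qed
  have int': "integrable M (\<lambda>y. f' x0 y h)" for h
  proof (rule Bochner_Integration.integrable_bound)
    show "integrable M (\<lambda>y. B y * norm h)" using B by simp
    show "AE y in M. norm (f' x0 y h) \<le> norm (B y * norm h)"
      using bound[OF U(2)] by (intro AE_I2) (smt (verit) real_norm_def)
  qed simp
  have lin: "bounded_linear (f' x0 y)" if "y \<in> space M" for y
    using der[OF U(2) that] has_derivative_bounded_linear by blast
  have bl: "bounded_linear (\<lambda>h. \<integral>y. f' x0 y h \<partial>M)"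
  proof (rule bounded_linear_intro[where K="\<integral>y. B y \<partial>M"])
    show "(\<integral>y. f' x0 y (h + k) \<partial>M) = (\<integral>y. f' x0 y h \<partial>M) + (\<integral>y. f' x0 y k \<partial>M)" for h k
    proof -
      have "(\<integral>y. f' x0 y (h + k) \<partial>M) = (\<integral>y. f' x0 y h + f' x0 y k \<partial>M)"
        by (intro Bochner_Integration.integral_cong refl) (metis lin bounded_linear_def linear_add)
      then show ?thesis by (simp add: int')
    qed
    show "(\<integral>y. f' x0 y (r *\<^sub>R h) \<partial>M) = r *\<^sub>R (\<integral>y. f' x0 y h \<partial>M)" for r h
    proof -
      have "(\<integral>y. f' x0 y (r *\<^sub>R h) \<partial>M) = (\<integral>y. r *\<^sub>R f' x0 y h \<partial>M)"
        by (intro Bochner_Integration.integral_cong refl) (metis lin bounded_linear_def linear_cmul)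
      then show ?thesis by simp
    qed
    show "norm (\<integral>y. f' x0 y h \<partial>M) \<le> norm h * (\<integral>y. B y \<partial>M)" for h
    proof -
      have "norm (\<integral>y. f' x0 y h \<partial>M) \<le> (\<integral>y. B y * norm h \<partial>M)"
        using bound[OF U(2)] B int'
        by (intro order_trans[OF integral_norm_bound] Bochner_Integration.integral_mono) auto
      then show ?thesis by (simp add: mult.commute)
    qed
  qed
  obtain e where e: "e > 0" "ball x0 e \<subseteq> U" using U openE by blast
  define q where "q h y = (f (x0 + h) y - f x0 y - f' x0 y h) / norm h" for h y
  have "((\<lambda>h. norm ((\<integral>y. f (x0 + h) y \<partial>M) - (\<integral>y. f x0 y \<partial>M) - (\<integral>y. f' x0 y h \<partial>M)) / norm h) \<longlongrightarrow> 0) (at 0)"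
    unfolding tendsto_at_iff_sequentially
  proof safe
    fix X :: "nat \<Rightarrow> 'x"
    assume X: "\<forall>i. X i \<in> UNIV - {0}" "X \<longlonglongrightarrow> 0"
    have nz: "(UNIV :: 'x set) \<noteq> {0}" using X(1) by blast
    have "eventually (\<lambda>n. norm (X n) < e) sequentially"
      using X(2) e(1) by (auto simp: LIMSEQ_iff eventually_sequentially)
    then obtain N where N: "\<And>n. n \<ge> N \<Longrightarrow> norm (X n) < e" by (auto simp: eventually_sequentially)
    \<comment> \<open>Integrability of \<open>f x\<close> is known on \<open>U\<close> only, so the
      sequence is shifted until it stays there.\<close>
    have inU: "x0 + X (n + N) \<in> U" for n
      using N[of "n + N"] e(2) by (auto simp: dist_norm)
    have "(\<lambda>n. \<integral>y. q (X (n + N)) y \<partial>M) \<longlonglongrightarrow> (\<integral>y. 0 \<partial>M)"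
    proof (rule integral_dominated_convergence[where w="\<lambda>y. 2 * B y"])
      show "(\<lambda>y. q (X (n + N)) y) \<in> borel_measurable M" for n
        using int[OF inU] int[OF U(2)] unfolding q_def by measurable
      show "integrable M (\<lambda>y. 2 * B y)" using B by simp
      show "AE y in M. (\<lambda>n. q (X (n + N)) y) \<longlonglongrightarrow> 0"
      proof (intro AE_I2)
        fix y assume y: "y \<in> space M"
        have "((\<lambda>h. norm (f (x0 + h) y - f x0 y - f' x0 y h) / norm h) \<longlongrightarrow> 0) (at 0)"
          using der[OF U(2) y] unfolding has_derivative_at by auto
        then have "((\<lambda>h. norm (f (x0 + h) y - f x0 y - f' x0 y h) / norm h) \<circ> X) \<longlonglongrightarrow> 0"
          using X unfolding tendsto_at_iff_sequentially by blast
        then have "(\<lambda>n. norm (q (X n) y)) \<longlonglongrightarrow> 0"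
          by (simp add: o_def q_def)
        then have "(\<lambda>n. q (X n) y) \<longlonglongrightarrow> 0" using tendsto_norm_zero_iff by blast
        then show "(\<lambda>n. q (X (n + N)) y) \<longlonglongrightarrow> 0" by (rule LIMSEQ_ignore_initial_segment)
      qed
      show "AE y in M. norm (q (X (n + N)) y) \<le> 2 * B y" for n
      proof (intro AE_I2)
        fix y assume y: "y \<in> space M"
        let ?h = "X (n + N)"
        have h: "norm ?h > 0" using X(1) by auto
        have "norm (f (x0 + ?h) y - f x0 y) \<le> B y * norm (x0 + ?h - x0)"
        proof (rule differentiable_bound[where S="ball x0 e" and f="\<lambda>x. f x y"])
          fix x assume x: "x \<in> ball x0 e"
          then have xU: "x \<in> U" using e by auto
          show "((\<lambda>x. f x y) has_derivative f' x y) (at x within ball x0 e)"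
            using der[OF xU y] by (rule has_derivative_at_withinI)
          show "onorm (f' x y) \<le> B y"
            using bound[OF xU y] by (intro onorm_bound B0[OF y nz]) auto
        qed (use e N[of "n + N"] in \<open>auto simp: dist_norm\<close>)
        then have "\<bar>f (x0 + ?h) y - f x0 y - f' x0 y ?h\<bar> \<le> 2 * B y * norm ?h"
          using bound[OF U(2) y, of ?h] by simp
        then show "norm (q ?h y) \<le> 2 * B y"
          using h by (simp add: q_def divide_le_eq)
      qed
    qed auto
    then have "(\<lambda>n. norm (\<integral>y. q (X (n + N)) y \<partial>M)) \<longlonglongrightarrow> 0"
      using tendsto_norm_zero by fastforce
    moreover have "norm (\<integral>y. q (X (n + N)) y \<partial>M) = norm ((\<integral>y. f (x0 + X (n + N)) y \<partial>M) - (\<integral>y. f x0 y \<partial>M) - (\<integral>y. f' x0 y (X (n + N)) \<partial>M)) / norm (X (n + N))" for n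
      unfolding q_def using int[OF inU] int[OF U(2)] int' by simp
    ultimately show "((\<lambda>h. norm ((\<integral>y. f (x0 + h) y \<partial>M) - (\<integral>y. f x0 y \<partial>M) - (\<integral>y. f' x0 y h \<partial>M)) / norm h) \<circ> X) \<longlonglongrightarrow> 0"
      unfolding o_def by (subst LIMSEQ_offset[where k=N]) auto
  qed
  then show ?thesis
    unfolding has_derivative_at using bl by simp
qed

lemma pd_eq: "(f has_derivative f') (at x) \<Longrightarrow> pd i f x = f' (axis i 1)"
  using frechet_derivative_at[of f f' x] by (simp add: pd_def)

lemma has_derivative_pd:
  assumes "f differentiable (at x)"
  shows "(f has_derivative (\<lambda>h. \<Sum>i\<in>UNIV. pd i f x * h $ i)) (at x)"
proof -
  have d: "(f has_derivative frechet_derivative f (at x)) (at x)"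
    using assms frechet_derivative_works by blast
  then have lin: "linear (frechet_derivative f (at x))"
    by (simp add: has_derivative_linear)
  have "frechet_derivative f (at x) h = (\<Sum>i\<in>UNIV. pd i f x * h $ i)" for h
  proof -
    have "frechet_derivative f (at x) h = frechet_derivative f (at x) (\<Sum>i\<in>UNIV. h $ i *\<^sub>R axis i 1)"
      using basis_expansion[of h] by (simp add: scalar_mult_eq_scaleR)
    then show ?thesis
      by (simp add: linear_sum[OF lin] linear_cmul[OF lin] pd_def mult.commute)
  qed
  then have "frechet_derivative f (at x) = (\<lambda>h. \<Sum>i\<in>UNIV. pd i f x * h $ i)" by auto
  then show ?thesis using d by simp
qed

lemma pds_Cons: "pds (i # js) f = pd i (pds js f)"
  by (simp add: pds_def)

lemma pds_Nil [simp]: "pds [] f = f"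
  by (simp add: pds_def)

lemma schwartz_differentiable: "\<phi> \<in> schwartz \<Longrightarrow> pds js \<phi> differentiable (at x)"
  by (simp add: schwartz_def)

lemma schwartz_decay:
  assumes "\<phi> \<in> schwartz"
  obtains C where "C > 0" "\<And>x. norm x ^ k * \<bar>pds js \<phi> x\<bar> \<le> C"
proof -
  have "bounded (range (\<lambda>x. norm x ^ k * pds js \<phi> x))" using assms by (simp add: schwartz_def)
  then obtain C where "C > 0" "\<And>x. norm (norm x ^ k * pds js \<phi> x) \<le> C"
    by (auto simp: bounded_pos)
  with that show ?thesis by (simp add: abs_mult)
qed

lemma continuous_pds: "\<phi> \<in> schwartz \<Longrightarrow> continuous_on UNIV (pds js \<phi>)"
  using schwartz_differentiable differentiable_imp_continuous_within
  by (metis continuous_at_imp_continuous_on)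

lemma borel_measurable_pds: "\<phi> \<in> schwartz \<Longrightarrow> pds js \<phi> \<in> borel_measurable borel"
  using borel_measurable_continuous_onI continuous_pds by blast

lemma sum_axis_plane: "(\<Sum>i\<in>UNIV. F i * (axis j (1::real) :: plane) $ i) = F j"
proof -
  have "(\<Sum>i\<in>UNIV. F i * (axis j (1::real) :: plane) $ i) = (\<Sum>i\<in>UNIV. if i = j then F i else 0)"
    by (intro sum.cong) (auto simp: axis_def)
  then show ?thesis by simp
qed

lemma has_derivative_convolution:
  assumes Q: "Q \<in> schwartz" and \<psi>: "integrable lborel \<psi>"
  shows "((\<lambda>x. LINT y|lborel. \<psi> y * pds js Q (x - y)) has_derivative
     (\<lambda>h. LINT y|lborel. \<psi> y * (\<Sum>i\<in>UNIV. pds (i # js) Q (x - y) * h $ i))) (at x)"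
proof -
  note [measurable] = borel_measurable_pds[OF Q]
  have [measurable]: "\<psi> \<in> borel_measurable borel" using \<psi> by auto
  obtain C0 where C0: "C0 > 0" "\<And>x. \<bar>pds js Q x\<bar> \<le> C0"
    using schwartz_decay[OF Q, of 0 js] by auto
  have "\<exists>C. C > 0 \<and> (\<forall>x. \<bar>pds (i # js) Q x\<bar> \<le> C)" for i
    using schwartz_decay[OF Q, of 0 "i # js"] by (metis power_0 mult_1)
  then obtain C where C: "\<And>i. C i > 0" "\<And>i x. \<bar>pds (i # js) Q x\<bar> \<le> C i" by metis
  show ?thesis
  proof (rule has_derivative_integral[where U=UNIV and B="\<lambda>y. \<bar>\<psi> y\<bar> * (\<Sum>i\<in>UNIV. C i)"])
    show "integrable lborel (\<lambda>y. \<psi> y * pds js Q (x - y))" for x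
    proof (rule Bochner_Integration.integrable_bound)
      show "integrable lborel (\<lambda>y. \<psi> y * C0)" using \<psi> by simp
    qed (use C0 in \<open>auto simp: abs_mult intro!: mult_left_mono\<close>)
    show "((\<lambda>x. \<psi> y * pds js Q (x - y)) has_derivative (\<lambda>h. \<psi> y * (\<Sum>i\<in>UNIV. pds (i # js) Q (x - y) * h $ i))) (at x)" for x y
    proof -
      have "((\<lambda>x. x - y) has_derivative (\<lambda>h. h)) (at x)"
        by (auto intro!: derivative_eq_intros)
      from has_derivative_compose[OF this has_derivative_pd[OF schwartz_differentiable[OF Q, of js "x - y"]]]
      show ?thesis by (intro has_derivative_mult_right) (simp add: pds_Cons)
    qed
    show "\<bar>\<psi> y * (\<Sum>i\<in>UNIV. pds (i # js) Q (x - y) * h $ i)\<bar> \<le> \<bar>\<psi> y\<bar> * (\<Sum>i\<in>UNIV. C i) * norm h" for x y h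
    proof -
      have "\<bar>\<Sum>i\<in>UNIV. pds (i # js) Q (x - y) * h $ i\<bar> \<le> (\<Sum>i\<in>UNIV. C i * norm h)"
        using C(2) component_le_norm_cart[of h] less_imp_le[OF C(1)]
        by (intro sum_abs[THEN order_trans] sum_mono) (auto simp: abs_mult intro!: mult_mono)
      then show ?thesis
        by (simp add: abs_mult mult_left_mono sum_distrib_right mult.assoc)
    qed
    show "integrable lborel (\<lambda>y. \<bar>\<psi> y\<bar> * (\<Sum>i\<in>UNIV. C i))" using \<psi> by simp
  qed auto
qed

text \<open>All derivatives fall on the Schwartz factor, so \<open>\<psi>\<close> enters only
  through its integrability.\<close>

lemma pds_convolution:
  assumes Q: "Q \<in> schwartz" and \<psi>: "integrable lborel \<psi>"
  shows "pds js (\<lambda>x. LINT y|lborel. \<psi> y * Q (x - y)) = (\<lambda>x. LINT y|lborel. \<psi> y * pds js Q (x - y))"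
proof (induction js)
  case (Cons i js)
  show ?case
    unfolding pds_Cons[of i js "\<lambda>x. LINT y|lborel. \<psi> y * Q (x - y)"] Cons
    by (rule ext, subst pd_eq[OF has_derivative_convolution[OF Q \<psi>]]) (simp only: sum_axis_plane)
qed simp

text \<open>On the support of \<open>\<psi>\<close>, |x| is at most twice the larger of |x - y| and
  |R|, so the polynomial weight is transferred from x to the argument of \<open>Q\<close>.\<close>

lemma convolution_schwartz:
  assumes Q: "Q \<in> schwartz" and \<psi>: "integrable lborel \<psi>" and R: "\<And>x. norm x > R \<Longrightarrow> \<psi> x = 0"
  shows "(\<lambda>x. LINT y|lborel. \<psi> y * Q (x - y)) \<in> schwartz"
  unfolding schwartz_def
proof (intro CollectI allI conjI)
  note [measurable] = borel_measurable_pds[OF Q]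
  have [measurable]: "\<psi> \<in> borel_measurable borel" using \<psi> by auto
  fix js k
  show "pds js (\<lambda>x. LINT y|lborel. \<psi> y * Q (x - y)) differentiable at x" for x
    unfolding pds_convolution[OF Q \<psi>]
    using has_derivative_convolution[OF Q \<psi>] differentiable_def by blast
  obtain C0 where C0: "C0 > 0" "\<And>x. \<bar>pds js Q x\<bar> \<le> C0"
    using schwartz_decay[OF Q, of 0 js] by auto
  obtain C where C: "C > 0" "\<And>x. norm x ^ k * \<bar>pds js Q x\<bar> \<le> C"
    using schwartz_decay[OF Q, of k js] by auto
  define K where "K = 2 ^ k * (C + \<bar>R\<bar> ^ k * C0)"
  have "\<bar>norm x ^ k * (LINT y|lborel. \<psi> y * pds js Q (x - y))\<bar> \<le> (LINT y|lborel. \<bar>\<psi> y\<bar> * K)" for x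
  proof -
    have "norm x ^ k * \<bar>\<psi> y * pds js Q (x - y)\<bar> \<le> \<bar>\<psi> y\<bar> * K" for y
    proof (cases "norm y \<le> R")
      case True
      have "norm x \<le> norm (x - y) + norm y" by (metis diff_add_cancel norm_triangle_ineq)
      then have "norm x \<le> 2 * max (norm (x - y)) \<bar>R\<bar>" using True by linarith
      then have "norm x ^ k \<le> (2 * max (norm (x - y)) \<bar>R\<bar>) ^ k" by (intro power_mono) auto
      also have "\<dots> \<le> 2 ^ k * (norm (x - y) ^ k + \<bar>R\<bar> ^ k)"
        by (auto simp: power_mult_distrib max_def)
      finally have "norm x ^ k * \<bar>pds js Q (x - y)\<bar> \<le> 2 ^ k * (norm (x - y) ^ k + \<bar>R\<bar> ^ k) * \<bar>pds js Q (x - y)\<bar>"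
        by (intro mult_right_mono) auto
      also have "\<dots> = 2 ^ k * (norm (x - y) ^ k * \<bar>pds js Q (x - y)\<bar> + \<bar>R\<bar> ^ k * \<bar>pds js Q (x - y)\<bar>)"
        by (simp add: algebra_simps)
      also have "\<dots> \<le> K"
        unfolding K_def using C0(2) C(2) by (intro mult_left_mono add_mono) auto
      finally have "\<bar>\<psi> y\<bar> * (norm x ^ k * \<bar>pds js Q (x - y)\<bar>) \<le> \<bar>\<psi> y\<bar> * K"
        by (intro mult_left_mono) auto
      then show ?thesis by (simp add: abs_mult mult_ac)
    qed (use R in auto)
    note le = this
    have "norm (LINT y|lborel. norm x ^ k * (\<psi> y * pds js Q (x - y))) \<le> (LINT y|lborel. \<bar>\<psi> y\<bar> * K)"
    proof (intro Bochner_Integration.integral_norm_bound_integral)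
      show "integrable lborel (\<lambda>y. norm x ^ k * (\<psi> y * pds js Q (x - y)))"
      proof (intro integrable_mult_right, rule Bochner_Integration.integrable_bound)
        show "integrable lborel (\<lambda>y. \<psi> y * C0)" using \<psi> by simp
      qed (use C0 in \<open>auto simp: abs_mult intro!: mult_left_mono\<close>)
    qed (use \<psi> le in \<open>auto simp: abs_mult\<close>)
    then show ?thesis by simp
  qed
  then show "bounded (range (\<lambda>x. norm x ^ k * pds js (\<lambda>x. LINT y|lborel. \<psi> y * Q (x - y)) x))"
    unfolding pds_convolution[OF Q \<psi>] by (auto simp: bounded_iff)
qed

section \<open>Polynomials times Gaussians are Schwartz functions\<close>

lemma real_polynomial_function_has_derivative:
  fixes p :: "'a::real_normed_vector \<Rightarrow> real"
  assumes "real_polynomial_function p"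
  shows "\<exists>p'. \<forall>x. (p has_derivative p' x) (at x) \<and> (\<forall>h. real_polynomial_function (\<lambda>x. p' x h))"
  using assms
proof induction
  case (linear f)
  then show ?case
    by (intro exI[of _ "\<lambda>x. f"]) (auto intro: bounded_linear_imp_has_derivative real_polynomial_function.intros(2))
next
  case (const c)
  then show ?case
    by (intro exI[of _ "\<lambda>x h. 0"]) (auto intro: real_polynomial_function.intros(2))
next
  case (add f g)
  then obtain f' g' where "\<forall>x. (f has_derivative f' x) (at x) \<and> (\<forall>h. real_polynomial_function (\<lambda>x. f' x h))"
    "\<forall>x. (g has_derivative g' x) (at x) \<and> (\<forall>h. real_polynomial_function (\<lambda>x. g' x h))" by blast
  then show ?case
    by (intro exI[of _ "\<lambda>x h. f' x h + g' x h"]) (auto intro!: derivative_intros real_polynomial_function.intros(3))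
next
  case (mult f g)
  then obtain f' g' where "\<forall>x. (f has_derivative f' x) (at x) \<and> (\<forall>h. real_polynomial_function (\<lambda>x. f' x h))"
    "\<forall>x. (g has_derivative g' x) (at x) \<and> (\<forall>h. real_polynomial_function (\<lambda>x. g' x h))" by blast
  with mult show ?case
    by (intro exI[of _ "\<lambda>x h. f x * g' x h + f' x h * g x"])
      (intro allI conjI has_derivative_mult real_polynomial_function.intros(3,4); simp)
qed

lemma real_polynomial_function_growth:
  fixes p :: "'a::real_normed_vector \<Rightarrow> real"
  assumes "real_polynomial_function p"
  shows "\<exists>C m. C \<ge> 0 \<and> (\<forall>x. \<bar>p x\<bar> \<le> C * (1 + norm x) ^ m)"
  using assms
proof induction
  case (linear f)
  then obtain K where K: "K > 0" "\<And>x. norm (f x) \<le> norm x * K" using bounded_linear.pos_bounded by blast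
  have "\<bar>f x\<bar> \<le> K * (1 + norm x) ^ 1" for x
    using K(2)[of x] K(1) by (simp add: algebra_simps)
  with K(1) show ?case by (meson less_imp_le)
next
  case (const c)
  show ?case by (intro exI[of _ "\<bar>c\<bar>"] exI[of _ 0]) auto
next
  case (add f g)
  then obtain C m D n where *: "C \<ge> 0" "\<forall>x. \<bar>f x\<bar> \<le> C * (1 + norm x) ^ m"
     "D \<ge> 0" "\<forall>x. \<bar>g x\<bar> \<le> D * (1 + norm x) ^ n" by blast
  have "\<bar>f x + g x\<bar> \<le> (C + D) * (1 + norm x) ^ (m + n)" for x
  proof -
    have "\<bar>f x + g x\<bar> \<le> C * (1 + norm x) ^ m + D * (1 + norm x) ^ n" using * by (smt (verit))
    also have "\<dots> \<le> C * (1 + norm x) ^ (m + n) + D * (1 + norm x) ^ (m + n)"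
      using * by (intro add_mono mult_left_mono power_increasing) auto
    finally show ?thesis by (simp add: algebra_simps)
  qed
  with * show ?case by (meson add_nonneg_nonneg)
next
  case (mult f g)
  then obtain C m D n where *: "C \<ge> 0" "\<forall>x. \<bar>f x\<bar> \<le> C * (1 + norm x) ^ m"
     "D \<ge> 0" "\<forall>x. \<bar>g x\<bar> \<le> D * (1 + norm x) ^ n" by blast
  have "\<bar>f x * g x\<bar> \<le> (C * D) * (1 + norm x) ^ (m + n)" for x
  proof -
    have "\<bar>f x\<bar> * \<bar>g x\<bar> \<le> (C * (1 + norm x) ^ m) * (D * (1 + norm x) ^ n)"
      using * by (intro mult_mono) auto
    then show ?thesis by (simp add: abs_mult power_add mult_ac)
  qed
  with * show ?case by (meson mult_nonneg_nonneg)
qed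

lemma has_derivative_gaussian:
  fixes x :: "'a::real_inner"
  shows "((\<lambda>x. exp (- k * (norm x)\<^sup>2)) has_derivative (\<lambda>h. exp (- k * (norm x)\<^sup>2) * (- 2 * k * (x \<bullet> h)))) (at x)"
  unfolding power2_norm_eq_inner
  by (auto intro!: derivative_eq_intros simp: inner_commute algebra_simps)

text \<open>Polynomial factors are carried along because the class of polynomials times a fixed
  Gaussian is closed under partial derivatives, whereas the multiples of the Gaussian alone are
  not.\<close>

lemma pds_poly_gaussian:
  fixes p :: "plane \<Rightarrow> real"
  assumes "real_polynomial_function p"
  shows "\<exists>q. real_polynomial_function q \<and> pds js (\<lambda>x. p x * exp (- k * (norm x)\<^sup>2)) = (\<lambda>x. q x * exp (- k * (norm x)\<^sup>2))"
proof (induction js)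
  case Nil
  show ?case using assms by auto
next
  case (Cons i js)
  then obtain q where q: "real_polynomial_function q"
    "pds js (\<lambda>x. p x * exp (- k * (norm x)\<^sup>2)) = (\<lambda>x. q x * exp (- k * (norm x)\<^sup>2))" by blast
  obtain q' where q': "\<And>x. (q has_derivative q' x) (at x)" "\<And>h. real_polynomial_function (\<lambda>x. q' x h)"
    using real_polynomial_function_has_derivative[OF q(1)] by blast
  let ?r = "\<lambda>x. q' x (axis i 1) + q x * (- 2 * k * (x \<bullet> axis i 1))"
  have "pd i (\<lambda>x. q x * exp (- k * (norm x)\<^sup>2)) x = ?r x * exp (- k * (norm x)\<^sup>2)" for x
    using pd_eq[OF has_derivative_mult[OF q'(1)[of x] has_derivative_gaussian[of k x]], of i]
    by (simp add: algebra_simps)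
  moreover have "real_polynomial_function ?r"
    using q(1) q'(2)
    by (intro real_polynomial_function.intros(3)[OF q'(2)] real_polynomial_function.intros(4)[OF q(1)]
      real_polynomial_function.intros(4)[OF real_polynomial_function.intros(2)]
      real_polynomial_function.intros(1) bounded_linear_inner_left)
  ultimately show ?case unfolding pds_Cons q(2) by (intro exI[of _ ?r]) auto
qed

lemma power_times_gaussian_bounded:
  assumes "k > 0"
  shows "\<exists>C. \<forall>r\<ge>0. (1 + r :: real) ^ n * exp (- k * r\<^sup>2) \<le> C"
proof (cases "n = 0")
  case True
  then show ?thesis using assms by (intro exI[of _ 1]) auto
next
  case False
  \<comment> \<open>Large enough for both 2 <= c and r^2 <= c (k r^2 / n), so that 1 + r <= c exp (k
    r^2 / n); the n-th power then cancels the Gaussian exactly.\<close>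
  define c where "c = max 2 (real n / k)"
  have "(1 + r) ^ n * exp (- k * r\<^sup>2) \<le> c ^ n" if r: "r \<ge> 0" for r
  proof -
    have "1 + r \<le> 2 + r\<^sup>2"
      using sum_squares_bound[of 1 r] by (simp add: power2_eq_square) (smt (verit) r zero_le_square)
    also have "\<dots> \<le> c + c * (k * r\<^sup>2 / n)"
    proof -
      have "r\<^sup>2 = real n / k * (k * r\<^sup>2 / n)" using False assms by simp
      also have "\<dots> \<le> c * (k * r\<^sup>2 / n)" using assms by (intro mult_right_mono) (auto simp: c_def)
      finally show ?thesis by (simp add: c_def)
    qed
    also have "\<dots> = c * (1 + k * r\<^sup>2 / n)" by (simp add: algebra_simps)
    also have "\<dots> \<le> c * exp (k * r\<^sup>2 / n)"
      by (intro mult_left_mono) (auto simp: c_def)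
    finally have "(1 + r) ^ n \<le> (c * exp (k * r\<^sup>2 / n)) ^ n" using r by (intro power_mono) auto
    also have "\<dots> = c ^ n * exp (k * r\<^sup>2)"
      using False by (simp add: power_mult_distrib flip: exp_of_nat_mult)
    finally have "(1 + r) ^ n * exp (- k * r\<^sup>2) \<le> (c ^ n * exp (k * r\<^sup>2)) * exp (- k * r\<^sup>2)"
      by (intro mult_right_mono) auto
    also have "\<dots> = c ^ n" by (simp add: mult_exp_exp)
    finally show ?thesis .
  qed
  then show ?thesis by blast
qed

lemma poly_gaussian_schwartz:
  fixes p :: "plane \<Rightarrow> real"
  assumes p: "real_polynomial_function p" and k: "k > 0"
  shows "(\<lambda>x. p x * exp (- k * (norm x)\<^sup>2)) \<in> schwartz"
  unfolding schwartz_def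
proof (intro CollectI allI conjI)
  fix js :: "2 list" and l :: nat
  obtain q where q: "real_polynomial_function q"
    "pds js (\<lambda>x. p x * exp (- k * (norm x)\<^sup>2)) = (\<lambda>x. q x * exp (- k * (norm x)\<^sup>2))"
    using pds_poly_gaussian[OF p] by blast
  obtain q' where "\<And>x. (q has_derivative q' x) (at x)"
    using real_polynomial_function_has_derivative[OF q(1)] by blast
  then show "pds js (\<lambda>x. p x * exp (- k * (norm x)\<^sup>2)) differentiable at x" for x
    unfolding q(2) differentiable_def using has_derivative_mult has_derivative_gaussian by blast
  obtain C m where C: "C \<ge> 0" "\<And>x. \<bar>q x\<bar> \<le> C * (1 + norm x) ^ m"
    using real_polynomial_function_growth[OF q(1)] by blast
  obtain D where D: "\<And>r. r \<ge> 0 \<Longrightarrow> (1 + r) ^ (l + m) * exp (- k * r\<^sup>2) \<le> D"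
    using power_times_gaussian_bounded[OF k] by blast
  have "\<bar>norm x ^ l * (q x * exp (- k * (norm x)\<^sup>2))\<bar> \<le> C * D" for x
  proof -
    have "\<bar>norm x ^ l * (q x * exp (- k * (norm x)\<^sup>2))\<bar> = norm x ^ l * \<bar>q x\<bar> * exp (- k * (norm x)\<^sup>2)"
      by (simp add: abs_mult)
    also have "\<dots> \<le> (1 + norm x) ^ l * (C * (1 + norm x) ^ m) * exp (- k * (norm x)\<^sup>2)"
      using C by (intro mult_right_mono mult_mono power_mono) auto
    also have "\<dots> = C * ((1 + norm x) ^ (l + m) * exp (- k * (norm x)\<^sup>2))"
      by (simp add: power_add)
    also have "\<dots> \<le> C * D" using C(1) D by (intro mult_left_mono) auto
    finally show ?thesis .
  qed
  then show "bounded (range (\<lambda>x. norm x ^ l * pds js (\<lambda>x. p x * exp (- k * (norm x)\<^sup>2)) x))"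
    unfolding q(2) by (auto simp: bounded_iff)
qed

section \<open>The heat kernel: regularity, mass and semigroup law\<close>

lemma heat_kernel_eq: "heat_kernel s x = 1 / (4 * pi * s) * exp (- (1 / (4 * s)) * (norm x)\<^sup>2)"
  by (simp add: heat_kernel_def)

lemma heat_kernel_schwartz: "s > 0 \<Longrightarrow> heat_kernel s \<in> schwartz"
  using poly_gaussian_schwartz[OF real_polynomial_function.intros(2)[of "1 / (4 * pi * s)"], of "1 / (4 * s)"]
  by (simp add: heat_kernel_def[abs_def])

lemma heat_kernel_measurable [measurable]: "heat_kernel s \<in> borel_measurable borel"
  unfolding heat_kernel_def by measurable

lemma heat_kernel_nonneg [simp]: "s > 0 \<Longrightarrow> heat_kernel s x \<ge> 0"
  by (simp add: heat_kernel_def)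

lemma heat_kernel_le: "s > 0 \<Longrightarrow> heat_kernel s x \<le> 1 / (4 * pi * s)"
  by (simp add: heat_kernel_def divide_right_mono)

lemma heat_kernel_minus: "heat_kernel s (x - y) = heat_kernel s (y - x)"
  by (simp add: heat_kernel_def norm_minus_commute)

lemma nn_integral_heat_kernel:
  assumes "s > 0"
  shows "(\<integral>\<^sup>+x. ennreal (heat_kernel s (x - y)) \<partial>lborel) = 1"
    "(\<integral>\<^sup>+x. ennreal (heat_kernel s (y - x)) \<partial>lborel) = 1"
proof -
  show *: "(\<integral>\<^sup>+x. ennreal (heat_kernel s (x - y)) \<partial>lborel) = 1" for y
  proof -
    have "(\<integral>\<^sup>+x. ennreal (heat_kernel s (x - y)) \<partial>lborel)
      = (\<integral>\<^sup>+x. ennreal (1 / (4 * pi * s)) * ennreal (exp (- (1 / (4 * s)) * (norm (x - y))\<^sup>2)) \<partial>lborel)"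
      unfolding heat_kernel_eq using assms by (intro nn_integral_cong ennreal_mult) auto
    also have "\<dots> = ennreal (1 / (4 * pi * s)) * ennreal (pi / (1 / (4 * s)))"
      using nn_integral_gaussian[of "1 / (4 * s)" y] assms by (subst nn_integral_cmult) auto
    also have "\<dots> = ennreal (1 / (4 * pi * s) * (pi / (1 / (4 * s))))"
      using assms by (intro ennreal_mult[symmetric]) auto
    finally show ?thesis using assms by simp
  qed
  then show "(\<integral>\<^sup>+x. ennreal (heat_kernel s (y - x)) \<partial>lborel) = 1"
    by (simp add: heat_kernel_minus[of s y])
qed

lemma integrable_heat_kernel:
  assumes "s > 0"
  shows "integrable lborel (\<lambda>x. heat_kernel s (x - y))" "integrable lborel (\<lambda>x. heat_kernel s (y - x))"
    "integrable lborel (heat_kernel s)"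
proof -
  show *: "integrable lborel (\<lambda>x. heat_kernel s (x - y))" for y
    using nn_integral_heat_kernel(1)[OF assms, of y] assms by (intro integrableI_nonneg) auto
  show "integrable lborel (\<lambda>x. heat_kernel s (y - x))"
    using *[of y] by (simp add: heat_kernel_minus[of s y])
  show "integrable lborel (heat_kernel s)"
    using *[of 0] by simp
qed

lemma integral_heat_kernel:
  assumes "s > 0"
  shows "(LINT x|lborel. heat_kernel s (x - y)) = 1" "(LINT x|lborel. heat_kernel s (y - x)) = 1"
  using nn_integral_heat_kernel[OF assms, of y] assms
  by (simp_all add: integral_eq_nn_integral)

text \<open>Completing the square: the two exponents combine into a Gaussian in z of rate
  \<open>k\<close>, centred at the weighted mean \<open>c\<close> of x and y, times the heat
  exponent at time a + b.\<close>

lemma heat_kernel_semigroup: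
  assumes "a > 0" "b > 0"
  shows "(LINT z|lborel. heat_kernel a (x - z) * heat_kernel b (z - y)) = heat_kernel (a + b) (x - y)"
proof -
  define k where "k = (a + b) / (4 * a * b)"
  define c where "c = (1 / (a + b)) *\<^sub>R (b *\<^sub>R x + a *\<^sub>R y)"
  have k: "k > 0" using assms by (simp add: k_def)
  have sq: "- (norm (x - z))\<^sup>2 / (4 * a) + - (norm (z - y))\<^sup>2 / (4 * b)
      = - (norm (x - y))\<^sup>2 / (4 * (a + b)) + - k * (norm (z - c))\<^sup>2" for z
  proof -
    have "z - c = (1 / (a + b)) *\<^sub>R (b *\<^sub>R (z - x) + a *\<^sub>R (z - y))"
    proof -
      have "(1 / (a + b)) *\<^sub>R (b *\<^sub>R (z - x) + a *\<^sub>R (z - y)) = (1 / (a + b)) *\<^sub>R ((a + b) *\<^sub>R z) - c"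
        unfolding c_def scaleR_diff_right[symmetric] by (simp add: algebra_simps)
      then show ?thesis using assms by simp
    qed
    moreover have "x - y = (z - y) - (z - x)" by simp
    moreover have "(norm (b *\<^sub>R u + a *\<^sub>R v))\<^sup>2 = b\<^sup>2 * (norm u)\<^sup>2 + 2 * a * b * (u \<bullet> v) + a\<^sup>2 * (norm v)\<^sup>2"
      "(norm (v - u))\<^sup>2 = (norm u)\<^sup>2 - 2 * (u \<bullet> v) + (norm v)\<^sup>2" for u v :: plane
      unfolding power2_norm_eq_inner
      by (simp_all add: inner_add_left inner_add_right inner_diff_left inner_diff_right
          inner_commute power2_eq_square algebra_simps)
    ultimately have e: "(norm (z - c))\<^sup>2 = (b\<^sup>2 * (norm (z - x))\<^sup>2 + 2 * a * b * ((z - x) \<bullet> (z - y)) + a\<^sup>2 * (norm (z - y))\<^sup>2) / (a + b)\<^sup>2"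
      "(norm (x - y))\<^sup>2 = (norm (z - x))\<^sup>2 - 2 * ((z - x) \<bullet> (z - y)) + (norm (z - y))\<^sup>2"
      by (simp_all only: norm_scaleR power_mult_distrib power2_abs power_divide) simp_all
    have f: "k / (a + b)\<^sup>2 = 1 / (4 * a * b * (a + b))"
      using assms by (simp add: k_def power2_eq_square)
    define X where "X = (norm (z - x))\<^sup>2"
    define Y where "Y = (norm (z - y))\<^sup>2"
    define P where "P = (z - x) \<bullet> (z - y)"
    have "- X / (4 * a) + - Y / (4 * b) = - (X - 2 * P + Y) / (4 * (a + b)) - (b\<^sup>2 * X + 2 * a * b * P + a\<^sup>2 * Y) / (4 * a * b * (a + b))"
      using assms by (simp add: divide_simps) (simp add: power2_eq_square algebra_simps)
    also have "\<dots> = - (X - 2 * P + Y) / (4 * (a + b)) + - k * ((b\<^sup>2 * X + 2 * a * b * P + a\<^sup>2 * Y) / (a + b)\<^sup>2)"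
    proof -
      have "k * (W / (a + b)\<^sup>2) = k / (a + b)\<^sup>2 * W" for W by simp
      then have "k * (W / (a + b)\<^sup>2) = W / (4 * a * b * (a + b))" for W unfolding f by simp
      then show ?thesis by simp
    qed
    finally show ?thesis
      using e by (simp add: X_def Y_def P_def norm_minus_commute[of x z])
  qed
  have "heat_kernel a (x - z) * heat_kernel b (z - y)
      = 1 / (16 * pi\<^sup>2 * a * b) * exp (- (norm (x - y))\<^sup>2 / (4 * (a + b))) * exp (- k * (norm (z - c))\<^sup>2)" for z
    using sq[of z] by (simp add: heat_kernel_def power2_eq_square flip: exp_add)
  moreover have "(LINT z|lborel. exp (- k * (norm (z - c))\<^sup>2)) = pi / k"
    using nn_integral_gaussian[OF k, of c] k by (simp add: integral_eq_nn_integral)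
  ultimately have "(LINT z|lborel. heat_kernel a (x - z) * heat_kernel b (z - y))
      = 1 / (16 * pi\<^sup>2 * a * b) * exp (- (norm (x - y))\<^sup>2 / (4 * (a + b))) * (pi / k)"
    by (simp only: integral_mult_right_zero)
  also have "\<dots> = (1 / (16 * pi\<^sup>2 * a * b) * (pi / k)) * exp (- (norm (x - y))\<^sup>2 / (4 * (a + b)))"
    by simp
  also have "1 / (16 * pi\<^sup>2 * a * b) * (pi / k) = 1 / (4 * pi * (a + b))"
  proof -
    have "a + b \<noteq> 0" using assms by simp
    then show ?thesis using assms unfolding k_def by (simp add: divide_simps power2_eq_square)
  qed
  finally show ?thesis by (simp add: heat_kernel_def)
qed

section \<open>Hoelder bounds for the heat semigroup\<close>

lemma L43_bound_integrable:
  assumes "L43_bound f A"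
  shows "integrable lborel (\<lambda>x. \<bar>f x\<bar> powr (4/3))" "A \<ge> 0 \<Longrightarrow> (LINT x|lborel. \<bar>f x\<bar> powr (4/3)) \<le> A powr (4/3)"
proof -
  have [measurable]: "f \<in> borel_measurable borel" using assms by (auto simp: L43_bound_def)
  have le: "(\<integral>\<^sup>+x. ennreal (\<bar>f x\<bar> powr (4/3)) \<partial>lborel) \<le> ennreal (A powr (4/3))"
    using assms by (auto simp: L43_bound_def)
  then show *: "integrable lborel (\<lambda>x. \<bar>f x\<bar> powr (4/3))"
    by (intro integrableI_nonneg) (auto intro: le_less_trans)
  show "(LINT x|lborel. \<bar>f x\<bar> powr (4/3)) \<le> A powr (4/3)"
    using le nn_integral_eq_integral[OF *] by (simp add: ennreal_le_iff)
qed

lemma L43_boundI: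
  assumes "f \<in> borel_measurable borel" "integrable lborel (\<lambda>x. \<bar>f x\<bar> powr (4/3))"
    "(LINT x|lborel. \<bar>f x\<bar> powr (4/3)) \<le> A powr (4/3)"
  shows "L43_bound f A"
  using assms nn_integral_eq_integral[OF assms(2)] by (simp add: L43_bound_def ennreal_leI)

lemma heat_distr_of: "heat s (distr_of \<psi>) = (\<lambda>x. LINT y|lborel. \<psi> y * heat_kernel s (x - y))"
  by (simp add: heat_def[abs_def] distr_of_def)

lemma heat_schwartz:
  assumes "integrable lborel \<psi>" "\<And>x. norm x > R \<Longrightarrow> \<psi> x = 0" "s > 0"
  shows "heat s (distr_of \<psi>) \<in> schwartz"
  unfolding heat_distr_of by (rule convolution_schwartz[OF heat_kernel_schwartz[OF assms(3)] assms(1,2)])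

lemma young_4: 
  assumes "a \<ge> 0" "b \<ge> 0"
  shows "a * b \<le> 3/4 * a powr (4/3) + 1/4 * (b::real) ^ 4"
  using Youngs_inequality[of "4/3" 4 a b] assms by (cases "b = 0") (auto simp: powr_numeral)

lemma integrable_mult_heat_kernel:
  assumes [measurable]: "\<psi> \<in> borel_measurable borel" and "\<And>y. \<bar>\<psi> y\<bar> \<le> B" "s > 0"
  shows "integrable lborel (\<lambda>y. \<psi> y * heat_kernel s (x - y))"
proof (rule Bochner_Integration.integrable_bound)
  show "integrable lborel (\<lambda>y. B * heat_kernel s (x - y))"
    using integrable_heat_kernel(2)[OF assms(3)] by simp
  have "B \<ge> 0" using assms(2)[of 0] by simp
  then show "AE y in lborel. norm (\<psi> y * heat_kernel s (x - y)) \<le> norm (B * heat_kernel s (x - y))"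
    using assms by (auto simp: abs_mult intro!: mult_right_mono)
qed simp

text \<open>If the convolution integrand is not integrable, the Bochner integral is 0 and the bound
  is trivial; so measurability suffices.\<close>

lemma abs_heat_le:
  assumes [measurable]: "\<psi> \<in> borel_measurable borel"
  shows "ennreal \<bar>heat s (distr_of \<psi>) x\<bar> \<le> (\<integral>\<^sup>+y. ennreal (\<bar>\<psi> y\<bar> * \<bar>heat_kernel s (x - y)\<bar>) \<partial>lborel)"
  unfolding heat_distr_of
  using integral_norm_bound_ennreal[of lborel "\<lambda>y. \<psi> y * heat_kernel s (x - y)"]
  by (cases "integrable lborel (\<lambda>y. \<psi> y * heat_kernel s (x - y))") (auto simp: abs_mult not_integrable_integral_eq)

lemma heat_distr_of_measurable [measurable]:
  assumes [measurable]: "\<psi> \<in> borel_measurable borel"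
  shows "heat s (distr_of \<psi>) \<in> borel_measurable borel"
  unfolding heat_distr_of by measurable

text \<open>Hoelder's inequality and the L^4 contractivity of the heat semigroup in one stroke:
  Young's inequality is applied under the double integral with weight G_s(x - y), whose mass in
  either variable is 1.\<close>

lemma holder_heat_normalized:
  assumes [measurable]: "H \<in> borel_measurable borel" "\<psi> \<in> borel_measurable borel" and "s > 0"
    and "(\<integral>\<^sup>+x. ennreal (\<bar>H x\<bar> powr (4/3)) \<partial>lborel) \<le> 1" "(\<integral>\<^sup>+x. ennreal (\<psi> x ^ 4) \<partial>lborel) \<le> 1"
  shows "(\<integral>\<^sup>+x. ennreal (\<bar>H x\<bar> * \<bar>heat s (distr_of \<psi>) x\<bar>) \<partial>lborel) \<le> 1"
proof -
  let ?G = "\<lambda>x y. heat_kernel s (x - y)"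
  have "(\<integral>\<^sup>+x. ennreal (\<bar>H x\<bar> * \<bar>heat s (distr_of \<psi>) x\<bar>) \<partial>lborel)
    \<le> (\<integral>\<^sup>+x. ennreal \<bar>H x\<bar> * (\<integral>\<^sup>+y. ennreal (\<bar>\<psi> y\<bar> * \<bar>?G x y\<bar>) \<partial>lborel) \<partial>lborel)"
  proof (rule nn_integral_mono)
    fix x
    have "ennreal (\<bar>H x\<bar> * \<bar>heat s (distr_of \<psi>) x\<bar>) = ennreal \<bar>H x\<bar> * ennreal \<bar>heat s (distr_of \<psi>) x\<bar>"
      by (simp add: ennreal_mult)
    also have "\<dots> \<le> ennreal \<bar>H x\<bar> * (\<integral>\<^sup>+y. ennreal (\<bar>\<psi> y\<bar> * \<bar>?G x y\<bar>) \<partial>lborel)"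
      by (rule mult_left_mono[OF abs_heat_le]) auto
    finally show "ennreal (\<bar>H x\<bar> * \<bar>heat s (distr_of \<psi>) x\<bar>)
      \<le> ennreal \<bar>H x\<bar> * (\<integral>\<^sup>+y. ennreal (\<bar>\<psi> y\<bar> * \<bar>?G x y\<bar>) \<partial>lborel)" .
  qed
  also have "\<dots> = (\<integral>\<^sup>+x. \<integral>\<^sup>+y. ennreal (\<bar>H x\<bar> * \<bar>\<psi> y\<bar>) * ennreal (?G x y) \<partial>lborel \<partial>lborel)"
  proof (intro nn_integral_cong)
    fix x
    have "ennreal \<bar>H x\<bar> * (\<integral>\<^sup>+y. ennreal (\<bar>\<psi> y\<bar> * \<bar>?G x y\<bar>) \<partial>lborel)
      = (\<integral>\<^sup>+y. ennreal \<bar>H x\<bar> * ennreal (\<bar>\<psi> y\<bar> * \<bar>?G x y\<bar>) \<partial>lborel)"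
      by (rule nn_integral_cmult[symmetric]) measurable
    also have "\<dots> = (\<integral>\<^sup>+y. ennreal (\<bar>H x\<bar> * \<bar>\<psi> y\<bar>) * ennreal (?G x y) \<partial>lborel)"
      using assms(3) by (intro nn_integral_cong) (simp add: ennreal_mult mult.assoc)
    finally show "ennreal \<bar>H x\<bar> * (\<integral>\<^sup>+y. ennreal (\<bar>\<psi> y\<bar> * \<bar>?G x y\<bar>) \<partial>lborel)
      = (\<integral>\<^sup>+y. ennreal (\<bar>H x\<bar> * \<bar>\<psi> y\<bar>) * ennreal (?G x y) \<partial>lborel)" .
  qed
  also have "\<dots> \<le> (\<integral>\<^sup>+x. \<integral>\<^sup>+y. ennreal (3/4) * (ennreal (\<bar>H x\<bar> powr (4/3)) * ennreal (?G x y)) + 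
       ennreal (1/4) * (ennreal (\<psi> y ^ 4) * ennreal (?G x y)) \<partial>lborel \<partial>lborel)"
  proof (intro nn_integral_mono)
    fix x y
    have "\<bar>H x\<bar> * \<bar>\<psi> y\<bar> * ?G x y \<le> (3/4 * \<bar>H x\<bar> powr (4/3) + 1/4 * \<psi> y ^ 4) * ?G x y"
      using young_4[of "\<bar>H x\<bar>" "\<bar>\<psi> y\<bar>"] assms(3) by (intro mult_right_mono) auto
    also have "\<dots> = 3/4 * (\<bar>H x\<bar> powr (4/3) * ?G x y) + 1/4 * (\<psi> y ^ 4 * ?G x y)" by (simp add: algebra_simps)
    finally have "ennreal (\<bar>H x\<bar> * \<bar>\<psi> y\<bar> * ?G x y) \<le> ennreal (3/4 * (\<bar>H x\<bar> powr (4/3) * ?G x y) + 1/4 * (\<psi> y ^ 4 * ?G x y))"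
      by (rule ennreal_leI)
    also have "\<dots> = ennreal (3/4) * (ennreal (\<bar>H x\<bar> powr (4/3)) * ennreal (?G x y)) + ennreal (1/4) * (ennreal (\<psi> y ^ 4) * ennreal (?G x y))"
    proof -
      have em: "ennreal (c * (p * q)) = ennreal c * (ennreal p * ennreal q)" if "c \<ge> 0" "p \<ge> 0" "q \<ge> 0" for c p q
        using that by (simp add: ennreal_mult)
      have G: "?G x y \<ge> 0" using assms(3) by simp
      show ?thesis
        by (subst ennreal_plus, use G in simp, use G in simp, subst em, simp, simp, rule G, subst em, simp, simp, rule G, rule refl)
    qed
    finally show "ennreal (\<bar>H x\<bar> * \<bar>\<psi> y\<bar>) * ennreal (?G x y) \<le> \<dots>"
      using assms(3) by (simp add: ennreal_mult)
  qed
  also have "\<dots> = ennreal (3/4) * (\<integral>\<^sup>+x. \<integral>\<^sup>+y. ennreal (\<bar>H x\<bar> powr (4/3)) * ennreal (?G x y) \<partial>lborel \<partial>lborel)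
       + ennreal (1/4) * (\<integral>\<^sup>+x. \<integral>\<^sup>+y. ennreal (\<psi> y ^ 4) * ennreal (?G x y) \<partial>lborel \<partial>lborel)"
    by (simp add: nn_integral_add nn_integral_cmult)
  also have "(\<integral>\<^sup>+x. \<integral>\<^sup>+y. ennreal (\<psi> y ^ 4) * ennreal (?G x y) \<partial>lborel \<partial>lborel)
      = (\<integral>\<^sup>+y. \<integral>\<^sup>+x. ennreal (\<psi> y ^ 4) * ennreal (?G x y) \<partial>lborel \<partial>lborel)"
    by (rule lborel_pair.Fubini') measurable
  also have "\<dots> = (\<integral>\<^sup>+y. ennreal (\<psi> y ^ 4) \<partial>lborel)"
    by (subst nn_integral_cmult) (auto simp: nn_integral_heat_kernel[OF assms(3)])
  also have "(\<integral>\<^sup>+x. \<integral>\<^sup>+y. ennreal (\<bar>H x\<bar> powr (4/3)) * ennreal (?G x y) \<partial>lborel \<partial>lborel)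
      = (\<integral>\<^sup>+x. ennreal (\<bar>H x\<bar> powr (4/3)) \<partial>lborel)"
    by (subst nn_integral_cmult) (auto simp: nn_integral_heat_kernel[OF assms(3)])
  also have "ennreal (3/4) * (\<integral>\<^sup>+x. ennreal (\<bar>H x\<bar> powr (4/3)) \<partial>lborel) + ennreal (1/4) * (\<integral>\<^sup>+y. ennreal (\<psi> y ^ 4) \<partial>lborel)
      \<le> ennreal (3/4) * 1 + ennreal (1/4) * 1"
    using assms(4,5) by (intro add_mono mult_left_mono) auto
  also have "\<dots> = 1"
    by (simp flip: ennreal_plus)
  finally show ?thesis .
qed

lemma heat_distr_of_scale: "heat s (distr_of (\<lambda>x. c * \<psi> x)) x = c * heat s (distr_of \<psi>) x"
  by (simp add: heat_distr_of mult.assoc)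

text \<open>Rescaling to unit norms gives the product form. The right side does not depend on
  \<open>s\<close>, so the bound survives the removal of the mollification.\<close>

lemma holder_heat:
  assumes H: "L43_bound H A" and [measurable]: "\<psi> \<in> borel_measurable borel" and "s > 0" "A > 0" "B > 0"
    and \<psi>: "(\<integral>\<^sup>+x. ennreal (\<psi> x ^ 4) \<partial>lborel) \<le> ennreal (B ^ 4)"
  shows "(\<integral>\<^sup>+x. ennreal (\<bar>H x\<bar> * \<bar>heat s (distr_of \<psi>) x\<bar>) \<partial>lborel) \<le> ennreal (A * B)"
proof -
  have [measurable]: "H \<in> borel_measurable borel" using H by (auto simp: L43_bound_def)
  let ?H = "\<lambda>x. 1 / A * H x" and ?\<psi> = "\<lambda>x. 1 / B * \<psi> x"
  have "L43_bound ?H 1"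
    using L43_bound_scale[OF H, of "1 / A"] assms by simp
  then have 1: "(\<integral>\<^sup>+x. ennreal (\<bar>?H x\<bar> powr (4/3)) \<partial>lborel) \<le> 1" by (simp add: L43_bound_def)
  have "(\<integral>\<^sup>+x. ennreal (?\<psi> x ^ 4) \<partial>lborel) = (\<integral>\<^sup>+x. ennreal (1 / B ^ 4) * ennreal (\<psi> x ^ 4) \<partial>lborel)"
    using assms(5) by (intro nn_integral_cong) (simp add: power_divide flip: ennreal_mult)
  also have "\<dots> = ennreal (1 / B ^ 4) * (\<integral>\<^sup>+x. ennreal (\<psi> x ^ 4) \<partial>lborel)" by (simp add: nn_integral_cmult)
  also have "\<dots> \<le> ennreal (1 / B ^ 4) * ennreal (B ^ 4)" by (intro mult_left_mono \<psi>) auto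
  also have "\<dots> = ennreal (1 / B ^ 4 * B ^ 4)" using assms(5) by (intro ennreal_mult[symmetric]) auto
  also have "\<dots> = 1" using assms(5) by simp
  finally have 2: "(\<integral>\<^sup>+x. ennreal (?\<psi> x ^ 4) \<partial>lborel) \<le> 1" .
  have "(\<integral>\<^sup>+x. ennreal (\<bar>H x\<bar> * \<bar>heat s (distr_of \<psi>) x\<bar>) \<partial>lborel)
    = (\<integral>\<^sup>+x. ennreal (A * B) * ennreal (\<bar>?H x\<bar> * \<bar>heat s (distr_of ?\<psi>) x\<bar>) \<partial>lborel)"
    using assms(4,5) unfolding heat_distr_of_scale
    by (intro nn_integral_cong) (simp add: abs_mult flip: ennreal_mult)
  also have "\<dots> = ennreal (A * B) * (\<integral>\<^sup>+x. ennreal (\<bar>?H x\<bar> * \<bar>heat s (distr_of ?\<psi>) x\<bar>) \<partial>lborel)"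
    by (rule nn_integral_cmult) measurable
  also have "\<dots> \<le> ennreal (A * B) * 1"
    by (intro mult_left_mono holder_heat_normalized assms 1 2) auto
  finally show ?thesis by simp
qed

text \<open>The Euclidean norm of the gradient of \<open>heat_kernel s\<close>, since that gradient
  at x is -x / (2 s) times the kernel.\<close>

definition grad_heat_norm :: "real \<Rightarrow> plane \<Rightarrow> real" where
  "grad_heat_norm s x = norm x / (2 * s) * heat_kernel s x"

lemma grad_heat_norm_measurable [measurable]: "grad_heat_norm s \<in> borel_measurable borel"
  unfolding grad_heat_norm_def[abs_def] by measurable

lemma grad_heat_norm_nonneg [simp]: "s > 0 \<Longrightarrow> grad_heat_norm s x \<ge> 0"
  by (simp add: grad_heat_norm_def)

text \<open>Half of the Gaussian exponent is spent on absorbing the factor |x|, which becomes a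
  multiple of sqrt s.\<close>

lemma grad_heat_norm_le:
  assumes "s > 0"
  shows "grad_heat_norm s x \<le> s powr (-3/2) / (2 * pi) * exp (- (norm x)\<^sup>2 / (8 * s))"
proof -
  have "norm x / (2 * s) \<le> 2 * s powr (-1/2) * exp ((norm x)\<^sup>2 / (8 * s))"
  proof -
    define a where "a = norm x / sqrt s"
    have "a \<le> 4 * (1 + a\<^sup>2 / 8)" 
    proof -
      have "2 * a \<le> a\<^sup>2 + 1" using sum_squares_bound[of a 1] by simp
      then show ?thesis by (simp add: field_simps)
    qed
    also have "\<dots> \<le> 4 * exp (a\<^sup>2 / 8)"
      by (intro mult_left_mono) auto
    finally have "a / (2 * sqrt s) \<le> 4 * exp (a\<^sup>2 / 8) / (2 * sqrt s)"
      using assms by (intro divide_right_mono) auto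
    moreover have "a\<^sup>2 = (norm x)\<^sup>2 / s" using assms by (simp add: a_def power_divide)
    moreover have "a / (2 * sqrt s) = norm x / (2 * s)" using assms by (simp add: a_def)
    moreover have "s powr (-1/2) = 1 / sqrt s"
      using assms powr_minus_divide[of s "1/2"] by (simp add: powr_half_sqrt)
    ultimately show ?thesis by (simp add: mult.commute)
  qed
  then have "grad_heat_norm s x \<le> 2 * s powr (-1/2) * exp ((norm x)\<^sup>2 / (8 * s)) * heat_kernel s x"
    unfolding grad_heat_norm_def using assms by (intro mult_right_mono) auto
  also have "\<dots> = s powr (-1/2) * s powr (-1) / (2 * pi) * (exp ((norm x)\<^sup>2 / (8 * s)) * exp (- (norm x)\<^sup>2 / (4 * s)))"
    using assms by (simp add: heat_kernel_def powr_minus field_simps)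
  also have "s powr (-1/2) * s powr (-1) = s powr (-3/2)"
    unfolding powr_add[symmetric] by simp
  also have "exp ((norm x)\<^sup>2 / (8 * s)) * exp (- (norm x)\<^sup>2 / (4 * s)) = exp (- (norm x)\<^sup>2 / (8 * s))"
    using assms by (simp add: field_simps flip: exp_add)
  finally show ?thesis .
qed

text \<open>Raising the Gaussian bound to the power 4/3 and integrating leaves at most 6 pi / s. The
  constant is 27 because 27^(4/3) = 81 is an integer comfortably above 6 pi.\<close>

lemma L43_bound_grad_heat:
  assumes "s > 0"
  shows "L43_bound (\<lambda>x. grad_heat_norm s (x - y)) (27 * s powr (-3/4))"
proof -
  have "(\<integral>\<^sup>+x. ennreal (\<bar>grad_heat_norm s (x - y)\<bar> powr (4/3)) \<partial>lborel)
     \<le> (\<integral>\<^sup>+x. ennreal (s powr (-2)) * ennreal (exp (- (1 / (6 * s)) * (norm (x - y))\<^sup>2)) \<partial>lborel)"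
  proof (intro nn_integral_mono)
    fix x
    let ?e = "exp (- (norm (x - y))\<^sup>2 / (8 * s))"
    have "\<bar>grad_heat_norm s (x - y)\<bar> \<le> s powr (-3/2) * ?e"
    proof -
      have "s powr (-3/2) / (2 * pi) * ?e \<le> s powr (-3/2) / 1 * ?e"
        using pi_ge_two by (intro mult_right_mono divide_left_mono) auto
      then show ?thesis using grad_heat_norm_le[OF assms, of "x - y"] assms by simp
    qed
    then have "\<bar>grad_heat_norm s (x - y)\<bar> powr (4/3) \<le> (s powr (-3/2) * ?e) powr (4/3)"
      by (intro powr_mono2) auto
    also have "\<dots> = s powr (-2) * exp (- (1 / (6 * s)) * (norm (x - y))\<^sup>2)"
      by (simp add: powr_mult powr_powr exp_powr_real)
    finally show "ennreal (\<bar>grad_heat_norm s (x - y)\<bar> powr (4/3))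
      \<le> ennreal (s powr (-2)) * ennreal (exp (- (1 / (6 * s)) * (norm (x - y))\<^sup>2))"
      by (simp add: ennreal_leI flip: ennreal_mult)
  qed
  also have "\<dots> = ennreal (s powr (-2)) * ennreal (pi / (1 / (6 * s)))"
    using nn_integral_gaussian[of "1 / (6 * s)" y] assms by (subst nn_integral_cmult) auto
  also have "\<dots> = ennreal (s powr (-2) * (pi / (1 / (6 * s))))"
    using assms by (intro ennreal_mult[symmetric]) auto
  also have "\<dots> \<le> ennreal ((27 * s powr (-3/4)) powr (4/3))"
  proof (rule ennreal_leI)
    show "s powr (-2) * (pi / (1 / (6 * s))) \<le> (27 * s powr (-3/4)) powr (4/3)"
    proof -
      have "(27 * s powr (-3/4)) powr (4/3) = (3 ^ 3) powr (4/3) * s powr (-1)"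
        using assms by (simp add: powr_mult powr_powr)
      also have "((3::real) ^ 3) powr (4/3) = (3 powr 3) powr (4/3)"
        by (simp only: powr_numeral)
      also have "\<dots> = 81"
        unfolding powr_powr by simp
      also have "s powr (-1) = 1 / s"
        using assms powr_minus_divide[of s 1] by simp
      finally have "(27 * s powr (-3/4)) powr (4/3) = 81 / s"
        by (simp only: times_divide_eq_right mult_1_right)
      moreover have "s powr (-2) * (pi / (1 / (6 * s))) = 6 * pi / s"
        using assms by (simp add: powr_minus powr_numeral power2_eq_square field_simps)
      ultimately show ?thesis using assms pi_less_4 by (simp add: divide_right_mono)
    qed
  qed
  finally show ?thesis by (simp add: L43_bound_def)
qed

section \<open>Duality\<close>

lemma L43_mult_gaussian_integrable:
  assumes w: "w \<in> borel_measurable borel" "integrable lborel (\<lambda>x. \<bar>w x\<bar> powr (4/3))" and k: "k > 0"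
  shows "integrable lborel (\<lambda>x::plane. w x * exp (- k * (norm x)\<^sup>2))"
proof (rule Bochner_Integration.integrable_bound)
  note [measurable] = w(1)
  show "integrable lborel (\<lambda>x. 3/4 * \<bar>w x\<bar> powr (4/3) + 1/4 * exp (- (4 * k) * (norm (x - 0))\<^sup>2))"
  proof (intro Bochner_Integration.integrable_add integrable_mult_right w(2))
    show "integrable lborel (\<lambda>x::plane. exp (- (4 * k) * (norm (x - 0))\<^sup>2))"
      using nn_integral_gaussian[of "4 * k" 0] k by (intro integrableI_nonneg) auto
  qed
  show "AE x in lborel. norm (w x * exp (- k * (norm x)\<^sup>2)) \<le> norm (3/4 * \<bar>w x\<bar> powr (4/3) + 1/4 * exp (- (4 * k) * (norm (x - 0))\<^sup>2))"
  proof (intro AE_I2)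
    fix x
    have "\<bar>w x\<bar> * exp (- k * (norm x)\<^sup>2) \<le> 3/4 * \<bar>w x\<bar> powr (4/3) + 1/4 * exp (- k * (norm x)\<^sup>2) ^ 4"
      by (rule young_4) auto
    also have "exp (- k * (norm x)\<^sup>2) ^ 4 = exp (- (4 * k) * (norm (x - 0))\<^sup>2)"
      by (simp flip: exp_of_nat_mult)
    finally show "norm (w x * exp (- k * (norm x)\<^sup>2)) \<le> norm (3/4 * \<bar>w x\<bar> powr (4/3) + 1/4 * exp (- (4 * k) * (norm (x - 0))\<^sup>2))"
      by (simp add: abs_mult)
  qed
qed (use w in measurable)

text \<open>A majorant independent of \<open>s\<close>, for passing to the limit s -> 0. It rests on
  G_s(z) = 2 exp(-|z|^2 / (8 s)) G_(2s)(z): for s <= 1 the exponential gives Gaussian decay in x,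
  and the remaining kernel has mass one.\<close>

lemma heat_gaussian_bound:
  assumes [measurable]: "\<psi> \<in> borel_measurable borel" and B: "\<And>x. \<bar>\<psi> x\<bar> \<le> B" and R: "R \<ge> 0" "\<And>x. norm x > R \<Longrightarrow> \<psi> x = 0"
    and s: "0 < s" "s \<le> 1"
  shows "\<bar>heat s (distr_of \<psi>) x\<bar> \<le> 2 * B * exp (R\<^sup>2 / 8) * exp (- (1 / 32) * (norm x)\<^sup>2)"
proof -
  have B0: "B \<ge> 0" using B[of 0] by simp
  let ?K = "B * exp (R\<^sup>2 / 8) * exp (- (1 / 32) * (norm x)\<^sup>2)"
  have "\<bar>\<psi> y * heat_kernel s (x - y)\<bar> \<le> 2 * ?K * heat_kernel (2 * s) (x - y)" for y
  proof (cases "norm y \<le> R")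
    case True
    have "norm x \<le> norm (x - y) + norm y" by (metis diff_add_cancel norm_triangle_ineq)
    then have "norm x \<le> norm (x - y) + R" using True by simp
    then have "(norm x)\<^sup>2 \<le> (norm (x - y) + R)\<^sup>2" by (intro power_mono) auto
    also have "\<dots> \<le> 2 * (norm (x - y))\<^sup>2 + 2 * R\<^sup>2"
      using sum_squares_bound[of "norm (x - y)" R] by (simp add: power2_sum)
    finally have *: "(norm x)\<^sup>2 / 32 \<le> (norm (x - y))\<^sup>2 / 16 + R\<^sup>2 / 16" by simp
    have "(norm (x - y))\<^sup>2 / 16 \<le> (norm (x - y))\<^sup>2 / (8 * s)"
      using s by (intro divide_left_mono) auto
    have le: "(norm x)\<^sup>2 / 32 \<le> (norm (x - y))\<^sup>2 / (8 * s) + R\<^sup>2 / 8"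
    proof -
      have "R\<^sup>2 / 16 \<le> R\<^sup>2 / 8" by simp
      then show ?thesis using * \<open>(norm (x - y))\<^sup>2 / 16 \<le> (norm (x - y))\<^sup>2 / (8 * s)\<close> by linarith
    qed
    have "heat_kernel s (x - y) = 2 * exp (- (norm (x - y))\<^sup>2 / (8 * s)) * heat_kernel (2 * s) (x - y)"
      using s by (simp add: heat_kernel_def field_simps flip: exp_add)
    also have "\<dots> \<le> 2 * (exp (R\<^sup>2 / 8) * exp (- (1 / 32) * (norm x)\<^sup>2)) * heat_kernel (2 * s) (x - y)"
      using le s by (intro mult_right_mono mult_left_mono) (auto simp flip: exp_add)
    finally have "\<bar>\<psi> y\<bar> * heat_kernel s (x - y) \<le> B * (2 * (exp (R\<^sup>2 / 8) * exp (- (1 / 32) * (norm x)\<^sup>2)) * heat_kernel (2 * s) (x - y))"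
      using B[of y] s B0 by (intro mult_mono) auto
    then show ?thesis using s by (simp add: abs_mult mult_ac)
  qed (use R(2)[of y] B0 s in auto)
  then have "norm (LINT y|lborel. \<psi> y * heat_kernel s (x - y)) \<le> (LINT y|lborel. 2 * ?K * heat_kernel (2 * s) (x - y))"
    using integrable_mult_heat_kernel[OF assms(1) B s(1)] integrable_heat_kernel(2)[of "2 * s" x] s
    by (intro Bochner_Integration.integral_norm_bound_integral) auto
  also have "\<dots> = 2 * ?K" using integral_heat_kernel(2)[of "2 * s" x] s by simp
  finally show ?thesis by (simp add: heat_distr_of mult_ac)
qed

text \<open>Continuity controls the part near x. Beyond distance \<delta>, half of the Gaussian
  exponent yields the factor exp(-\<delta>^2 / (8 s)), and the other half is still a kernel of mass
  one.\<close>

lemma heat_tendsto: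
  assumes cont: "continuous_on UNIV \<psi>" and B: "\<And>x. \<bar>\<psi> x\<bar> \<le> B"
    and s: "\<And>n. s n > 0" "s \<longlonglongrightarrow> 0"
  shows "(\<lambda>n. heat (s n) (distr_of \<psi>) x) \<longlonglongrightarrow> \<psi> x"
proof -
  have [measurable]: "\<psi> \<in> borel_measurable borel" using cont by (rule borel_measurable_continuous_onI)
  have B0: "B \<ge> 0" using B[of 0] by simp
  show ?thesis
  proof (rule LIMSEQ_I)
    fix r :: real assume r: "r > 0"
    obtain \<delta> where \<delta>: "\<delta> > 0" "\<And>y. dist y x < \<delta> \<Longrightarrow> dist (\<psi> y) (\<psi> x) < r / 2"
      using cont r unfolding continuous_on_iff by (metis UNIV_I half_gt_zero)
    have est: "\<bar>heat (s n) (distr_of \<psi>) x - \<psi> x\<bar> \<le> r / 2 + 4 * B * exp (- \<delta>\<^sup>2 / (8 * s n))" for n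
    proof -
      let ?t = "s n"
      have t: "?t > 0" using s by simp
      let ?q = "4 * B * exp (- \<delta>\<^sup>2 / (8 * ?t))"
      have "heat ?t (distr_of \<psi>) x - \<psi> x = (LINT y|lborel. \<psi> y * heat_kernel ?t (x - y)) - \<psi> x * (LINT y|lborel. heat_kernel ?t (x - y))"
        using integral_heat_kernel[OF t] by (simp add: heat_distr_of)
      also have "\<dots> = (LINT y|lborel. (\<psi> y - \<psi> x) * heat_kernel ?t (x - y))"
        using integrable_mult_heat_kernel[OF _ B t] integrable_heat_kernel[OF t] by (simp add: left_diff_distrib)
      also have "\<bar>\<dots>\<bar> \<le> (LINT y|lborel. r / 2 * heat_kernel ?t (x - y) + ?q * heat_kernel (2 * ?t) (x - y))"
        unfolding real_norm_def[symmetric]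
      proof (rule Bochner_Integration.integral_norm_bound_integral)
        show "integrable lborel (\<lambda>y. (\<psi> y - \<psi> x) * heat_kernel ?t (x - y))"
          using integrable_mult_heat_kernel[OF _ B t] integrable_heat_kernel[OF t] by (simp add: left_diff_distrib)
        show "integrable lborel (\<lambda>y. r / 2 * heat_kernel ?t (x - y) + ?q * heat_kernel (2 * ?t) (x - y))"
          using integrable_heat_kernel[OF t] integrable_heat_kernel[of "2 * ?t"] t by simp
        fix y
        show "norm ((\<psi> y - \<psi> x) * heat_kernel ?t (x - y)) \<le> r / 2 * heat_kernel ?t (x - y) + ?q * heat_kernel (2 * ?t) (x - y)"
        proof (cases "dist y x < \<delta>")
          case True
          then have "\<bar>\<psi> y - \<psi> x\<bar> * heat_kernel ?t (x - y) \<le> r / 2 * heat_kernel ?t (x - y)"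
            using \<delta>(2)[OF True] t by (intro mult_right_mono) (auto simp: dist_norm)
          moreover have "0 \<le> ?q * heat_kernel (2 * ?t) (x - y)" using t B0 by simp
          moreover have "norm ((\<psi> y - \<psi> x) * heat_kernel ?t (x - y)) = \<bar>\<psi> y - \<psi> x\<bar> * heat_kernel ?t (x - y)"
            using t by (simp add: abs_mult)
          ultimately show ?thesis by linarith
        next
          case False
          then have d: "\<delta>\<^sup>2 \<le> (norm (x - y))\<^sup>2"
            using \<delta>(1) by (intro power_mono) (auto simp: dist_norm norm_minus_commute)
          have "heat_kernel ?t (x - y) = 2 * exp (- (norm (x - y))\<^sup>2 / (8 * ?t)) * heat_kernel (2 * ?t) (x - y)"
            using t by (simp add: heat_kernel_def field_simps flip: exp_add)
          also have "\<dots> \<le> 2 * exp (- \<delta>\<^sup>2 / (8 * ?t)) * heat_kernel (2 * ?t) (x - y)"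
            using d t by (intro mult_right_mono mult_left_mono) (auto simp: divide_right_mono)
          finally have "\<bar>\<psi> y - \<psi> x\<bar> * heat_kernel ?t (x - y) \<le> (2 * B) * (2 * exp (- \<delta>\<^sup>2 / (8 * ?t)) * heat_kernel (2 * ?t) (x - y))"
            using B[of x] B[of y] t B0 by (intro mult_mono) auto
          moreover have "0 \<le> r / 2 * heat_kernel ?t (x - y)" using t r by simp
          ultimately show ?thesis using t by (simp add: abs_mult mult_ac)
        qed
      qed
      also have "\<dots> = r / 2 + ?q"
        using integrable_heat_kernel[OF t] integrable_heat_kernel[of "2 * ?t"] t
          integral_heat_kernel[OF t] integral_heat_kernel[of "2 * ?t"] by simp
      finally show ?thesis .
    qed
    have "filterlim s (at_right 0) sequentially"
      using s(2) less_imp_neq[OF s(1)] s(1) by (auto simp: filterlim_at intro!: always_eventually)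
    moreover have "((\<lambda>t. 4 * B * exp (- \<delta>\<^sup>2 / (8 * t))) \<longlongrightarrow> 0) (at_right 0)"
      using \<delta>(1) by real_asymp
    ultimately have "(\<lambda>n. 4 * B * exp (- \<delta>\<^sup>2 / (8 * s n))) \<longlonglongrightarrow> 0"
      by (rule filterlim_compose[rotated])
    then have "eventually (\<lambda>n. 4 * B * exp (- \<delta>\<^sup>2 / (8 * s n)) < r / 2) sequentially"
      using r by (intro order_tendstoD(2)) auto
    then obtain N where "\<And>n. n \<ge> N \<Longrightarrow> 4 * B * exp (- \<delta>\<^sup>2 / (8 * s n)) < r / 2"
      by (auto simp: eventually_sequentially)
    then show "\<exists>no. \<forall>n\<ge>no. norm (heat (s n) (distr_of \<psi>) x - \<psi> x) < r"
      using est by (intro exI[of _ N]) (smt (verit) field_sum_of_halves real_norm_def)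
  qed
qed

text \<open>Only functions \<open>G\<^sub>s * \<psi>\<close> with \<open>\<psi>\<close> continuous of bounded support serve as test functions: they are
  Schwartz because \<open>G\<^sub>s\<close> is, and \<open>s \<rightarrow> 0\<close> gives back \<open>\<psi>\<close>.\<close>

lemma duality_continuous:
  assumes w: "w \<in> borel_measurable borel" "integrable lborel (\<lambda>x. \<bar>w x\<bar> powr (4/3))"
    and le: "\<And>s. 0 < s \<Longrightarrow> s \<le> 1 \<Longrightarrow> \<bar>LINT x|lborel. w x * heat s (distr_of \<psi>) x\<bar> \<le> K"
    and cont: "continuous_on UNIV \<psi>" and R: "R \<ge> 0" "\<And>x. norm x > R \<Longrightarrow> \<psi> x = 0" and B: "\<And>x. \<bar>\<psi> x\<bar> \<le> B"
  shows "\<bar>LINT x|lborel. w x * \<psi> x\<bar> \<le> K"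
proof -
  note [measurable] = w(1)
  have [measurable]: "\<psi> \<in> borel_measurable borel" using cont by (rule borel_measurable_continuous_onI)
  define s where "s n = 1 / real (Suc n)" for n
  have s: "s n > 0" "s n \<le> 1" for n by (auto simp: s_def)
  have s0: "s \<longlonglongrightarrow> 0" unfolding s_def by (rule LIMSEQ_Suc[OF lim_1_over_n])
  define E where "E x = 2 * B * exp (R\<^sup>2 / 8) * exp (- (1 / 32) * (norm x)\<^sup>2)" for x :: plane
  have "(\<lambda>n. LINT x|lborel. w x * heat (s n) (distr_of \<psi>) x) \<longlonglongrightarrow> (LINT x|lborel. w x * \<psi> x)"
  proof (rule integral_dominated_convergence[where w="\<lambda>x. \<bar>w x * E x\<bar>"])
    show "integrable lborel (\<lambda>x. \<bar>w x * E x\<bar>)"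
      using L43_mult_gaussian_integrable[OF w, of "1 / 32"]
      unfolding E_def by (intro integrable_abs) (simp add: mult.left_commute[of "w _"])
    show "AE x in lborel. (\<lambda>n. w x * heat (s n) (distr_of \<psi>) x) \<longlonglongrightarrow> w x * \<psi> x"
      using heat_tendsto[OF cont B s(1) s0] by (intro AE_I2 tendsto_mult_left)
    show "AE x in lborel. norm (w x * heat (s n) (distr_of \<psi>) x) \<le> \<bar>w x * E x\<bar>" for n
    proof (intro AE_I2)
      fix x
      have "\<bar>heat (s n) (distr_of \<psi>) x\<bar> \<le> E x"
        unfolding E_def by (rule heat_gaussian_bound[OF _ B R s]) measurable
      then show "norm (w x * heat (s n) (distr_of \<psi>) x) \<le> \<bar>w x * E x\<bar>"
        by (auto simp: abs_mult intro!: mult_left_mono)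
    qed
  qed measurable
  then have "(\<lambda>n. \<bar>LINT x|lborel. w x * heat (s n) (distr_of \<psi>) x\<bar>) \<longlonglongrightarrow> \<bar>LINT x|lborel. w x * \<psi> x\<bar>"
    by (rule tendsto_rabs)
  then show ?thesis by (rule LIMSEQ_le_const2) (use le s in auto)
qed

lemma L43_ball_integrable:
  fixes w :: "plane \<Rightarrow> real"
  assumes w: "w \<in> borel_measurable borel" "integrable lborel (\<lambda>x. \<bar>w x\<bar> powr (4/3))"
  shows "integrable lborel (\<lambda>x::plane. w x * indicator (cball 0 R) x)"
proof (rule Bochner_Integration.integrable_bound)
  note [measurable] = w(1)
  show "integrable lborel (\<lambda>x. w x * exp (- 1 * (norm x)\<^sup>2) * exp (R\<^sup>2))"
    using L43_mult_gaussian_integrable[OF w, of 1] by simp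
  show "AE x in lborel. norm (w x * indicator (cball 0 R) x) \<le> norm (w x * exp (- 1 * (norm x)\<^sup>2) * exp (R\<^sup>2))"
  proof (intro AE_I2)
    fix x :: plane
    have "indicator (cball 0 R) x \<le> exp (R\<^sup>2 - (norm x)\<^sup>2)"
    proof (cases "norm x \<le> R")
      case True
      then have "(norm x)\<^sup>2 \<le> R\<^sup>2" by (intro power_mono) auto
      then show ?thesis by (auto simp: indicator_def)
    qed (simp add: indicator_def)
    then have "\<bar>w x\<bar> * indicator (cball 0 R) x \<le> \<bar>w x\<bar> * exp (R\<^sup>2 - (norm x)\<^sup>2)" by (intro mult_left_mono) auto
    also have "exp (R\<^sup>2 - (norm x)\<^sup>2) = exp (- 1 * (norm x)\<^sup>2) * exp (R\<^sup>2)"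
      by (simp flip: exp_add)
    finally show "norm (w x * indicator (cball 0 R) x) \<le> norm (w x * exp (- 1 * (norm x)\<^sup>2) * exp (R\<^sup>2))"
      by (simp only: real_norm_def abs_mult abs_exp_cancel mult.assoc) simp
  qed
qed (use w in \<open>auto intro!: borel_measurable_times borel_measurable_indicator\<close>)

text \<open>Passes from continuous to bounded measurable test functions. The strict inequality on
  the integral of the fourth power leaves room for the approximants, whose integrals merely converge
  to that of \<open>\<psi>\<close>.\<close>

lemma duality_bounded:
  assumes w: "w \<in> borel_measurable borel" "integrable lborel (\<lambda>x. \<bar>w x\<bar> powr (4/3))"
    and le: "\<And>\<psi> s B. continuous_on UNIV \<psi> \<Longrightarrow> (\<exists>R. \<forall>x. norm x > R \<longrightarrow> \<psi> x = 0) \<Longrightarrow> 0 < s \<Longrightarrow> s \<le> 1 \<Longrightarrow> 0 < B \<Longrightarrow>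
       (LINT x|lborel. \<psi> x ^ 4) \<le> B ^ 4 \<Longrightarrow> \<bar>LINT x|lborel. w x * heat s (distr_of \<psi>) x\<bar> \<le> A * B"
    and [measurable]: "\<psi> \<in> borel_measurable borel" and n: "n \<ge> 0" "\<And>x. \<bar>\<psi> x\<bar> \<le> n" "\<And>x. norm x > n \<Longrightarrow> \<psi> x = 0"
    and B: "B > 0" "(LINT x|lborel. \<psi> x ^ 4) < B ^ 4"
  shows "\<bar>LINT x|lborel. w x * \<psi> x\<bar> \<le> A * B"
proof -
  note [measurable] = w(1)
  have "\<psi> \<in> borel_measurable lebesgue" using assms(4) by (simp add: measurable_completion)
  \<comment> \<open>\<open>measurable_on\<close> supplies continuous functions converging to
    \<open>\<psi>\<close> off a negligible set, but without any common bound.\<close>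
  then have "\<psi> measurable_on UNIV" by (rule lebesgue_measurable_imp_measurable_on) auto
  then obtain N g where N: "negligible N" and g: "\<And>k. continuous_on UNIV (g k)" "\<And>x. x \<notin> N \<Longrightarrow> (\<lambda>k. g k x) \<longlonglongrightarrow> \<psi> x"
    unfolding measurable_on_def by auto
  have AEN: "AE x in lborel. x \<notin> N"
  proof -
    have "AE x in lebesgue. x \<notin> N" using N AE_not_in by (simp add: negligible_iff_null_sets)
    then show ?thesis by (simp only: AE_completion_iff)
  qed
  \<comment> \<open>Clipping to [-n, n] and a continuous cutoff equal to 1 on the ball of radius
    \<open>n\<close> make the approximants dominated; the limit is unchanged, as
    \<open>\<psi>\<close> obeys both restrictions.\<close>
  define h where "h k x = max (-n) (min n (g k x)) * max 0 (min 1 (n + 1 - norm x))" for k x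
  have hc: "continuous_on UNIV (h k)" for k
    unfolding h_def by (intro continuous_intros g)
  have [measurable]: "h k \<in> borel_measurable borel" for k
    using hc by (rule borel_measurable_continuous_onI)
  have h0: "norm x > n + 1 \<Longrightarrow> h k x = 0" for k x by (simp add: h_def)
  have hb: "\<bar>h k x\<bar> \<le> n * indicator (cball 0 (n + 1)) x" for k x
  proof (cases "norm x \<le> n + 1")
    case True
    have "\<bar>h k x\<bar> \<le> n * 1" unfolding h_def abs_mult using n(1) by (intro mult_mono) auto
    then show ?thesis using True by simp
  qed (simp add: h0)
  have hb': "\<bar>h k x\<bar> \<le> n" for k x
    using hb[of k x] n(1) by (auto split: split_indicator_asm)
  have hlim: "(\<lambda>k. h k x) \<longlonglongrightarrow> \<psi> x" if "x \<notin> N" for x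
  proof -
    have "(\<lambda>k. h k x) \<longlonglongrightarrow> max (-n) (min n (\<psi> x)) * max 0 (min 1 (n + 1 - norm x))"
      unfolding h_def by (intro tendsto_intros g that)
    also have "max (-n) (min n (\<psi> x)) * max 0 (min 1 (n + 1 - norm x)) = \<psi> x"
      using n(2)[of x] n(3)[of x] n(1) by (cases "norm x > n") (auto simp: max_def min_def abs_le_iff)
    finally show ?thesis .
  qed
  have 1: "(\<lambda>k. LINT x|lborel. w x * h k x) \<longlonglongrightarrow> (LINT x|lborel. w x * \<psi> x)"
  proof (rule integral_dominated_convergence[where w="\<lambda>x. n * \<bar>w x * indicator (cball 0 (n + 1)) x\<bar>"])
    show "integrable lborel (\<lambda>x. n * \<bar>w x * indicator (cball 0 (n + 1)) x\<bar>)"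
      using L43_ball_integrable[OF w] by (intro integrable_mult_right integrable_abs)
    show "AE x in lborel. (\<lambda>k. w x * h k x) \<longlonglongrightarrow> w x * \<psi> x"
      using AEN by eventually_elim (intro tendsto_mult_left hlim)
    show "AE x in lborel. norm (w x * h k x) \<le> n * \<bar>w x * indicator (cball 0 (n + 1)) x\<bar>" for k
      using mult_left_mono[OF hb, of "\<bar>w _\<bar>"] by (intro AE_I2) (simp add: abs_mult mult_ac)
  qed measurable
  have 2: "(\<lambda>k. LINT x|lborel. h k x ^ 4) \<longlonglongrightarrow> (LINT x|lborel. \<psi> x ^ 4)"
  proof (rule integral_dominated_convergence[where w="\<lambda>x. n ^ 4 * indicator (cball 0 (n + 1)) x"])
    show "integrable lborel (\<lambda>x::plane. n ^ 4 * indicator (cball 0 (n + 1)) x)"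
      by (intro integrable_mult_right integrable_real_indicator emeasure_bounded_finite) auto
    show "AE x in lborel. (\<lambda>k. h k x ^ 4) \<longlonglongrightarrow> \<psi> x ^ 4"
      using AEN by eventually_elim (intro tendsto_power hlim)
    show "AE x in lborel. norm (h k x ^ 4) \<le> n ^ 4 * indicator (cball 0 (n + 1)) x" for k
    proof (intro AE_I2)
      fix x
      show "norm (h k x ^ 4) \<le> n ^ 4 * indicator (cball 0 (n + 1)) x"
        using power_mono[OF hb'[of k x] abs_ge_zero, of 4] h0[of x k] by (cases "norm x \<le> n + 1") (auto simp: power_abs)
    qed
  qed measurable
  have "eventually (\<lambda>k. (LINT x|lborel. h k x ^ 4) < B ^ 4) sequentially"
    using 2 B(2) by (rule order_tendstoD(2))
  then have "eventually (\<lambda>k. \<bar>LINT x|lborel. w x * h k x\<bar> \<le> A * B) sequentially"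
  proof eventually_elim
    case (elim k)
    show ?case
    proof (rule duality_continuous[OF w _ hc _ h0 hb'])
      fix s :: real assume "0 < s" "s \<le> 1"
      then show "\<bar>LINT x|lborel. w x * heat s (distr_of (h k)) x\<bar> \<le> A * B"
        using h0 elim B(1) by (intro le[OF hc]) (auto intro: less_imp_le)
    qed (use n in auto)
  qed
  then show ?thesis
    using tendsto_upperbound[OF tendsto_rabs[OF 1]] by simp
qed

text \<open>The converse of Hoelder's inequality, with the extremal function sgn w |w|^(1/3),
  truncated by \<open>\<kappa>\<close> so as to be bounded with bounded support.\<close>

lemma L43_bound_by_duality:
  assumes w: "w \<in> borel_measurable borel" "integrable lborel (\<lambda>x. \<bar>w x\<bar> powr (4/3))" and A: "A > 0"
    and le: "\<And>\<psi> s B. continuous_on UNIV \<psi> \<Longrightarrow> (\<exists>R. \<forall>x. norm x > R \<longrightarrow> \<psi> x = 0) \<Longrightarrow> 0 < s \<Longrightarrow> s \<le> 1 \<Longrightarrow> 0 < B \<Longrightarrow>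
       (LINT x|lborel. \<psi> x ^ 4) \<le> B ^ 4 \<Longrightarrow> \<bar>LINT x|lborel. w x * heat s (distr_of \<psi>) x\<bar> \<le> A * B"
  shows "L43_bound w A"
proof -
  note [measurable] = w(1)
  define \<kappa> where "\<kappa> n x = (if \<bar>w x\<bar> \<le> real (Suc n) \<and> norm x \<le> real (Suc n) then 1 else (0::real))" for n x
  have [measurable]: "\<kappa> n \<in> borel_measurable borel" for n unfolding \<kappa>_def by measurable
  define I where "I n = (LINT x|lborel. \<bar>w x\<bar> powr (4/3) * \<kappa> n x)" for n
  have Ile: "I n \<le> A powr (4/3)" for n
  proof (rule ccontr)
    assume "\<not> I n \<le> A powr (4/3)"
    then have I: "I n > A powr (4/3)" by simp
    then have I0: "I n > 0" using A by (smt (verit) powr_gt_zero)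
    define \<psi> where "\<psi> x = sgn (w x) * \<bar>w x\<bar> powr (1/3) * \<kappa> n x" for x
    have [measurable]: "\<psi> \<in> borel_measurable borel" unfolding \<psi>_def by measurable
    have wpsi: "w x * \<psi> x = \<bar>w x\<bar> powr (4/3) * \<kappa> n x" for x
    proof -
      have "\<bar>w x\<bar> powr (4/3) = \<bar>w x\<bar> * \<bar>w x\<bar> powr (1/3)"
        using powr_mult_base[of "\<bar>w x\<bar>" "1/3"] by simp
      then show ?thesis by (simp add: \<psi>_def mult.assoc[symmetric] abs_sgn[symmetric] del: abs_sgn)
    qed
    have psi4: "\<psi> x ^ 4 = \<bar>w x\<bar> powr (4/3) * \<kappa> n x" for x
    proof -
      have "(\<bar>w x\<bar> powr (1/3)) ^ 4 = \<bar>w x\<bar> powr (4/3)"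
        by (cases "w x = 0") (simp_all add: powr_powr flip: powr_numeral)
      moreover have "\<kappa> n x ^ 4 = \<kappa> n x" by (simp add: \<kappa>_def)
      moreover have "sgn (w x) ^ 4 * \<bar>w x\<bar> powr (4/3) = \<bar>w x\<bar> powr (4/3)" by (simp add: sgn_if)
      ultimately show ?thesis by (simp add: \<psi>_def power_mult_distrib)
    qed
    \<comment> \<open>Room for a \<open>B\<close> above the L^4 norm I^(1/4) of the test function
      and below I / A, where the tested bound I <= A B fails.\<close>
    have I14: "I n powr (1/4) < I n / A"
    proof -
      have "A = (A powr (4/3)) powr (3/4)" using A by (simp add: powr_powr)
      also have "\<dots> < I n powr (3/4)" using I by (intro powr_less_mono2) auto
      finally have "A * I n powr (1/4) < I n powr (3/4) * I n powr (1/4)" using I0 by (intro mult_strict_right_mono) auto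
      then have "A * I n powr (1/4) < I n" using I0 by (simp flip: powr_add)
      then show ?thesis using A by (simp add: field_simps)
    qed
    then obtain B where B: "I n powr (1/4) < B" "B < I n / A" using dense by blast
    have B0: "B > 0" using B(1) by (smt (verit) powr_ge_zero)
    have "\<bar>LINT x|lborel. w x * \<psi> x\<bar> \<le> A * B"
    proof (rule duality_bounded[OF w le, where n="real (Suc n)"])
      show "\<bar>\<psi> x\<bar> \<le> real (Suc n)" for x
      proof (cases "\<bar>w x\<bar> \<le> real (Suc n) \<and> norm x \<le> real (Suc n)")
        case True
        have "\<bar>w x\<bar> powr (1/3) \<le> real (Suc n) powr (1/3)" using True by (intro powr_mono2) auto
        also have "\<dots> \<le> real (Suc n) powr 1" by (intro powr_mono) auto
        finally show ?thesis using True by (auto simp: \<psi>_def \<kappa>_def abs_mult sgn_if)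
      qed (auto simp: \<psi>_def \<kappa>_def)
      show "norm x > real (Suc n) \<Longrightarrow> \<psi> x = 0" for x by (simp add: \<psi>_def \<kappa>_def)
      have "I n = (I n powr (1/4)) powr 4" using I0 by (simp add: powr_powr)
      also have "\<dots> < B powr 4" using B(1) by (intro powr_less_mono2) auto
      also have "\<dots> = B ^ 4" using B0 by (simp add: powr_numeral)
      finally show "(LINT x|lborel. \<psi> x ^ 4) < B ^ 4" by (simp add: psi4 I_def)
    qed (use B0 in auto)
    then have "I n \<le> A * B" unfolding wpsi by (simp add: I_def)
    with B(2) A show False by (simp add: field_simps)
  qed
  have "I \<longlonglongrightarrow> (LINT x|lborel. \<bar>w x\<bar> powr (4/3))"
    unfolding I_def
  proof (rule integral_dominated_convergence[where w="\<lambda>x. \<bar>w x\<bar> powr (4/3)"])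
    show "AE x in lborel. (\<lambda>n. \<bar>w x\<bar> powr (4/3) * \<kappa> n x) \<longlonglongrightarrow> \<bar>w x\<bar> powr (4/3)"
    proof (intro AE_I2 tendsto_eventually)
      fix x
      obtain N where "max \<bar>w x\<bar> (norm x) \<le> real N" using real_arch_simple by blast
      then show "\<forall>\<^sub>F n in sequentially. \<bar>w x\<bar> powr (4/3) * \<kappa> n x = \<bar>w x\<bar> powr (4/3)"
        unfolding eventually_sequentially by (intro exI[of _ N]) (auto simp: \<kappa>_def)
    qed
  qed (use w in \<open>auto simp: \<kappa>_def\<close>)
  then have "(LINT x|lborel. \<bar>w x\<bar> powr (4/3)) \<le> A powr (4/3)"
    by (rule LIMSEQ_le_const2) (use Ile in auto)
  then show ?thesis using w by (intro L43_boundI)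
qed

section \<open>The self-similar profile\<close>

locale profile =
  fixes M :: real and \<xi> \<xi>' :: "real \<Rightarrow> real"
  assumes profile: "debye_profile M \<xi> \<xi>'" and M_pos: "M > 0"
begin

text \<open>The second derivative as the profile equation expresses it. At 0 the quotient \<xi> y /
  y is replaced by its limit, which makes the function continuous on the closed half-line.\<close>

definition \<xi>2 :: "real \<Rightarrow> real" where
  "\<xi>2 y = ((if y = 0 then \<xi>' 0 else \<xi> y / y) / 2 - 1/4) * \<xi>' y"

lemma xi_0: "\<xi> 0 = 0"
  and xi_lim: "(\<xi> \<longlongrightarrow> M / (2 * pi)) at_top"
  and xi'_cont: "continuous_on {0..} \<xi>'"
  and xi_deriv_within: "y \<ge> 0 \<Longrightarrow> (\<xi> has_real_derivative \<xi>' y) (at y within {0..})"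
  using profile by (auto simp: debye_profile_def)

lemma xi_deriv: "y > 0 \<Longrightarrow> (\<xi> has_real_derivative \<xi>' y) (at y)"
  using xi_deriv_within[of y] at_within_interior[of y "{0..}"] by (simp add: interior_real_atLeast)

lemma xi_cont: "continuous_on {0..} \<xi>"
  using xi_deriv_within DERIV_continuous_on by (metis atLeast_iff)

lemma xi'_deriv: "y > 0 \<Longrightarrow> (\<xi>' has_real_derivative \<xi>2 y) (at y)"
proof -
  assume y: "y > 0"
  obtain \<xi>'' where "(\<xi>' has_real_derivative \<xi>'' y) (at y)"
    "\<xi>'' y + 1/4 * \<xi>' y - 1 / (2 * y) * \<xi> y * \<xi>' y = 0"
    using profile y by (auto simp: debye_profile_def)
  moreover from this y have "\<xi>'' y = \<xi>2 y" by (simp add: \<xi>2_def algebra_simps)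
  ultimately show ?thesis by simp
qed

text \<open>Continuity at 0 amounts to \<xi> y / y tending to the one-sided derivative \<xi>' 0, as
  \<xi> vanishes there. It is what makes \<open>grad_U\<close> continuous at the origin.\<close>

lemma xi2_cont: "continuous_on {0..} \<xi>2"
proof -
  have "continuous_on {0..} (\<lambda>y. if y = 0 then \<xi>' 0 else \<xi> y / y)"
    unfolding continuous_on_eq_continuous_within
  proof
    fix x :: real assume x: "x \<in> {0..}"
    show "continuous (at x within {0..}) (\<lambda>y. if y = 0 then \<xi>' 0 else \<xi> y / y)"
    proof (cases "x = 0")
      case True
      have "((\<lambda>y. (\<xi> y - \<xi> 0) / (y - 0)) \<longlongrightarrow> \<xi>' 0) (at 0 within {0..})"
        using xi_deriv_within[of 0] by (simp add: has_field_derivative_iff)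
      then have "((\<lambda>y. if y = 0 then \<xi>' 0 else \<xi> y / y) \<longlongrightarrow> \<xi>' 0) (at 0 within {0..})"
        by (rule Lim_transform_eventually) (auto simp: eventually_at_filter xi_0)
      then show ?thesis using True by (simp add: continuous_within)
    next
      case False
      have "continuous (at x within {0..}) (\<lambda>y. \<xi> y / y)"
        using xi_cont x False by (intro continuous_intros) (auto simp: continuous_on_eq_continuous_within)
      moreover have "\<forall>\<^sub>F y in at x within {0..}. (if y = 0 then \<xi>' 0 else \<xi> y / y) = \<xi> y / y"
      proof -
        have "\<forall>\<^sub>F y in at x within {0..}. y \<noteq> 0"
          using tendsto_ident_at False by (rule tendsto_imp_eventually_ne)
        then show ?thesis by eventually_elim simp
      qed
      ultimately show ?thesis
        using False unfolding continuous_within by (simp add: filterlim_cong)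
    qed
  qed
  then show ?thesis
    unfolding \<xi>2_def[abs_def] by (intro continuous_intros xi'_cont) auto
qed

text \<open>With \<xi> regarded as a coefficient, the profile equation is linear of first order in
  \<xi>', so an integrating factor preserves the sign.\<close>

lemma xi'_sign:
  assumes "0 < y1" "y1 < y2"
  shows "\<exists>r>0. \<xi>' y2 = r * \<xi>' y1"
proof -
  have "continuous_on {y1..y2} (\<lambda>y. \<xi> y / y / 2 - 1/4)"
    using assms by (intro continuous_intros continuous_on_subset[OF xi_cont]) auto
  then obtain g where g: "\<And>y. y \<in> {y1..y2} \<Longrightarrow> (g has_vector_derivative (\<xi> y / y / 2 - 1/4)) (at y within {y1..y2})"
    using antiderivative_continuous by blast
  have "\<exists>c. \<forall>y\<in>{y1..y2}. \<xi>' y * exp (- g y) = c"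
  proof (rule has_field_derivative_zero_constant)
    fix y assume y: "y \<in> {y1..y2}"
    have "((\<lambda>y. \<xi>' y * exp (- g y)) has_real_derivative \<xi>2 y * exp (- g y) + (exp (- g y) * - (\<xi> y / y / 2 - 1/4)) * \<xi>' y) (at y within {y1..y2})"
      using g[OF y] xi'_deriv[of y] y assms
      by (auto intro!: derivative_eq_intros simp: has_real_derivative_iff_has_vector_derivative[symmetric] intro: has_field_derivative_at_within)
    then show "((\<lambda>y. \<xi>' y * exp (- g y)) has_real_derivative 0) (at y within {y1..y2})"
      using y assms by (simp add: \<xi>2_def algebra_simps)
  qed simp
  then have "\<xi>' y2 * exp (- g y2) = \<xi>' y1 * exp (- g y1)" using assms by auto
  then have "\<xi>' y2 = exp (g y2 - g y1) * \<xi>' y1"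
    by (simp add: exp_minus exp_diff field_simps)
  then show ?thesis by (intro exI[of _ "exp (g y2 - g y1)"]) auto
qed

lemma xi_mvt:
  assumes "0 \<le> a" "a < b"
  obtains c where "a < c" "c < b" "\<xi> b - \<xi> a = \<xi>' c * (b - a)"
proof (rule mvt[OF assms(2)])
  show "continuous_on {a..b} \<xi>" using assms by (intro continuous_on_subset[OF xi_cont]) auto
  show "(\<xi> has_derivative (*) (\<xi>' x)) (at x)" if "a < x" "x < b" for x
    using xi_deriv[of x] that assms by (simp add: has_field_derivative_def)
qed (use that in auto)

lemma xi'_mvt:
  assumes "0 \<le> a" "a < b"
  obtains c where "a < c" "c < b" "\<xi>' b - \<xi>' a = \<xi>2 c * (b - a)"
proof (rule mvt[OF assms(2)])
  show "continuous_on {a..b} \<xi>'" using assms by (intro continuous_on_subset[OF xi'_cont]) auto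
  show "(\<xi>' has_derivative (*) (\<xi>2 x)) (at x)" if "a < x" "x < b" for x
    using xi'_deriv[of x] that assms by (simp add: has_field_derivative_def)
qed (use that in auto)

text \<open>If \<xi>' were nonpositive at one point it would be so everywhere, which would make
  \<xi> nonpositive and contradict its positive limit.\<close>

lemma xi'_pos: 
  assumes "y > 0" shows "\<xi>' y > 0"
proof (rule ccontr)
  assume "\<not> \<xi>' y > 0"
  then have np: "\<xi>' z \<le> 0" if "z > 0" for z
    using xi'_sign[of y z] xi'_sign[of z y] that assms
    by (cases z y rule: linorder_cases) (auto simp: not_less mult_le_0_iff)
  have "\<xi> z \<le> 0" if z: "z > 0" for z
  proof -
    obtain c where "0 < c" "c < z" "\<xi> z - \<xi> 0 = \<xi>' c * (z - 0)"
      by (rule xi_mvt[of 0 z]) (use z in auto)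
    then show ?thesis using np[of c] z xi_0 by (simp add: mult_le_0_iff)
  qed
  then have "\<forall>\<^sub>F z in at_top. \<xi> z \<le> 0"
    by (intro eventually_mono[OF eventually_gt_at_top[of 0]])
  then have "M / (2 * pi) \<le> 0" using tendsto_upperbound[OF xi_lim] by auto
  then show False using M_pos by (simp add: field_simps)
qed

lemma tendsto_xi'_0: "(\<xi>' \<longlongrightarrow> \<xi>' 0) (at_right 0)"
proof -
  have "(\<xi>' \<longlongrightarrow> \<xi>' 0) (at 0 within {0..})"
    using xi'_cont by (auto simp: continuous_on_def)
  then show ?thesis by (rule tendsto_within_subset) auto
qed

lemma xi'_nonneg:
  assumes "y \<ge> 0" shows "\<xi>' y \<ge> 0"
proof (cases "y = 0")
  case True
  have "\<forall>\<^sub>F y in at_right 0. \<xi>' y \<ge> 0"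
    by (rule eventually_mono[OF eventually_at_right_less]) (use xi'_pos in \<open>auto intro: less_imp_le\<close>)
  then show ?thesis using tendsto_lowerbound[OF tendsto_xi'_0] True by auto
qed (use xi'_pos[of y] assms in auto)

lemma xi_mono: "0 \<le> a \<Longrightarrow> a \<le> b \<Longrightarrow> \<xi> a \<le> \<xi> b"
proof (cases "a = b")
  assume "0 \<le> a" "a \<le> b" "a \<noteq> b"
  then obtain c where "a < c" "c < b" "\<xi> b - \<xi> a = \<xi>' c * (b - a)" using xi_mvt[of a b] by auto
  moreover from this \<open>0 \<le> a\<close> have "\<xi>' c * (b - a) \<ge> 0" using xi'_nonneg[of c] by (intro mult_nonneg_nonneg) auto
  ultimately show ?thesis by simp
qed simp

lemma xi_nonneg: "y \<ge> 0 \<Longrightarrow> \<xi> y \<ge> 0"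
  using xi_mono[of 0 y] by (simp add: xi_0)

lemma xi_le: 
  assumes "y \<ge> 0" shows "\<xi> y \<le> M / (2 * pi)"
proof (rule tendsto_lowerbound[OF xi_lim])
  show "\<forall>\<^sub>F z in at_top. \<xi> y \<le> \<xi> z"
    by (rule eventually_mono[OF eventually_ge_at_top[of y]]) (use xi_mono[OF assms] in auto)
qed simp

text \<open>Since \<xi> and \<xi>' are nonnegative, the equation gives \<xi>'' >= -\<xi>' /
  4.\<close>

lemma xi'_lower:
  assumes "0 < z" "z \<le> y"
  shows "\<xi>' z * exp (- (y - z) / 4) \<le> \<xi>' y"
proof -
  have "\<xi>' z * exp (z / 4) \<le> \<xi>' y * exp (y / 4)"
  proof (rule DERIV_nonneg_imp_nondecreasing[OF assms(2)])
    fix x assume x: "z \<le> x" "x \<le> y"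
    have "((\<lambda>x. \<xi>' x * exp (x / 4)) has_real_derivative \<xi>2 x * exp (x / 4) + (exp (x / 4) * (1/4)) * \<xi>' x) (at x)"
      using x assms by (auto intro!: derivative_eq_intros xi'_deriv)
    moreover have "\<xi>2 x * exp (x / 4) + (exp (x / 4) * (1/4)) * \<xi>' x = \<xi> x / x / 2 * \<xi>' x * exp (x / 4)"
      using x assms by (simp add: \<xi>2_def algebra_simps)
    moreover have "\<dots> \<ge> 0" using x assms xi_nonneg[of x] xi'_nonneg[of x] by auto
    ultimately show "\<exists>d. ((\<lambda>x. \<xi>' x * exp (x / 4)) has_real_derivative d) (at x) \<and> d \<ge> 0" by metis
  qed
  then have "\<xi>' z * exp (z / 4) * exp (- y / 4) \<le> \<xi>' y * exp (y / 4) * exp (- y / 4)" by (intro mult_right_mono) auto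
  then show ?thesis by (simp add: mult.assoc diff_divide_distrib flip: exp_add)
qed

text \<open>Integrating \<open>xi'_lower\<close> from z to infinity adds at least 4 \<xi>' z to
  \<xi> z, and the total cannot exceed the limit M / (2 pi).\<close>

lemma xi'_le_pos:
  assumes z: "0 < z"
  shows "\<xi>' z \<le> M / (8 * pi)"
proof -
  define h where "h y = \<xi> y + 4 * \<xi>' z * exp (- (y - z) / 4)" for y
  have "h z \<le> h y" if "y \<ge> z" for y
  proof (rule DERIV_nonneg_imp_nondecreasing[OF that])
    fix x assume x: "z \<le> x" "x \<le> y"
    have "(h has_real_derivative \<xi>' x - \<xi>' z * exp (- (x - z) / 4)) (at x)"
      unfolding h_def using x z by (auto intro!: derivative_eq_intros xi_deriv)
    moreover have "\<xi>' x - \<xi>' z * exp (- (x - z) / 4) \<ge> 0" using xi'_lower[OF z x(1)] by simp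
    ultimately show "\<exists>d. (h has_real_derivative d) (at x) \<and> d \<ge> 0" by metis
  qed
  then have "\<forall>\<^sub>F y in at_top. h z \<le> h y"
    by (rule eventually_mono[OF eventually_ge_at_top[of z]])
  moreover have "(h \<longlongrightarrow> M / (2 * pi) + 4 * \<xi>' z * 0) at_top"
  proof -
    have "((\<lambda>y. exp (- (y - z) / 4)) \<longlongrightarrow> 0) at_top" by real_asymp
    then show ?thesis unfolding h_def by (intro tendsto_intros xi_lim)
  qed
  ultimately have "h z \<le> M / (2 * pi)" using tendsto_lowerbound[of h _ at_top "h z"] by simp
  then have "4 * \<xi>' z \<le> M / (2 * pi)" using xi_nonneg[of z] z by (simp add: h_def)
  then show ?thesis by simp
qed

lemma xi'_le: "y \<ge> 0 \<Longrightarrow> \<xi>' y \<le> M / (8 * pi)"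
proof (cases "y = 0")
  case True
  have "\<forall>\<^sub>F y in at_right 0. \<xi>' y \<le> M / (8 * pi)"
    by (rule eventually_mono[OF eventually_at_right_less]) (use xi'_le_pos in auto)
  then show ?thesis using tendsto_upperbound[OF tendsto_xi'_0] True by auto
qed (use xi'_le_pos[of y] in auto)

lemma xi_div_le: "y > 0 \<Longrightarrow> \<xi> y / y \<le> M / (8 * pi)"
  using xi_mvt[of 0 y] xi'_le by (metis diff_zero le_less_trans less_imp_le nonzero_mult_div_cancel_right order_less_irrefl xi_0 order_refl)

text \<open>The coefficient of \<xi>' in \<open>\<xi>2\<close> lies between -1/4 and M / (16 pi) -
  1/4, because \<xi> y / y is a mean value of \<xi>'.\<close>

lemma xi2_le:
  assumes "y \<ge> 0"
  shows "\<bar>\<xi>2 y\<bar> \<le> (M / (16 * pi) + 1/4) * \<xi>' y"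
proof -
  define q where "q = (if y = 0 then \<xi>' 0 else \<xi> y / y)"
  have "0 \<le> q" "q \<le> M / (8 * pi)"
    using assms xi'_nonneg[of 0] xi_nonneg[of y] xi'_le[of 0] xi_div_le[of y] by (auto simp: q_def)
  moreover have "M / (16 * pi) = M / (8 * pi) / 2" by simp
  ultimately have "\<bar>q / 2 - 1/4\<bar> \<le> M / (16 * pi) + 1/4" by linarith
  then show ?thesis unfolding \<xi>2_def abs_mult q_def[symmetric] using xi'_nonneg[OF assms] by (intro mult_mono) auto
qed

lemma xi'_decay: 
  obtains C where "C > 0" "\<And>y. y \<ge> 0 \<Longrightarrow> \<xi>' y \<le> C * exp (- y / 8)"
proof -
  \<comment> \<open>Beyond this point \<xi> y / y is at most (M / (2 pi)) / y0 = 1/4, so the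
    coefficient of \<xi>' in the equation is at most -1/8, the rate of decay obtained.\<close>
  define y0 where "y0 = 2 * M / pi"
  have y0: "y0 > 0" using M_pos by (simp add: y0_def)
  have dec: "\<xi>' y * exp (y / 8) \<le> \<xi>' y0 * exp (y0 / 8)" if "y \<ge> y0" for y
  proof (rule DERIV_nonpos_imp_nonincreasing[OF that])
    fix x assume x: "y0 \<le> x" "x \<le> y"
    then have x0: "x > 0" using y0 by simp
    have "((\<lambda>x. \<xi>' x * exp (x / 8)) has_real_derivative \<xi>2 x * exp (x / 8) + (exp (x / 8) * (1/8)) * \<xi>' x) (at x)"
      using x0 by (auto intro!: derivative_eq_intros xi'_deriv)
    moreover have "\<xi>2 x * exp (x / 8) + (exp (x / 8) * (1/8)) * \<xi>' x = (\<xi> x / x / 2 - 1/8) * (\<xi>' x * exp (x / 8))"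
      using x0 by (simp add: \<xi>2_def algebra_simps)
    moreover have "\<dots> \<le> 0"
    proof (rule mult_nonpos_nonneg)
      have "\<xi> x / x \<le> (M / (2 * pi)) / y0"
        using x y0 xi_le[of x] xi_nonneg[of x] M_pos by (intro frac_le) auto
      also have "\<dots> = 1/4" using M_pos by (simp add: y0_def)
      finally have "\<xi> x / x / 2 \<le> 1 / 4 / 2" by (intro divide_right_mono) auto
      then show "\<xi> x / x / 2 - 1/8 \<le> 0" by simp
    qed (use x0 xi'_nonneg[of x] in auto)
    ultimately show "\<exists>d. ((\<lambda>x. \<xi>' x * exp (x / 8)) has_real_derivative d) (at x) \<and> d \<le> 0" by metis
  qed
  define C where "C = M / (8 * pi) * exp (y0 / 8)"
  have "\<xi>' y \<le> C * exp (- y / 8)" if "y \<ge> 0" for y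
  proof -
    have "\<xi>' y * exp (y / 8) \<le> C"
    proof (cases "y \<ge> y0")
      case True
      then show ?thesis using dec[OF True] xi'_le[of y0] y0 unfolding C_def
        by (meson exp_ge_zero less_imp_le mult_right_mono order_trans)
    next
      case False
      then show ?thesis using xi'_le[OF that] xi'_nonneg[OF that] M_pos unfolding C_def by (intro mult_mono) auto
    qed
    then have "\<xi>' y * exp (y / 8) * exp (- y / 8) \<le> C * exp (- y / 8)" by (intro mult_right_mono) auto
    then show ?thesis by (simp add: mult.assoc flip: exp_add)
  qed
  moreover have "C > 0" using M_pos by (simp add: C_def)
  ultimately show ?thesis using that by blast
qed

end

section \<open>The self-similar solution: mass, size and gradient\<close>

context profile begin

definition U :: "real \<Rightarrow> plane \<Rightarrow> real" where
  "U t x = 2 / t * \<xi>' ((norm x)\<^sup>2 / t)"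

definition grad_U :: "real \<Rightarrow> plane \<Rightarrow> plane" where
  "grad_U t x = (4 / t\<^sup>2 * \<xi>2 ((norm x)\<^sup>2 / t)) *\<^sub>R x"

lemma U_nonneg: "t > 0 \<Longrightarrow> U t x \<ge> 0"
  unfolding U_def by (intro mult_nonneg_nonneg xi'_nonneg) auto

lemma U_continuous: "t > 0 \<Longrightarrow> continuous_on UNIV (U t)"
  unfolding U_def[abs_def]
  by (intro continuous_intros continuous_on_compose2[OF xi'_cont]) auto

lemma grad_U_continuous: "t > 0 \<Longrightarrow> continuous_on UNIV (grad_U t)"
  unfolding grad_U_def[abs_def]
  by (intro continuous_intros continuous_on_compose2[OF xi2_cont]) auto

lemma U_measurable: "t > 0 \<Longrightarrow> U t \<in> borel_measurable borel"
  using U_continuous by (intro borel_measurable_continuous_onI)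

lemma grad_U_measurable: "t > 0 \<Longrightarrow> grad_U t \<in> borel_measurable borel"
  using grad_U_continuous by (intro borel_measurable_continuous_onI)

lemma U_disc:
  assumes t: "t > 0" and \<rho>: "\<rho> \<ge> 0"
  shows "(\<integral>\<^sup>+x. ennreal (U t x) * indicator {0..\<rho>} ((norm x)\<^sup>2) \<partial>lborel) = ennreal (2 * pi * \<xi> (\<rho> / t))"
proof -
  let ?f = "\<lambda>s. 2 / t * \<xi>' (max 0 (s / t))"
  have "continuous_on UNIV ?f"
    by (intro continuous_intros continuous_on_compose2[OF xi'_cont]) (use t in auto)
  then have [measurable]: "?f \<in> borel_measurable borel" by (rule borel_measurable_continuous_onI)
  have "(\<integral>\<^sup>+x. ennreal (U t x) * indicator {0..\<rho>} ((norm x)\<^sup>2) \<partial>lborel)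
    = (\<integral>\<^sup>+x. ennreal (?f ((norm (x::plane))\<^sup>2)) * indicator {0..\<rho>} ((norm x)\<^sup>2) \<partial>lborel)"
    using t by (simp add: U_def max_def)
  also have "\<dots> = ennreal pi * (\<integral>\<^sup>+s. (ennreal (?f s) * indicator {0..\<rho>} s) * indicator {0..} s \<partial>lborel)"
    by (rule nn_integral_radial) measurable
  also have "(\<integral>\<^sup>+s. (ennreal (?f s) * indicator {0..\<rho>} s) * indicator {0..} s \<partial>lborel)
     = (\<integral>\<^sup>+s. ennreal (2 / t * \<xi>' (s / t)) * indicator {0..\<rho>} s \<partial>lborel)"
    using t by (intro nn_integral_cong) (auto split: split_indicator simp: max_def)
  also have "\<dots> = ennreal (2 * \<xi> (\<rho> / t) - 2 * \<xi> (0 / t))"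
  proof (rule nn_integral_has_integral_lebesgue')
    show "((\<lambda>s. 2 / t * \<xi>' (s / t)) has_integral 2 * \<xi> (\<rho> / t) - 2 * \<xi> (0 / t)) {0..\<rho>}"
    proof (rule fundamental_theorem_of_calculus[OF \<rho>])
      fix s assume s: "s \<in> {0..\<rho>}"
      have "((\<lambda>s. \<xi> (s / t)) has_real_derivative \<xi>' (s / t) * (1 / t)) (at s within {0..\<rho>})"
      proof (rule DERIV_image_chain[where g="\<lambda>s. s / t" and f=\<xi>, unfolded o_def])
        show "((\<lambda>s. s / t) has_real_derivative 1 / t) (at s within {0..\<rho>})"
          using t by (auto intro!: derivative_eq_intros)
        show "(\<xi> has_real_derivative \<xi>' (s / t)) (at (s / t) within (\<lambda>s. s / t) ` {0..\<rho>})"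
          using t s by (intro DERIV_subset[OF xi_deriv_within]) auto
      qed
      then show "((\<lambda>s. 2 * \<xi> (s / t)) has_vector_derivative 2 / t * \<xi>' (s / t)) (at s within {0..\<rho>})"
        unfolding has_real_derivative_iff_has_vector_derivative[symmetric]
        by (auto intro!: derivative_eq_intros)
    qed
  qed (use t xi'_nonneg in auto)
  also have "ennreal pi * \<dots> = ennreal (2 * pi * \<xi> (\<rho> / t))"
    using t \<rho> xi_nonneg[of "\<rho> / t"] by (simp add: xi_0 ennreal_mult[symmetric] mult_ac)
  finally show ?thesis .
qed

lemma U_mass:
  assumes t: "t > 0"
  shows "(\<integral>\<^sup>+x. ennreal (U t x) \<partial>lborel) = ennreal M"
proof (rule LIMSEQ_unique)
  note [measurable] = U_measurable[OF t]
  show "(\<lambda>n. \<integral>\<^sup>+x. ennreal (U t x) * indicator {0..real n} ((norm x)\<^sup>2) \<partial>lborel) \<longlonglongrightarrow> (\<integral>\<^sup>+x. ennreal (U t x) \<partial>lborel)"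
  proof (rule nn_integral_LIMSEQ)
    show "incseq (\<lambda>n x. ennreal (U t x) * indicator {0..real n} ((norm x)\<^sup>2))"
      by (auto simp: incseq_def le_fun_def split: split_indicator)
    show "(\<lambda>n. ennreal (U t x) * indicator {0..real n} ((norm x)\<^sup>2)) \<longlonglongrightarrow> ennreal (U t x)" for x
    proof (rule tendsto_eventually)
      obtain N where "(norm x)\<^sup>2 \<le> real N" using real_arch_simple by blast
      then show "\<forall>\<^sub>F n in sequentially. ennreal (U t x) * indicator {0..real n} ((norm x)\<^sup>2) = ennreal (U t x)"
        unfolding eventually_sequentially by (intro exI[of _ N]) (auto split: split_indicator)
    qed
  qed measurable
  have "filterlim (\<lambda>n. real n / t) at_top sequentially"
    using t by real_asymp
  then have "(\<lambda>n. 2 * pi * \<xi> (real n / t)) \<longlonglongrightarrow> 2 * pi * (M / (2 * pi))"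
    using filterlim_compose[OF xi_lim] by (intro tendsto_intros) blast
  then have "(\<lambda>n. ennreal (2 * pi * \<xi> (real n / t))) \<longlonglongrightarrow> ennreal M" by (intro tendsto_ennrealI) simp
  then show "(\<lambda>n. \<integral>\<^sup>+x. ennreal (U t x) * indicator {0..real n} ((norm x)\<^sup>2) \<partial>lborel) \<longlonglongrightarrow> ennreal M"
    using t by (simp add: U_disc)
qed

lemma U_integrable: "t > 0 \<Longrightarrow> integrable lborel (U t)"
  using U_mass U_measurable U_nonneg by (intro integrableI_nonneg) auto

lemma U_integral: "t > 0 \<Longrightarrow> (LINT x|lborel. U t x) = M"
  using U_mass U_measurable U_nonneg M_pos by (simp add: integral_eq_nn_integral)

lemma U_le: "t > 0 \<Longrightarrow> U t x \<le> M / (4 * pi * t)"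
proof -
  assume t: "t > 0"
  then have "U t x \<le> 2 / t * (M / (8 * pi))"
    unfolding U_def by (intro mult_left_mono xi'_le) auto
  then show ?thesis by (simp add: field_simps)
qed

text \<open>Interpolates between the mass M and the sup bound M / t, in which the factor 1 / (4 pi)
  has been dropped.\<close>

lemma U_L43:
  assumes t: "t > 0"
  shows "L43_bound (U t) (M * t powr (-1/4))"
proof -
  note [measurable] = U_measurable[OF t]
  have "(\<integral>\<^sup>+x. ennreal (\<bar>U t x\<bar> powr (4/3)) \<partial>lborel) \<le> (\<integral>\<^sup>+x. ennreal ((M / t) powr (1/3)) * ennreal (U t x) \<partial>lborel)"
  proof (rule nn_integral_mono)
    fix x
    have "U t x \<le> M / t"
    proof -
      have "M / (4 * pi * t) \<le> M / (1 * t)"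
        using t M_pos pi_ge_two by (intro divide_left_mono mult_right_mono) auto
      then show ?thesis using U_le[OF t, of x] by simp
    qed
    then have "U t x powr (1/3) * U t x \<le> (M / t) powr (1/3) * U t x"
      using U_nonneg[OF t, of x] by (intro mult_right_mono powr_mono2) auto
    moreover have "\<bar>U t x\<bar> powr (4/3) = U t x powr (1/3) * U t x"
      using powr_mult_base[OF U_nonneg[OF t], of x "1/3"] U_nonneg[OF t, of x] by (simp add: mult.commute)
    ultimately show "ennreal (\<bar>U t x\<bar> powr (4/3)) \<le> ennreal ((M / t) powr (1/3)) * ennreal (U t x)"
      by (simp add: ennreal_leI U_nonneg[OF t] flip: ennreal_mult)
  qed
  also have "\<dots> = ennreal ((M / t) powr (1/3)) * ennreal M"
    by (simp add: nn_integral_cmult U_mass[OF t])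
  also have "\<dots> = ennreal ((M / t) powr (1/3) * M)"
    using M_pos by (intro ennreal_mult[symmetric]) auto
  also have "(M / t) powr (1/3) * M = (M * t powr (-1/4)) powr (4/3)"
  proof -
    have "(M / t) powr (1/3) = M powr (1/3) * t powr (-1/3)"
      using M_pos t powr_minus_divide[of t "1/3"] by (simp add: powr_divide)
    moreover have "M powr (1/3) * M = M powr (4/3)"
      using powr_mult_base[of M "1/3"] M_pos by (simp add: mult.commute)
    moreover have "(M * t powr (-1/4)) powr (4/3) = M powr (4/3) * t powr (-1/3)"
      using M_pos t by (simp add: powr_mult powr_powr)
    ultimately show ?thesis by (simp add: mult_ac)
  qed
  finally show ?thesis by (simp add: L43_bound_def)
qed

text \<open>Away from the origin this is the chain rule. At the origin no derivative of \<xi>' is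
  given, but a Lipschitz bound for \<xi>' suffices, because its argument is quadratic in the
  increment.\<close>

lemma U_has_derivative:
  assumes t: "t > 0"
  shows "(U t has_derivative (\<lambda>h. grad_U t x \<bullet> h)) (at x)"
proof (cases "x = 0")
  case False
  then have y: "(norm x)\<^sup>2 / t > 0" using t by simp
  have "((\<lambda>x. (norm x)\<^sup>2 / t) has_derivative (\<lambda>h. 2 * (x \<bullet> h) / t)) (at x)"
    unfolding power2_norm_eq_inner using t by (auto intro!: derivative_eq_intros simp: inner_commute)
  from has_derivative_compose[OF this xi'_deriv[OF y, unfolded has_field_derivative_def]]
  have "((\<lambda>x. 2 / t * \<xi>' ((norm x)\<^sup>2 / t)) has_derivative (\<lambda>h. 2 / t * (\<xi>2 ((norm x)\<^sup>2 / t) * (2 * (x \<bullet> h) / t)))) (at x)"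
    by (rule has_derivative_mult_right)
  then show ?thesis
    unfolding U_def[abs_def] grad_U_def using t by (simp add: power2_eq_square mult_ac)
next
  case True
  obtain C where C: "C > 0" "\<And>y. y \<ge> 0 \<Longrightarrow> \<bar>\<xi>2 y\<bar> \<le> C"
  proof
    show "(M / (16 * pi) + 1/4) * (M / (8 * pi)) > 0" using M_pos by (simp add: add_pos_pos)
    show "\<bar>\<xi>2 y\<bar> \<le> (M / (16 * pi) + 1/4) * (M / (8 * pi))" if "y \<ge> 0" for y
      using xi2_le[OF that] xi'_le[OF that] M_pos by (elim order_trans, intro mult_left_mono) auto
  qed
  have lip: "\<bar>\<xi>' y - \<xi>' 0\<bar> \<le> C * y" if y: "y \<ge> 0" for y
  proof (cases "y = 0")
    case False
    with y have "0 < y" by simp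
    then obtain c where "0 < c" "c < y" "\<xi>' y - \<xi>' 0 = \<xi>2 c * (y - 0)" by (rule xi'_mvt[OF order_refl])
    then show ?thesis using C(2)[of c] by (simp add: abs_mult mult_right_mono)
  qed simp
  have "((\<lambda>h. norm (U t (0 + h) - U t 0 - 0) / norm h) \<longlongrightarrow> 0) (at 0)"
  proof (rule Lim_null_comparison)
    show "\<forall>\<^sub>F h in at 0. norm (norm (U t (0 + h) - U t 0 - 0) / norm h) \<le> 2 * C / t\<^sup>2 * norm h"
    proof (rule eventually_at_filter[THEN iffD2], rule always_eventually, safe)
      fix h :: plane
      assume "h \<noteq> 0"
      have "\<bar>U t h - U t 0\<bar> = 2 / t * \<bar>\<xi>' ((norm h)\<^sup>2 / t) - \<xi>' 0\<bar>"
      proof -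
        have "U t h - U t 0 = 2 / t * (\<xi>' ((norm h)\<^sup>2 / t) - \<xi>' 0)"
          unfolding U_def right_diff_distrib by simp
        then show ?thesis unfolding \<open>U t h - U t 0 = _\<close> abs_mult using t by simp
      qed
      also have "\<dots> \<le> 2 / t * (C * ((norm h)\<^sup>2 / t))"
        using t by (intro mult_left_mono lip) auto
      finally have "\<bar>U t h - U t 0\<bar> / norm h \<le> 2 / t * (C * ((norm h)\<^sup>2 / t)) / norm h" by (intro divide_right_mono) auto
      also have "\<dots> = 2 * C / t\<^sup>2 * norm h" by (simp add: power2_eq_square)
      finally show "norm (norm (U t (0 + h) - U t 0 - 0) / norm h) \<le> 2 * C / t\<^sup>2 * norm h" by simp
    qed
    show "((\<lambda>h::plane. 2 * C / t\<^sup>2 * norm h) \<longlongrightarrow> 0) (at 0)"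
      using t by (auto intro!: tendsto_eq_intros)
  qed
  then show ?thesis using True by (simp add: has_derivative_at grad_U_def)
qed

lemma U_decay:
  obtains C where "C > 0" "\<And>t x. t > 0 \<Longrightarrow> U t x \<le> C / t * exp (- (norm x)\<^sup>2 / (8 * t))"
    "\<And>t x. t > 0 \<Longrightarrow> norm (grad_U t x) \<le> C / t\<^sup>2 * norm x * exp (- (norm x)\<^sup>2 / (8 * t))"
proof -
  obtain C where C: "C > 0" "\<And>y. y \<ge> 0 \<Longrightarrow> \<xi>' y \<le> C * exp (- y / 8)" using xi'_decay by blast
  define K where "K = M / (16 * pi) + 1/4"
  have K: "K > 0" using M_pos by (auto simp: K_def intro: add_pos_pos)
  define D where "D = 2 * C + 4 * (K * C)"
  have D: "2 * C \<le> D" "4 * (K * C) \<le> D" "D > 0" using C K by (auto simp: D_def intro: add_pos_pos)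
  show ?thesis
  proof
    show "D > 0" by fact
    fix t :: real and x :: plane assume t: "t > 0"
    let ?y = "(norm x)\<^sup>2 / t"
    let ?e = "exp (- (norm x)\<^sup>2 / (8 * t))"
    have y: "?y \<ge> 0" and e: "exp (- ?y / 8) = ?e" using t by (simp_all add: mult.commute)
    have "U t x \<le> 2 / t * (C * ?e)"
      unfolding U_def using C(2)[OF y, unfolded e] t by (intro mult_left_mono) auto
    also have "\<dots> = 2 * C / t * ?e" by simp
    also have "\<dots> \<le> D / t * ?e" using D t by (intro mult_right_mono divide_right_mono) auto
    finally show "U t x \<le> D / t * ?e" .
    have "\<bar>\<xi>2 ?y\<bar> \<le> K * (C * ?e)"
      using xi2_le[OF y] C(2)[OF y, unfolded e] K unfolding K_def[symmetric] by (elim order_trans, intro mult_left_mono) auto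
    then have "norm (grad_U t x) \<le> 4 / t\<^sup>2 * (K * (C * ?e)) * norm x"
      unfolding grad_U_def norm_scaleR abs_mult by (intro mult_mono) auto
    also have "\<dots> = 4 * (K * C) / t\<^sup>2 * norm x * ?e" by simp
    also have "\<dots> \<le> D / t\<^sup>2 * norm x * ?e" using D t by (intro mult_right_mono divide_right_mono) auto
    finally show "norm (grad_U t x) \<le> D / t\<^sup>2 * norm x * ?e" .
  qed
qed

end

section \<open>Newton's theorem\<close>

definition rot :: "real \<Rightarrow> plane \<Rightarrow> plane" where
  "rot \<theta> x = (\<chi> i. if i = 1 then cos \<theta> * x $ 1 - sin \<theta> * x $ 2 else sin \<theta> * x $ 1 + cos \<theta> * x $ 2)"

text \<open>The plane is identified with the complex numbers because (x - y) / |x - y|^2 is the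
  conjugate of 1 / (X - Y), whose mean over a circle has an elementary antiderivative.\<close>

definition to_complex :: "plane \<Rightarrow> complex" where
  "to_complex x = Complex (x $ 1) (x $ 2)"

lemma to_complex_alt: "to_complex x = of_real (x $ 1) + \<i> * of_real (x $ 2)"
  by (simp add: to_complex_def complex_eq_iff)

lemma to_complex_measurable [measurable]: "to_complex \<in> borel_measurable borel"
  unfolding to_complex_alt[abs_def] by (intro borel_measurable_continuous_onI continuous_intros)

lemma norm_plane: "norm (x::plane) = sqrt ((x $ 1)\<^sup>2 + (x $ 2)\<^sup>2)"
  by (simp add: norm_vec_def L2_set_def sum_2)

lemma norm_to_complex: "norm (to_complex x) = norm x"
  by (simp add: to_complex_def norm_plane cmod_def)

lemma to_complex_diff: "to_complex (x - y) = to_complex x - to_complex y"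
  by (simp add: to_complex_def complex_eq_iff)

lemma to_complex_eq_0: "to_complex x = 0 \<longleftrightarrow> x = 0"
  using norm_to_complex[of x] by (metis norm_eq_zero)

lemma to_complex_rot: "to_complex (rot \<theta> x) = cis \<theta> * to_complex x"
  by (simp add: to_complex_def rot_def complex_eq_iff)

lemma norm_rot: "norm (rot \<theta> x) = norm x"
  by (metis to_complex_rot norm_to_complex norm_mult norm_cis mult_1)

lemma rot_rot: "rot \<theta> (rot (- \<theta>) x) = x"
proof -
  have "to_complex (rot \<theta> (rot (- \<theta>) x)) = to_complex x"
    by (simp add: to_complex_rot mult.assoc[symmetric] cis_mult)
  then show ?thesis
    by (auto simp: to_complex_def vec_eq_iff forall_2)
qed

lemma linear_rot: "linear (rot \<theta>)"
  by (rule linearI) (auto simp: rot_def vec_eq_iff algebra_simps)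

lemma orthogonal_transformation_rot: "orthogonal_transformation (rot \<theta>)"
  unfolding orthogonal_transformation using linear_rot norm_rot by auto

lemma rot_measurable [measurable]: "rot \<theta> \<in> borel_measurable borel"
  by (intro borel_measurable_continuous_onI linear_continuous_on linear_conv_bounded_linear[THEN iffD1] linear_rot)

text \<open>The preimage of a box is its image under the inverse rotation, and orthogonal maps
  preserve Lebesgue measure; boundedness of that image permits the passage from
  \<open>measure\<close> to \<open>emeasure\<close>.\<close>

lemma distr_rot: "distr lborel borel (rot \<theta>) = lborel"
proof (rule lborel_eqI[symmetric])
  fix l u :: plane assume "\<And>b. b \<in> Basis \<Longrightarrow> l \<bullet> b \<le> u \<bullet> b"
  have "rot \<theta> -` box l u = rot (- \<theta>) ` box l u"
  proof safe
    fix x assume "rot \<theta> x \<in> box l u"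
    moreover have "x = rot (- \<theta>) (rot \<theta> x)" using rot_rot[of "- \<theta>" x] by simp
    ultimately show "x \<in> rot (- \<theta>) ` box l u" by blast
  qed (simp add: rot_rot)
  moreover have R: "rot \<theta> -` box l u \<in> sets borel"
    using measurable_sets[OF rot_measurable, of "box l u" \<theta>] by simp
  moreover have "measure lebesgue (rot (- \<theta>) ` box l u) = measure lebesgue (box l u)"
    by (rule measure_orthogonal_image[OF orthogonal_transformation_rot]) simp
  ultimately have m: "measure lborel (rot \<theta> -` box l u) = measure lborel (box l u)"
    using measure_completion[of "rot \<theta> -` box l u" lborel] measure_completion[of "box l u" lborel] by simp
  have "bounded (rot (- \<theta>) ` box l u)"
    by (intro bounded_linear_image bounded_box linear_conv_bounded_linear[THEN iffD1] linear_rot)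
  then have "emeasure lborel (rot \<theta> -` box l u) < \<infinity>"
    using emeasure_bounded_finite \<open>rot \<theta> -` box l u = rot (- \<theta>) ` box l u\<close> by simp
  then have "emeasure lborel (rot \<theta> -` box l u) = emeasure lborel (box l u)"
    using m emeasure_eq_ennreal_measure[of lborel "rot \<theta> -` box l u"] emeasure_eq_ennreal_measure[of lborel "box l u"]
      emeasure_lborel_box_finite[of l u] by simp
  then show "emeasure (distr lborel borel (rot \<theta>)) (box l u) = ennreal (prod ((\<bullet>) (u - l)) Basis)"
    using \<open>\<And>b. b \<in> Basis \<Longrightarrow> l \<bullet> b \<le> u \<bullet> b\<close> by (subst emeasure_distr) (auto simp: emeasure_lborel_box)
qed simp

text \<open>With q = Y / X of modulus below 1, the number 1 - exp(i theta) q stays in the right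
  half-plane, so its logarithm is smooth and periodic; only the linear term of the antiderivative
  contributes.\<close>

lemma circle_mean_inside:
  fixes X Y :: complex
  assumes "norm Y < norm X"
  shows "((\<lambda>\<theta>. 1 / (X - cis \<theta> * Y)) has_integral (2 * pi / X)) {0..2*pi}"
proof -
  have X: "X \<noteq> 0" using assms by auto
  define q where "q = Y / X"
  have q: "norm q < 1" using assms X by (simp add: q_def norm_divide)
  define F where "F \<theta> = (of_real \<theta> + \<i> * Ln (1 - exp (\<i> * of_real \<theta>) * q)) / X" for \<theta> :: real
  have "((\<lambda>\<theta>. 1 / (X - cis \<theta> * Y)) has_integral (F (2*pi) - F 0)) {0..2*pi}"
  proof (rule fundamental_theorem_of_calculus)
    fix \<theta> :: real
    let ?e = "exp (\<i> * of_real \<theta>)"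
    have n: "norm (?e * q) < 1" using q by (simp add: norm_mult)
    then have "Re (?e * q) < 1" using complex_Re_le_cmod[of "?e * q"] by linarith
    then have "Re (1 - ?e * q) > 0" by simp
    then have nn: "1 - ?e * q \<notin> \<real>\<^sub>\<le>\<^sub>0" using complex_nonpos_Reals_iff by fastforce
    then have nz: "1 - ?e * q \<noteq> 0" by auto
    have "((\<lambda>z. (z + \<i> * Ln (1 - exp (\<i> * z) * q)) / X) has_field_derivative
       (1 + \<i> * (- (exp (\<i> * of_real \<theta>) * \<i> * q)) / (1 - exp (\<i> * of_real \<theta>) * q)) / X) (at (of_real \<theta>))"
      using X nn by (auto intro!: derivative_eq_intros simp: divide_inverse mult_ac)
    from has_vector_derivative_real_field[OF this]
    have "(F has_vector_derivative ((1 + \<i> * (- (?e * \<i> * q)) / (1 - ?e * q)) / X)) (at \<theta> within {0..2*pi})"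
      unfolding F_def[abs_def] by (simp add: o_def)
    moreover have "(1 + \<i> * (- (?e * \<i> * q)) / (1 - ?e * q)) / X = 1 / (X - cis \<theta> * Y)"
    proof -
      have "\<i> * (- (?e * \<i> * q)) = ?e * q" by (simp add: algebra_simps)
      then have "(1 + \<i> * (- (?e * \<i> * q)) / (1 - ?e * q)) / X = 1 / (1 - ?e * q) / X"
        using nz by (simp add: field_simps)
      also have "\<dots> = 1 / ((1 - ?e * q) * X)" by simp
      also have "(1 - ?e * q) * X = X - ?e * Y"
        using X by (simp add: q_def left_diff_distrib)
      finally show ?thesis by (simp add: cis_conv_exp)
    qed
    ultimately show "(F has_vector_derivative 1 / (X - cis \<theta> * Y)) (at \<theta> within {0..2*pi})" by simp
  qed simp
  moreover have "F (2*pi) - F 0 = 2 * pi / X"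
    by (simp add: F_def add_divide_distrib mult.commute[of \<i>])
  ultimately show ?thesis by simp
qed

text \<open>Now q = X / Y has modulus below 1 and the antiderivative has no linear term. It is
  periodic, hence the integral vanishes: outer rings exert no force.\<close>

lemma circle_mean_outside:
  fixes X Y :: complex
  assumes "norm X < norm Y" "X \<noteq> 0"
  shows "((\<lambda>\<theta>. 1 / (X - cis \<theta> * Y)) has_integral 0) {0..2*pi}"
proof -
  have Y: "Y \<noteq> 0" using assms by auto
  define q where "q = X / Y"
  have q: "norm q < 1" using assms Y by (simp add: q_def norm_divide)
  define F where "F \<theta> = (\<i> * Ln (1 - exp (- \<i> * of_real \<theta>) * q)) / X" for \<theta> :: real
  have "((\<lambda>\<theta>. 1 / (X - cis \<theta> * Y)) has_integral (F (2*pi) - F 0)) {0..2*pi}"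
  proof (rule fundamental_theorem_of_calculus)
    fix \<theta> :: real
    let ?e = "exp (- \<i> * of_real \<theta>)"
    have n: "norm (?e * q) < 1" using q by (simp add: norm_mult)
    then have "Re (?e * q) < 1" using complex_Re_le_cmod[of "?e * q"] by linarith
    then have "Re (1 - ?e * q) > 0" by simp
    then have nn: "1 - ?e * q \<notin> \<real>\<^sub>\<le>\<^sub>0" using complex_nonpos_Reals_iff by fastforce
    then have nz: "1 - ?e * q \<noteq> 0" by auto
    have "((\<lambda>z. (\<i> * Ln (1 - exp (- \<i> * z) * q)) / X) has_field_derivative
       (\<i> * (exp (- \<i> * of_real \<theta>) * \<i> * q) / (1 - exp (- \<i> * of_real \<theta>) * q)) / X) (at (of_real \<theta>))"
      using assms nn by (auto intro!: derivative_eq_intros simp: divide_inverse mult_ac)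
    from has_vector_derivative_real_field[OF this]
    have "(F has_vector_derivative ((\<i> * (?e * \<i> * q) / (1 - ?e * q)) / X)) (at \<theta> within {0..2*pi})"
      unfolding F_def[abs_def] by (simp add: o_def)
    moreover have "(\<i> * (?e * \<i> * q) / (1 - ?e * q)) / X = 1 / (X - cis \<theta> * Y)"
    proof -
      have e: "?e * cis \<theta> = 1" by (simp add: cis_conv_exp flip: exp_add)
      have "\<i> * (?e * \<i> * q) = - (?e * q)" by (simp add: algebra_simps)
      then have "(\<i> * (?e * \<i> * q) / (1 - ?e * q)) / X = - (?e * q) / ((1 - ?e * q) * X)" by simp
      also have "\<dots> = - ?e / ((1 - ?e * q) * Y)"
      proof -
        have "- (?e * q) / (D * X) = - ?e / (D * Y)" for D
          using Y assms(2) by (cases "D = 0") (simp_all add: q_def field_simps)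
        then show ?thesis .
      qed
      also have "(1 - ?e * q) * Y = - ?e * (X - cis \<theta> * Y)"
        using e Y by (simp add: q_def algebra_simps) 
      also have "- ?e / (- ?e * (X - cis \<theta> * Y)) = 1 / (X - cis \<theta> * Y)" by simp
      finally show ?thesis .
    qed
    ultimately show "(F has_vector_derivative 1 / (X - cis \<theta> * Y)) (at \<theta> within {0..2*pi})" by simp
  qed simp
  moreover have "F (2*pi) - F 0 = 0"
  proof -
    have "exp (- \<i> * complex_of_real (2*pi)) = 1" by (simp add: exp_minus mult.commute[of \<i>])
    then show ?thesis unfolding F_def by simp
  qed
  ultimately show ?thesis by simp
qed


text \<open>\<open>hls_kernel 1\<close> is reused as an integrable substitute for the singularity:
  up to distance 1 it equals half of 1 / r, and beyond that \<open>g\<close> itself is a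
  majorant.\<close>

lemma integrable_div_dist:
  fixes g :: "plane \<Rightarrow> real"
  assumes [measurable]: "g \<in> borel_measurable borel" and g: "\<And>y. 0 \<le> g y" "\<And>y. g y \<le> B" "integrable lborel g"
  shows "integrable lborel (\<lambda>y. g y / norm (x - y))"
proof (rule integrableI_nonneg)
  have B: "B \<ge> 0" using g(1,2)[of 0] by simp
  have [measurable]: "(\<lambda>y. hls_kernel 1 (norm (y - x))) \<in> borel_measurable borel"
    unfolding hls_kernel_def by measurable
  have "(\<integral>\<^sup>+y. ennreal (g y / norm (x - y)) \<partial>lborel) \<le> (\<integral>\<^sup>+y. ennreal (2 * B) * ennreal (hls_kernel 1 (norm (y - x))) + ennreal (g y) \<partial>lborel)"
  proof (rule nn_integral_mono)
    fix y
    let ?r = "norm (y - x)"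
    have "g y / ?r \<le> 2 * B * hls_kernel 1 ?r + g y"
    proof (cases "?r \<le> 1")
      case True
      have "1 / ?r \<le> 1 / ?r ^ 4"
        using True power_decreasing[of 1 4 ?r] by (cases "?r = 0") (auto intro!: divide_left_mono)
      then have "2 * B * hls_kernel 1 ?r = B / ?r" by (simp add: hls_kernel_def min_def)
      moreover have "g y / ?r \<le> B / ?r" using g by (intro divide_right_mono) auto
      ultimately show ?thesis using g(1)[of y] by simp
    next
      case False
      then have "g y / ?r \<le> g y / 1" using g(1)[of y] by (intro divide_left_mono) auto
      moreover have "0 \<le> 2 * B * hls_kernel 1 ?r" using B hls_kernel_nonneg[of ?r 1] by simp
      ultimately show ?thesis by simp
    qed
    then show "ennreal (g y / norm (x - y)) \<le> ennreal (2 * B) * ennreal (hls_kernel 1 ?r) + ennreal (g y)"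
      using B g(1)[of y] hls_kernel_nonneg[of ?r 1]
      by (simp add: norm_minus_commute ennreal_leI flip: ennreal_mult ennreal_plus)
  qed
  also have "\<dots> = ennreal (2 * B) * (\<integral>\<^sup>+y. ennreal (hls_kernel 1 (norm (y - x))) \<partial>lborel) + (\<integral>\<^sup>+y. ennreal (g y) \<partial>lborel)"
    by (simp add: nn_integral_add nn_integral_cmult)
  also have "(\<integral>\<^sup>+y. ennreal (hls_kernel 1 (norm (y - x))) \<partial>lborel) = (\<integral>\<^sup>+y. ennreal (hls_kernel 1 (norm (y::plane))) \<partial>lborel)"
    by (rule nn_integral_lborel_translate) (auto simp: hls_kernel_def)
  also have "ennreal (2 * B) * (\<integral>\<^sup>+y. ennreal (hls_kernel 1 (norm (y::plane))) \<partial>lborel) + (\<integral>\<^sup>+y. ennreal (g y) \<partial>lborel) < \<infinity>"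
  proof -
    have "(\<integral>\<^sup>+y. ennreal (hls_kernel 1 (norm (y::plane))) \<partial>lborel) < \<infinity>"
      using nn_integral_hls_kernel[of 1] by (auto intro: le_less_trans)
    moreover have "(\<integral>\<^sup>+y. ennreal (g y) \<partial>lborel) < \<infinity>"
      using g by (simp add: nn_integral_eq_integral)
    ultimately show ?thesis by (simp add: ennreal_mult_less_top)
  qed
  finally show "(\<integral>\<^sup>+y. ennreal (g y / norm (x - y)) \<partial>lborel) < \<infinity>" .
qed (use g in auto)

lemma integral_rot:
  fixes k :: "plane \<Rightarrow> 'b::{banach, second_countable_topology}"
  assumes [measurable]: "k \<in> borel_measurable borel"
  shows "(LINT y|lborel. k (rot \<theta> y)) = (LINT y|lborel. k y)"
    "integrable lborel (\<lambda>y. k (rot \<theta> y)) \<longleftrightarrow> integrable lborel k"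
proof -
  show "(LINT y|lborel. k (rot \<theta> y)) = (LINT y|lborel. k y)"
    using integral_distr[of "rot \<theta>" lborel borel k] by (simp add: distr_rot)
  show "integrable lborel (\<lambda>y. k (rot \<theta> y)) \<longleftrightarrow> integrable lborel k"
    using integrable_distr_eq[of "rot \<theta>" lborel borel k] by (simp add: distr_rot)
qed

lemma AE_norm_neq: "AE y::plane in lborel. norm y \<noteq> r"
proof -
  have "AE y::plane in lebesgue. y \<notin> sphere 0 r"
    by (rule AE_not_in) (use negligible_sphere in \<open>simp add: negligible_iff_null_sets\<close>)
  then have "AE y::plane in lborel. y \<notin> sphere 0 r" by (simp only: AE_completion_iff)
  then show ?thesis by eventually_elim simp
qed

text \<open>Rotating y changes nothing for radial \<open>g\<close>, so the integral may first be
  averaged over all angles; the circle means then retain exactly the mass inside the disc of radius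
  |x|.\<close>

lemma newton_complex:
  fixes g :: "plane \<Rightarrow> real"
  assumes [measurable]: "g \<in> borel_measurable borel" and g: "\<And>y. 0 \<le> g y" "\<And>y. g y \<le> B" "integrable lborel g"
    and rad: "\<And>\<theta> y. g (rot \<theta> y) = g y" and x: "x \<noteq> 0"
  shows "integrable lborel (\<lambda>y. of_real (g y) / (to_complex x - to_complex y))"
    "(LINT y|lborel. of_real (g y) / (to_complex x - to_complex y))
      = of_real (LINT y|lborel. g y * indicator {y. norm y < norm x} y) / to_complex x"
proof -
  let ?X = "to_complex x"
  have X: "?X \<noteq> 0" using x by (simp add: to_complex_eq_0)
  define k where "k y = of_real (g y) / (?X - to_complex y)" for y
  have [measurable]: "k \<in> borel_measurable borel" unfolding k_def by measurable
  have nk: "norm (k y) = g y / norm (x - y)" for y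
    using g(1)[of y] by (simp add: k_def norm_divide flip: to_complex_diff norm_to_complex)
  have ik: "integrable lborel k"
    using integrable_div_dist[OF assms(1) g, of x]
    by (intro Bochner_Integration.integrable_bound[of lborel "\<lambda>y. g y / norm (x - y)" k]) (auto simp: nk g)
  then show "integrable lborel (\<lambda>y. of_real (g y) / (to_complex x - to_complex y))"
    by (simp add: k_def[abs_def])
  define f where "f = (\<lambda>(\<theta>::real, y). indicator {0..2*pi} \<theta> *\<^sub>R (of_real (g y) / (?X - cis \<theta> * to_complex y)))"
  have f_eq: "f (\<theta>, y) = indicator {0..2*pi} \<theta> *\<^sub>R k (rot \<theta> y)" for \<theta> y
    by (simp add: f_def k_def rad to_complex_rot)
  have [measurable]: "cis \<in> borel_measurable borel"
    by (intro borel_measurable_continuous_onI continuous_on_cis continuous_on_id)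
  have fm [measurable]: "f \<in> borel_measurable (lborel \<Otimes>\<^sub>M lborel)"
    unfolding f_def by measurable
  have ifub: "integrable (lborel \<Otimes>\<^sub>M lborel) f"
  proof (rule lborel_pair.Fubini_integrable[OF fm])
    have "(\<lambda>\<theta>. LINT y|lborel. norm (f (\<theta>, y))) = (\<lambda>\<theta>. indicator {0..2*pi} \<theta> * (LINT y|lborel. norm (k y)))"
      using integral_rot(1)[of "\<lambda>y. norm (k y)"] by (auto simp: f_eq)
    then show "integrable lborel (\<lambda>\<theta>. LINT y|lborel. norm (f (\<theta>, y)))" by simp
    show "AE \<theta> in lborel. integrable lborel (\<lambda>y. f (\<theta>, y))"
      using integral_rot(2)[of k] ik by (auto simp: f_eq)
  qed
  have "(LINT y|lborel. LINT \<theta>|lborel. f (\<theta>, y)) = (LINT \<theta>|lborel. LINT y|lborel. f (\<theta>, y))"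
    using lborel_pair.Fubini_integral[of "\<lambda>\<theta> y. f (\<theta>, y)"] ifub by simp
  also have "\<dots> = (LINT \<theta>|lborel. indicator {0..2*pi} \<theta> *\<^sub>R (LINT y|lborel. k y))"
    using integral_rot(1)[of k] by (simp add: f_eq)
  also have "\<dots> = (2 * pi) *\<^sub>R (LINT y|lborel. k y)"
    by simp
  finally have e1: "(LINT y|lborel. LINT \<theta>|lborel. f (\<theta>, y)) = (2 * pi) *\<^sub>R (LINT y|lborel. k y)" .
  have "(LINT y|lborel. LINT \<theta>|lborel. f (\<theta>, y)) = (LINT y|lborel. of_real (g y * indicator {y. norm y < norm x} y) * (2 * pi / ?X))"
  proof (rule integral_cong_AE)
    show "AE y in lborel. (LINT \<theta>|lborel. f (\<theta>, y)) = of_real (g y * indicator {y. norm y < norm x} y) * (2 * pi / ?X)"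
      \<comment> \<open>The circle |y| = |x|, on which the averaged kernel is singular, is a null
        set.\<close>
      using AE_norm_neq[of "norm x"]
    proof eventually_elim
      case (elim y)
      have nz: "?X - cis \<theta> * to_complex y \<noteq> 0" for \<theta>
      proof
        assume "?X - cis \<theta> * to_complex y = 0"
        then have "norm ?X = norm (cis \<theta> * to_complex y)" by simp
        then show False using elim by (simp add: norm_mult norm_to_complex)
      qed
      have "set_integrable lborel {0..2*pi} (\<lambda>\<theta>. 1 / (?X - cis \<theta> * to_complex y))"
        unfolding set_integrable_def
        by (rule borel_integrable_compact) (auto intro!: continuous_intros nz)
      then have "(LINT \<theta>:{0..2*pi}|lborel. 1 / (?X - cis \<theta> * to_complex y)) = integral {0..2*pi} (\<lambda>\<theta>. 1 / (?X - cis \<theta> * to_complex y))"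
        by (rule set_borel_integral_eq_integral(2))
      also have "\<dots> = indicator {y. norm y < norm x} y * (2 * pi / ?X)"
      proof (cases "norm y < norm x")
        case True
        then show ?thesis
          using integral_unique[OF circle_mean_inside[of "to_complex y" ?X]] by (simp add: norm_to_complex)
      next
        case False
        then show ?thesis using elim X
          using integral_unique[OF circle_mean_outside[of ?X "to_complex y"]] by (simp add: norm_to_complex)
      qed
      finally have i: "(LINT \<theta>:{0..2*pi}|lborel. 1 / (?X - cis \<theta> * to_complex y)) = indicator {y. norm y < norm x} y * (2 * pi / ?X)" .
      have "(LINT \<theta>|lborel. f (\<theta>, y)) = (LINT \<theta>|lborel. of_real (g y) * (indicator {0..2*pi} \<theta> *\<^sub>R (1 / (?X - cis \<theta> * to_complex y))))"
        by (simp add: f_def)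
      also have "\<dots> = of_real (g y) * (LINT \<theta>:{0..2*pi}|lborel. 1 / (?X - cis \<theta> * to_complex y))"
        unfolding set_lebesgue_integral_def by (rule integral_mult_right_zero)
      finally show ?case using i by (simp split: split_indicator)
    qed
  qed measurable
  also have "\<dots> = of_real (LINT y|lborel. g y * indicator {y. norm y < norm x} y) * (2 * pi / ?X)"
    by (simp only: integral_mult_left_zero integral_complex_of_real)
  finally have "(2 * pi) *\<^sub>R (LINT y|lborel. k y) = (2 * pi) *\<^sub>R (of_real (LINT y|lborel. g y * indicator {y. norm y < norm x} y) / ?X)"
    using e1 by (simp add: scaleR_conv_of_real)
  then show "(LINT y|lborel. of_real (g y) / (to_complex x - to_complex y))
      = of_real (LINT y|lborel. g y * indicator {y. norm y < norm x} y) / to_complex x"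
    by (simp add: k_def[abs_def])
qed

lemma newton_plane:
  fixes g :: "plane \<Rightarrow> real"
  assumes [measurable]: "g \<in> borel_measurable borel" and g: "\<And>y. 0 \<le> g y" "\<And>y. g y \<le> B" "integrable lborel g"
    and rad: "\<And>\<theta> y. g (rot \<theta> y) = g y" and x: "x \<noteq> 0"
  shows "(LINT y|lborel. (g y / (norm (x - y))\<^sup>2) *\<^sub>R (x - y))
      = ((LINT y|lborel. g y * indicator {y. norm y < norm x} y) / (norm x)\<^sup>2) *\<^sub>R x"
proof -
  \<comment> \<open>Complex conjugation, read as a map into the plane: it turns u / Z into u z /
    |z|^2.\<close>
  define L :: "complex \<Rightarrow> plane" where "L z = (\<chi> i. if i = 1 then Re z else - Im z)" for z
  have "linear L" by (rule linearI) (auto simp: L_def vec_eq_iff)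
  then have L: "bounded_linear L" by (simp add: linear_conv_bounded_linear)
  have Lx: "L (of_real u / to_complex z) = (u / (norm z)\<^sup>2) *\<^sub>R z" for u z
  proof -
    have "(norm z)\<^sup>2 = (z $ 1)\<^sup>2 + (z $ 2)\<^sup>2" by (simp add: norm_plane)
    then show ?thesis
      by (auto simp: L_def vec_eq_iff forall_2 to_complex_def Re_divide Im_divide)
  qed
  have "(LINT y|lborel. (g y / (norm (x - y))\<^sup>2) *\<^sub>R (x - y)) = (LINT y|lborel. L (of_real (g y) / (to_complex x - to_complex y)))"
    by (simp flip: Lx to_complex_diff)
  also have "\<dots> = L (LINT y|lborel. of_real (g y) / (to_complex x - to_complex y))"
    by (rule integral_bounded_linear[OF L newton_complex(1)[OF assms]])
  finally show ?thesis
    by (simp add: newton_complex(2)[OF assms] Lx)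
qed

section \<open>Duhamel's formula for the self-similar solution\<close>

text \<open>By Fubini along segments the integral equals that of h (x + e) - h x, which vanishes by
  translation invariance. This replaces a cutoff argument at infinity.\<close>

lemma integral_directional_derivative_eq_0:
  fixes h :: "'a::euclidean_space \<Rightarrow> real"
  assumes der: "\<And>x. (h has_derivative h' x) (at x)" and cont: "continuous_on UNIV (\<lambda>x. h' x e)"
    and ih: "integrable lborel h" and ih': "integrable lborel (\<lambda>x. h' x e)"
  shows "(LINT x|lborel. h' x e) = 0"
proof -
  let ?c = "LINT x|lborel. h' x e"
  define f where "f = (\<lambda>(s::real, x). indicator {0..1} s *\<^sub>R h' (x + s *\<^sub>R e) e)"
  have "continuous_on UNIV (\<lambda>p :: real \<times> 'a. h' (snd p + fst p *\<^sub>R e) e)"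
    by (intro continuous_on_compose2[OF cont] continuous_intros) auto
  then have [measurable]: "(\<lambda>p :: real \<times> 'a. h' (snd p + fst p *\<^sub>R e) e) \<in> borel_measurable (lborel \<Otimes>\<^sub>M lborel)"
    by (simp add: lborel_prod borel_measurable_continuous_onI)
  have fm: "f \<in> borel_measurable (lborel \<Otimes>\<^sub>M lborel)"
    unfolding f_def split_beta by measurable
  have hm [measurable]: "(\<lambda>x. h' x e) \<in> borel_measurable borel" using ih' by auto
  have tr: "(LINT x|lborel. k (x + v)) = (LINT x|lborel. k x)" "integrable lborel k \<Longrightarrow> integrable lborel (\<lambda>x. k (x + v))"
    if [measurable]: "k \<in> borel_measurable borel" for k :: "'a \<Rightarrow> real" and v
  proof -
    show "(LINT x|lborel. k (x + v)) = (LINT x|lborel. k x)"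
      using integral_distr[of "(+) v" lborel borel k] by (simp add: lborel_distr_plus add.commute)
    show "integrable lborel (\<lambda>x. k (x + v))" if "integrable lborel k"
      using integrable_distr_eq[of "(+) v" lborel borel k] that by (simp add: lborel_distr_plus add.commute)
  qed
  have ifub: "integrable (lborel \<Otimes>\<^sub>M lborel) f"
  proof (rule lborel_pair.Fubini_integrable[OF fm])
    have "(\<lambda>s. LINT x|lborel. norm (f (s, x))) = (\<lambda>s. indicator {0..1} s * (LINT x|lborel. norm (h' x e)))"
      using tr(1)[of "\<lambda>x. norm (h' x e)"] by (auto simp: f_def abs_mult)
    then show "integrable lborel (\<lambda>s. LINT x|lborel. norm (f (s, x)))" by simp
    show "AE s in lborel. integrable lborel (\<lambda>x. f (s, x))"
      using tr(2)[of "\<lambda>x. h' x e"] ih' by (auto simp: f_def)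
  qed
  have FTC: "(LINT s|lborel. f (s, x)) = h (x + e) - h x" for x
  proof -
    have c: "continuous_on {0..1} (\<lambda>s. h' (x + s *\<^sub>R e) e)"
      by (intro continuous_on_compose2[OF cont] continuous_intros) auto
    have "((\<lambda>s. h' (x + s *\<^sub>R e) e) has_integral h (x + 1 *\<^sub>R e) - h (x + 0 *\<^sub>R e)) {0..1}"
    proof (rule fundamental_theorem_of_calculus)
      fix s :: real
      have "((\<lambda>s. x + s *\<^sub>R e) has_vector_derivative e) (at s within {0..1})"
        by (auto intro!: derivative_eq_intros)
      then show "((\<lambda>s. h (x + s *\<^sub>R e)) has_vector_derivative h' (x + s *\<^sub>R e) e) (at s within {0..1})"
        using vector_derivative_diff_chain_within[OF \<open>((\<lambda>s. x + s *\<^sub>R e) has_vector_derivative e) (at s within {0..1})\<close>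
          has_derivative_at_withinI[OF der]] by (simp add: o_def)
    qed simp
    moreover have "(LINT s:{0..1}|lborel. h' (x + s *\<^sub>R e) e) = integral {0..1} (\<lambda>s. h' (x + s *\<^sub>R e) e)"
      using borel_integrable_compact[OF compact_Icc c]
      by (intro set_borel_integral_eq_integral(2)) (simp add: set_integrable_def)
    ultimately show ?thesis by (simp add: f_def set_lebesgue_integral_def integral_unique)
  qed
  have [measurable]: "h \<in> borel_measurable borel" using ih by auto
  have "(LINT s|lborel. LINT x|lborel. f (s, x)) = (LINT x|lborel. LINT s|lborel. f (s, x))"
    using lborel_pair.Fubini_integral[of "\<lambda>s x. f (s, x)"] ifub by simp
  also have "\<dots> = (LINT x|lborel. h (x + e) - h x)" by (simp add: FTC)
  also have "\<dots> = 0"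
    using ih tr[of h e] by simp
  finally have 0: "(LINT s|lborel. LINT x|lborel. f (s, x)) = 0" .
  have "(LINT s|lborel. LINT x|lborel. f (s, x)) = (LINT s|lborel. indicator {0..1::real} s *\<^sub>R ?c)"
    using tr(1)[of "\<lambda>x. h' x e"] by (simp add: f_def content_real)
  also have "(LINT s|lborel. indicator {0..1::real} s *\<^sub>R ?c) = ?c" by (simp add: content_real)
  finally show ?thesis using 0 by simp
qed

lemma borel_measurable_plane_nth [measurable (raw)]:
  assumes "F \<in> borel_measurable N"
  shows "(\<lambda>x. (F x :: plane) $ i) \<in> borel_measurable N"
proof -
  have "(\<lambda>x::plane. x $ i) \<in> borel_measurable borel"
    by (intro borel_measurable_continuous_onI continuous_intros)
  from measurable_compose[OF assms this] show ?thesis .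
qed

lemma integral_scale_plane:
  fixes f :: "plane \<Rightarrow> real"
  assumes [measurable]: "f \<in> borel_measurable borel" and c: "c > 0"
  shows "(LINT y|lborel. f y) = c\<^sup>2 * (LINT z|lborel. f (c *\<^sub>R z))"
proof -
  have "(LINT y|lborel. f y) = (LINT y|density (distr lborel borel (\<lambda>x::plane. 0 + c *\<^sub>R x)) (\<lambda>_. ennreal (\<bar>c\<bar> ^ DIM(plane))). f y)"
    using lborel_affine[of c "0::plane"] c by simp
  also have "\<dots> = (LINT y|distr lborel borel (\<lambda>x::plane. 0 + c *\<^sub>R x). c\<^sup>2 *\<^sub>R f y)"
    using c by (subst integral_density) auto
  also have "\<dots> = (LINT z|lborel. c\<^sup>2 *\<^sub>R f (c *\<^sub>R z))"
    by (subst integral_distr) auto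
  finally show ?thesis by simp
qed

section \<open>Integration by parts against the self-similar solution\<close>

context profile begin

lemma U_poly_integrable:
  fixes f :: "plane \<Rightarrow> real"
  assumes t: "t > 0" and [measurable]: "f \<in> borel_measurable borel" and le: "\<And>x. \<bar>f x\<bar> \<le> A + B * norm x" and AB: "A \<ge> 0" "B \<ge> 0"
  shows "integrable lborel (\<lambda>x. U t x * f x)" "integrable lborel (\<lambda>x. norm (grad_U t x) * f x)"
proof -
  note [measurable] = U_measurable[OF t] grad_U_measurable[OF t]
  obtain C where C: "C > 0" "\<And>x. U t x \<le> C / t * exp (- (norm x)\<^sup>2 / (8 * t))"
    "\<And>x. norm (grad_U t x) \<le> C / t\<^sup>2 * norm x * exp (- (norm x)\<^sup>2 / (8 * t))" using U_decay t by metis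
  obtain D where D: "\<And>r. r \<ge> 0 \<Longrightarrow> (1 + r :: real) ^ 2 * exp (- (1 / (16 * t)) * r\<^sup>2) \<le> D"
    using power_times_gaussian_bounded[of "1 / (16 * t)" 2] t by auto
  define K where "K = (C / t + C / t\<^sup>2) * (A + B)"
  have K0: "K \<ge> 0" unfolding K_def using C t AB by (intro mult_nonneg_nonneg add_nonneg_nonneg) auto
  have D0: "D \<ge> 0" using D[of 0] by simp
  have fin: "integrable lborel (\<lambda>x::plane. K * D * exp (- (1 / (16 * t)) * (norm (x - 0))\<^sup>2))"
  proof -
    have "integrable lborel (\<lambda>x::plane. exp (- (1 / (16 * t)) * (norm (x - 0))\<^sup>2))"
      using nn_integral_gaussian[of "1 / (16 * t)" 0] t by (intro integrableI_nonneg) auto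
    then show ?thesis by (rule integrable_mult_right)
  qed
  have key: "q * \<bar>f x\<bar> \<le> K * D * exp (- (1 / (16 * t)) * (norm (x - 0))\<^sup>2)"
    if q: "0 \<le> q" "q \<le> (C / t + C / t\<^sup>2) * (1 + norm x) * exp (- (norm x)\<^sup>2 / (8 * t))" for q x
  proof -
    let ?e = "exp (- (1 / (16 * t)) * (norm x)\<^sup>2)"
    \<comment> \<open>One half of the exponent pays for the two factors 1 + |x|; the other half
      remains integrable.\<close>
    have ee: "exp (- (norm x)\<^sup>2 / (8 * t)) = ?e * ?e" using t by (simp add: field_simps flip: exp_add)
    have "\<bar>f x\<bar> \<le> (A + B) * (1 + norm x)"
    proof -
      have "(A + B) * (1 + norm x) = (A + B * norm x) + (B + A * norm x)" by (simp add: algebra_simps)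
      moreover have "0 \<le> B + A * norm x" using AB by simp
      ultimately show ?thesis using le[of x] by linarith
    qed
    then have "q * \<bar>f x\<bar> \<le> ((C / t + C / t\<^sup>2) * (1 + norm x) * (?e * ?e)) * ((A + B) * (1 + norm x))"
      using q unfolding ee by (intro mult_mono) auto
    also have "\<dots> = K * ((1 + norm x) ^ 2 * ?e) * ?e" by (simp add: K_def power2_eq_square)
    also have "\<dots> \<le> K * D * ?e" using D[of "norm x"] K0 by (intro mult_right_mono mult_left_mono) auto
    finally show ?thesis by simp
  qed
  have 1: "0 \<le> C / t * norm x" "0 \<le> C / t\<^sup>2" "0 \<le> C / t\<^sup>2 * norm x" "0 \<le> C / t" for x :: plane using C t by auto
  show "integrable lborel (\<lambda>x. U t x * f x)"
  proof (rule Bochner_Integration.integrable_bound[OF fin])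
    show "AE x in lborel. norm (U t x * f x) \<le> norm (K * D * exp (- (1 / (16 * t)) * (norm (x - 0))\<^sup>2))"
    proof (intro AE_I2)
      fix x :: plane
      have "C / t \<le> (C / t + C / t\<^sup>2) * (1 + norm x)" using 1(1)[of x] 1(2) 1(3)[of x] 1(4)
        by (simp only: distrib_left distrib_right mult_1_right)
      then have "U t x \<le> (C / t + C / t\<^sup>2) * (1 + norm x) * exp (- (norm x)\<^sup>2 / (8 * t))"
        using C(2)[of x] by (meson exp_ge_zero mult_right_mono order_trans)
      from key[OF U_nonneg[OF t] this] show "norm (U t x * f x) \<le> norm (K * D * exp (- (1 / (16 * t)) * (norm (x - 0))\<^sup>2))"
        using U_nonneg[OF t, of x] K0 D0 by (simp add: abs_mult)
    qed
  qed measurable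
  show "integrable lborel (\<lambda>x. norm (grad_U t x) * f x)"
  proof (rule Bochner_Integration.integrable_bound[OF fin])
    show "AE x in lborel. norm (norm (grad_U t x) * f x) \<le> norm (K * D * exp (- (1 / (16 * t)) * (norm (x - 0))\<^sup>2))"
    proof (intro AE_I2)
      fix x :: plane
      have "C / t\<^sup>2 * norm x \<le> (C / t + C / t\<^sup>2) * (1 + norm x)" using 1(1)[of x] 1(2) 1(3)[of x] 1(4)
        by (simp only: distrib_left distrib_right mult_1_right)
      then have "norm (grad_U t x) \<le> (C / t + C / t\<^sup>2) * (1 + norm x) * exp (- (norm x)\<^sup>2 / (8 * t))"
        using C(3)[of x] by (meson exp_ge_zero mult_right_mono order_trans)
      from key[OF norm_ge_zero this] show "norm (norm (grad_U t x) * f x) \<le> norm (K * D * exp (- (1 / (16 * t)) * (norm (x - 0))\<^sup>2))"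
        using K0 D0 by (simp add: abs_mult)
    qed
  qed measurable
qed

lemma schwartz_bounded:
  assumes "v \<in> schwartz"
  obtains C where "C > 0" "\<And>x. \<bar>pds js v x\<bar> \<le> C"
  using schwartz_decay[OF assms, of 0 js] by auto

text \<open>The product of \<open>U t\<close> with a first derivative of \<open>v\<close> has
  integrable directional derivatives by the Gaussian decay of \<open>U\<close> and its gradient, so
  the integral of the full derivative is 0.\<close>

lemma U_integration_by_parts:
  assumes t: "t > 0" and v: "v \<in> schwartz"
  shows "integrable lborel (\<lambda>y. grad_U t y $ i * pd i v y)" "integrable lborel (\<lambda>y. U t y * pds [i, i] v y)"
    "(LINT y|lborel. grad_U t y $ i * pd i v y) = - (LINT y|lborel. U t y * pds [i, i] v y)"
proof -
  note [measurable] = U_measurable[OF t] grad_U_measurable[OF t] borel_measurable_pds[OF v]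
  have p1: "pd i v = pds [i] v" by (simp add: pds_def)
  obtain C1 where C1: "C1 > 0" "\<And>x. \<bar>pd i v x\<bar> \<le> C1" using schwartz_bounded[OF v, of "[i]"] unfolding p1 by blast
  obtain C2 where C2: "C2 > 0" "\<And>x. \<bar>pds [i,i] v x\<bar> \<le> C2" using schwartz_bounded[OF v] by blast
  have m1 [measurable]: "pd i v \<in> borel_measurable borel" unfolding p1 by measurable
  show i1: "integrable lborel (\<lambda>y. grad_U t y $ i * pd i v y)"
  proof (rule Bochner_Integration.integrable_bound)
    show "integrable lborel (\<lambda>y. norm (grad_U t y) * C1)" by (rule U_poly_integrable(2)[OF t, of _ C1 0]) (use C1 in auto)
    show "(\<lambda>y. grad_U t y $ i * pd i v y) \<in> borel_measurable lborel"
      using borel_measurable_times[OF borel_measurable_plane_nth[OF grad_U_measurable[OF t]] m1] by simp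
    show "AE y in lborel. norm (grad_U t y $ i * pd i v y) \<le> norm (norm (grad_U t y) * C1)"
    proof (intro AE_I2)
      fix y show "norm (grad_U t y $ i * pd i v y) \<le> norm (norm (grad_U t y) * C1)"
        using C1(2)[of y] C1(1) component_le_norm_cart[of "grad_U t y" i] by (auto simp: abs_mult intro!: mult_mono)
    qed
  qed
  show i2: "integrable lborel (\<lambda>y. U t y * pds [i, i] v y)"
    by (rule U_poly_integrable(1)[OF t, of _ C2 0]) (use C2 in auto)
  have i3: "integrable lborel (\<lambda>y. U t y * pd i v y)"
    by (rule U_poly_integrable(1)[OF t, of _ C1 0]) (use C1 in auto)
  have pdv: "(pd i v has_derivative (\<lambda>h. \<Sum>j\<in>UNIV. pds [j, i] v x * h $ j)) (at x)" for x
    using has_derivative_pd[OF schwartz_differentiable[OF v, of "[i]" x]] by (simp add: pds_def)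
  have "(LINT y|lborel. U t y * (\<Sum>j\<in>UNIV. pds [j, i] v y * axis i 1 $ j) + (grad_U t y \<bullet> axis i 1) * pd i v y) = 0"
  proof (rule integral_directional_derivative_eq_0[where h'="\<lambda>y h. U t y * (\<Sum>j\<in>UNIV. pds [j, i] v y * h $ j) + (grad_U t y \<bullet> h) * pd i v y"])
    show "((\<lambda>y. U t y * pd i v y) has_derivative (\<lambda>h. U t x * (\<Sum>j\<in>UNIV. pds [j, i] v x * h $ j) + (grad_U t x \<bullet> h) * pd i v x)) (at x)" for x
      by (rule has_derivative_mult[OF U_has_derivative[OF t] pdv])
    show "continuous_on UNIV (\<lambda>x. U t x * (\<Sum>j\<in>UNIV. pds [j, i] v x * axis i 1 $ j) + (grad_U t x \<bullet> axis i 1) * pd i v x)"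
      unfolding p1 by (intro continuous_intros U_continuous grad_U_continuous continuous_pds t v)
    show "integrable lborel (\<lambda>y. U t y * pd i v y)" by (rule i3)
    show "integrable lborel (\<lambda>x. U t x * (\<Sum>j\<in>UNIV. pds [j, i] v x * axis i 1 $ j) + (grad_U t x \<bullet> axis i 1) * pd i v x)"
      using i1 i2 by (simp add: sum_axis_plane inner_axis)
  qed
  then show "(LINT y|lborel. grad_U t y $ i * pd i v y) = - (LINT y|lborel. U t y * pds [i, i] v y)"
    using i1 i2 by (simp add: sum_axis_plane inner_axis)
qed

end

section \<open>Derivatives of the heat kernel\<close>

lemma heat_kernel_has_derivative_joint:
  assumes "r > 0"
  shows "((\<lambda>p. heat_kernel (fst p) (snd p)) has_derivative
    (\<lambda>k. heat_kernel r y * ((norm y)\<^sup>2 / (4 * r\<^sup>2) - 1 / r) * fst k + heat_kernel r y * (- (y \<bullet> snd k) / (2 * r)))) (at (r, y))"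
proof -
  let ?q = "\<lambda>p::real \<times> plane. - (snd p \<bullet> snd p) / (4 * fst p)"
  let ?q' = "\<lambda>k::real \<times> plane. - (y \<bullet> snd k) / (2 * r) + (y \<bullet> y) / (4 * r\<^sup>2) * fst k"
  have "(?q has_derivative ?q') (at (r, y))"
    using assms by (auto intro!: derivative_eq_intros simp: inner_commute power2_eq_square divide_simps)
  then have "((\<lambda>p. exp (?q p)) has_derivative (\<lambda>k. exp (?q (r, y)) * ?q' k)) (at (r, y))"
    by (rule has_derivative_eq_rhs[OF has_derivative_exp]) (simp add: fun_eq_iff mult.commute)
  moreover have "((\<lambda>p::real \<times> plane. 1 / (4 * pi * fst p)) has_derivative (\<lambda>k. - (fst k) / (4 * pi * r\<^sup>2))) (at (r, y))"
    using assms by (auto intro!: derivative_eq_intros simp: power2_eq_square divide_simps)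
  ultimately have "((\<lambda>p. 1 / (4 * pi * fst p) * exp (?q p)) has_derivative
     (\<lambda>k. 1 / (4 * pi * fst (r, y)) * (exp (?q (r, y)) * ?q' k) + - (fst k) / (4 * pi * r\<^sup>2) * exp (?q (r, y)))) (at (r, y))"
    by (intro has_derivative_mult)
  moreover have "1 / (4 * pi * fst (r, y)) * (exp (?q (r, y)) * ?q' k) + - (fst k) / (4 * pi * r\<^sup>2) * exp (?q (r, y))
     = heat_kernel r y * ((norm y)\<^sup>2 / (4 * r\<^sup>2) - 1 / r) * fst k + heat_kernel r y * (- (y \<bullet> snd k) / (2 * r))" for k :: "real \<times> plane"
  proof -
    have "heat_kernel r y = 1 / (4 * pi * r) * exp (?q (r, y))" by (simp add: heat_kernel_def power2_norm_eq_inner)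
    moreover have "- (fst k) / (4 * pi * r\<^sup>2) = 1 / (4 * pi * r) * (- 1 / r * fst k)" by (simp add: power2_eq_square)
    moreover have "c * (E * (- Q + A * f)) + c * (- \<rho> * f) * E = c * E * (A - \<rho>) * f + c * E * (- Q)" for c E Q A f \<rho> :: real
      by (simp add: algebra_simps)
    ultimately show ?thesis by (simp only: power2_norm_eq_inner fst_conv minus_divide_left[symmetric])
  qed
  ultimately show ?thesis by (simp add: heat_kernel_def power2_norm_eq_inner)
qed

lemma heat_kernel_has_derivative:
  assumes "r > 0"
  shows "(heat_kernel r has_derivative (\<lambda>h. heat_kernel r y * (- (y \<bullet> h) / (2 * r)))) (at y)"
proof -
  have "((\<lambda>y. (r, y)) has_derivative (\<lambda>h. (0, h))) (at y)"
    by (auto intro!: derivative_eq_intros)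
  from has_derivative_compose[OF this heat_kernel_has_derivative_joint[OF assms]] show ?thesis by simp
qed

lemma pd_heat_kernel: "r > 0 \<Longrightarrow> pd i (heat_kernel r) y = - (y $ i / (2 * r)) * heat_kernel r y"
  using pd_eq[OF heat_kernel_has_derivative, of r i y] by (simp add: inner_axis)

lemma pds_heat_kernel_2:
  assumes "r > 0"
  shows "pds [i, i] (heat_kernel r) y = heat_kernel r y * ((y $ i)\<^sup>2 / (4 * r\<^sup>2) - 1 / (2 * r))"
proof -
  have "pd i (heat_kernel r) = (\<lambda>y. - (y \<bullet> axis i 1 / (2 * r)) * heat_kernel r y)"
    using pd_heat_kernel[OF assms] by (auto simp: inner_axis)
  moreover have "((\<lambda>y. - (y \<bullet> axis i 1 / (2 * r)) * heat_kernel r y) has_derivative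
     (\<lambda>h. - (y \<bullet> axis i 1 / (2 * r)) * (heat_kernel r y * (- (y \<bullet> h) / (2 * r))) + (- (h \<bullet> axis i 1 / (2 * r))) * heat_kernel r y)) (at y)"
    by (intro has_derivative_mult heat_kernel_has_derivative assms) (use assms in \<open>auto intro!: derivative_eq_intros\<close>)
  from pd_eq[OF this] have "pd i (\<lambda>y. - (y \<bullet> axis i 1 / (2 * r)) * heat_kernel r y) y
     = heat_kernel r y * ((y $ i)\<^sup>2 / (4 * r\<^sup>2) - 1 / (2 * r))"
    using assms by (simp add: inner_axis power2_eq_square right_diff_distrib)
  ultimately show ?thesis by (simp add: pds_def)
qed

text \<open>The right side is the coefficient of the time increment in
  \<open>heat_kernel_has_derivative_joint\<close>: this is where the heat equation enters.\<close>

lemma laplace_heat_kernel: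
  assumes "r > 0"
  shows "(\<Sum>i\<in>UNIV. pds [i, i] (heat_kernel r) y) = heat_kernel r y * ((norm y)\<^sup>2 / (4 * r\<^sup>2) - 1 / r)"
  using assms by (simp add: pds_heat_kernel_2 sum_2 norm_plane)
    (simp add: field_simps)

text \<open>With a = |y|^2 / (4 r), both a exp(-a) and exp(-a) lie in [0, 1]. Stating the bound for
  all r >= s provides a majorant uniform in time.\<close>

lemma laplace_heat_kernel_le:
  assumes "0 < s" "s \<le> r"
  shows "\<bar>heat_kernel r y * ((norm y)\<^sup>2 / (4 * r\<^sup>2) - 1 / r)\<bar> \<le> 1 / s\<^sup>2"
proof -
  have r: "r > 0" using assms by simp
  let ?a = "(norm y)\<^sup>2 / (4 * r)"
  have "?a * exp (- ?a) \<le> 1"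
  proof -
    have "?a \<le> exp ?a" using exp_ge_add_one_self[of ?a] by linarith
    then have "?a * exp (- ?a) \<le> exp ?a * exp (- ?a)" by (intro mult_right_mono) auto
    then show ?thesis by (simp add: mult_exp_exp)
  qed
  moreover have "0 \<le> ?a * exp (- ?a)" "0 \<le> exp (- ?a)" "exp (- ?a) \<le> 1" using r by auto
  ultimately have "\<bar>?a * exp (- ?a) - exp (- ?a)\<bar> \<le> 1" by linarith
  moreover have "heat_kernel r y * ((norm y)\<^sup>2 / (4 * r\<^sup>2) - 1 / r) = 1 / (4 * pi * r\<^sup>2) * (?a * exp (- ?a) - exp (- ?a))"
  proof -
    have "1 / (4 * pi * r) * E * (N / (4 * r\<^sup>2) - 1 / r) = 1 / (4 * pi * r\<^sup>2) * (N / (4 * r) * E - E)" for E N :: real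
      using r by (simp add: field_simps power2_eq_square)
    from this[of "exp (- ?a)" "(norm y)\<^sup>2"] show ?thesis by (simp add: heat_kernel_def)
  qed
  ultimately have "\<bar>heat_kernel r y * ((norm y)\<^sup>2 / (4 * r\<^sup>2) - 1 / r)\<bar> \<le> 1 / (4 * pi * r\<^sup>2) * 1"
    using r by (simp only: abs_mult) (intro mult_mono, auto)
  also have "\<dots> \<le> 1 / s\<^sup>2"
  proof -
    have "s\<^sup>2 \<le> r\<^sup>2" using assms by (intro power_mono) auto
    also have "r\<^sup>2 = 1 * r\<^sup>2" by simp
    also have "1 * r\<^sup>2 \<le> 4 * pi * r\<^sup>2" using pi_ge_two by (intro mult_right_mono) auto
    finally have "s\<^sup>2 \<le> 4 * pi * r\<^sup>2" .
    then show ?thesis using assms by (simp add: frac_le)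
  qed
  finally show ?thesis .
qed

lemma grad_heat_norm_le_const:
  assumes "0 < s" "s \<le> r"
  shows "grad_heat_norm r y \<le> s powr (-3/2)"
proof -
  have "grad_heat_norm r y \<le> r powr (-3/2) / (2 * pi) * exp (- (norm y)\<^sup>2 / (8 * r))"
    using assms by (intro grad_heat_norm_le) auto
  also have "\<dots> \<le> r powr (-3/2) / 1 * 1"
    using assms pi_ge_two by (intro mult_mono divide_left_mono) auto
  also have "\<dots> \<le> s powr (-3/2)" using assms by (simp add: powr_mono2')
  finally show ?thesis .
qed

lemma abs_pd_heat_kernel_le: "r > 0 \<Longrightarrow> \<bar>pd i (heat_kernel r) y\<bar> \<le> grad_heat_norm r y"
  using component_le_norm_cart[of y i]
  by (auto simp: pd_heat_kernel grad_heat_norm_def abs_mult intro!: mult_right_mono divide_right_mono)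

lemma abs_pd_heat_kernel_le_const: "0 < s \<Longrightarrow> s \<le> r \<Longrightarrow> \<bar>pd i (heat_kernel r) y\<bar> \<le> s powr (-3/2)"
  using abs_pd_heat_kernel_le[of r i y] grad_heat_norm_le_const[of s r y] by linarith

section \<open>Test functions under the heat flow\<close>

locale test_function =
  fixes \<psi> :: "plane \<Rightarrow> real" and R :: real
  assumes cont: "continuous_on UNIV \<psi>" and supp: "\<And>x. norm x > R \<Longrightarrow> \<psi> x = 0"
begin

lemma measurable_psi [measurable]: "\<psi> \<in> borel_measurable borel"
  using cont by (rule borel_measurable_continuous_onI)

lemma psi_bounded: obtains B where "B > 0" "\<And>x. \<bar>\<psi> x\<bar> \<le> B"
proof -
  have "compact (\<psi> ` cball 0 R)"
    by (intro compact_continuous_image continuous_on_subset[OF cont]) auto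
  then obtain B where B: "B > 0" "\<And>y. y \<in> \<psi> ` cball 0 R \<Longrightarrow> norm y \<le> B"
    using compact_imp_bounded bounded_pos by metis
  have "\<bar>\<psi> x\<bar> \<le> B" for x
    using B supp[of x] by (cases "norm x \<le> R") auto
  with B(1) show ?thesis using that by blast
qed

lemma integrable_psi: "integrable lborel \<psi>"
proof -
  obtain B where B: "B > 0" "\<And>x. \<bar>\<psi> x\<bar> \<le> B" using psi_bounded by blast
  show ?thesis
  proof (rule Bochner_Integration.integrable_bound)
    show "integrable lborel (\<lambda>x::plane. B * indicator (cball 0 R) x)"
      by (intro integrable_mult_right integrable_real_indicator emeasure_bounded_finite) auto
    show "AE x in lborel. norm (\<psi> x) \<le> norm (B * indicator (cball 0 R) x)"
      using B supp by (intro AE_I2) (auto simp: indicator_def)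
  qed simp
qed

text \<open>The heat semigroup is self-adjoint, so evolving the test function by \<open>V\<close>
  replaces evolving the solution.\<close>

definition V :: "real \<Rightarrow> plane \<Rightarrow> real" where
  "V r = heat r (distr_of \<psi>)"

lemma V_eq: "V r y = (LINT x|lborel. \<psi> x * heat_kernel r (y - x))"
  by (simp add: V_def heat_distr_of)

lemma V_schwartz: "r > 0 \<Longrightarrow> V r \<in> schwartz"
  unfolding V_def by (rule heat_schwartz[OF integrable_psi supp])

lemma pds_V: "r > 0 \<Longrightarrow> pds js (V r) y = (LINT x|lborel. \<psi> x * pds js (heat_kernel r) (y - x))"
  using pds_convolution[OF heat_kernel_schwartz integrable_psi, of r js]
  by (simp add: V_def heat_distr_of)

lemma pd_V: "r > 0 \<Longrightarrow> pd i (V r) y = (LINT x|lborel. \<psi> x * pd i (heat_kernel r) (y - x))"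
  using pds_V[of r "[i]" y] by (simp add: pds_def)

lemma integrable_psi_mult:
  assumes [measurable]: "f \<in> borel_measurable borel" and "\<And>x. \<bar>f x\<bar> \<le> C"
  shows "integrable lborel (\<lambda>x. \<psi> x * f x)" "\<bar>LINT x|lborel. \<psi> x * f x\<bar> \<le> C * (LINT x|lborel. \<bar>\<psi> x\<bar>)"
proof -
  have C: "C \<ge> 0" using assms(2)[of 0] by simp
  have le: "\<bar>\<psi> x\<bar> * \<bar>f x\<bar> \<le> \<bar>\<psi> x\<bar> * C" for x
    using assms(2) by (intro mult_left_mono) auto
  show i: "integrable lborel (\<lambda>x. \<psi> x * f x)"
  proof (rule Bochner_Integration.integrable_bound)
    show "integrable lborel (\<lambda>x. C * \<psi> x)" using integrable_psi by simp
    show "AE x in lborel. norm (\<psi> x * f x) \<le> norm (C * \<psi> x)"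
      using le C by (intro AE_I2) (simp add: abs_mult mult.commute[of C])
  qed measurable
  have "norm (LINT x|lborel. \<psi> x * f x) \<le> (LINT x|lborel. C * \<bar>\<psi> x\<bar>)"
    using integrable_psi le by (intro Bochner_Integration.integral_norm_bound_integral i)
      (auto simp: abs_mult mult.commute[of C])
  then show "\<bar>LINT x|lborel. \<psi> x * f x\<bar> \<le> C * (LINT x|lborel. \<bar>\<psi> x\<bar>)" by simp
qed

definition laplace_V :: "real \<Rightarrow> plane \<Rightarrow> real" where
  "laplace_V r y = (\<Sum>i\<in>UNIV. pds [i, i] (V r) y)"

lemma measurable_pds_heat: "r > 0 \<Longrightarrow> (\<lambda>x. pds js (heat_kernel r) (y - x)) \<in> borel_measurable borel"
  using borel_measurable_pds[OF heat_kernel_schwartz] by measurable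

lemma measurable_pd_heat: "r > 0 \<Longrightarrow> (\<lambda>x. pd i (heat_kernel r) (y - x)) \<in> borel_measurable borel"
  using measurable_pds_heat[of r "[i]" y] by (simp add: pds_def)

lemma laplace_V_eq:
  assumes "r > 0"
  shows "laplace_V r y = (LINT x|lborel. \<psi> x * (heat_kernel r (y - x) * ((norm (y - x))\<^sup>2 / (4 * r\<^sup>2) - 1 / r)))"
proof -
  have "integrable lborel (\<lambda>x. \<psi> x * pds [i, i] (heat_kernel r) (y - x))" for i
  proof -
    obtain C where "\<And>x. \<bar>pds [i, i] (heat_kernel r) x\<bar> \<le> C"
      using schwartz_decay[OF heat_kernel_schwartz[OF assms], of 0 "[i, i]"] by auto
    then show ?thesis by (intro integrable_psi_mult measurable_pds_heat assms)
  qed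
  then have "laplace_V r y = (LINT x|lborel. (\<Sum>i\<in>UNIV. \<psi> x * pds [i, i] (heat_kernel r) (y - x)))"
    by (simp add: laplace_V_def pds_V[OF assms])
  then show ?thesis
    by (simp only: sum_distrib_left[symmetric] laplace_heat_kernel[OF assms])
qed

lemma V_le: "0 < s \<Longrightarrow> s \<le> r \<Longrightarrow> \<bar>V r y\<bar> \<le> 1 / s * (LINT x|lborel. \<bar>\<psi> x\<bar>)"
proof -
  assume s: "0 < s" "s \<le> r"
  have "\<bar>heat_kernel r (y - x)\<bar> \<le> 1 / s" for x
  proof -
    have "s \<le> 4 * pi * r" using s pi_ge_two by (smt (verit) mult_le_cancel_right1)
    then have "1 / (4 * pi * r) \<le> 1 / s" using s by (simp add: frac_le)
    then show ?thesis using heat_kernel_le[of r "y - x"] s by simp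
  qed
  then show ?thesis unfolding V_eq by (intro integrable_psi_mult) measurable
qed

lemma laplace_V_le: "0 < s \<Longrightarrow> s \<le> r \<Longrightarrow> \<bar>laplace_V r y\<bar> \<le> 1 / s\<^sup>2 * (LINT x|lborel. \<bar>\<psi> x\<bar>)"
proof -
  assume "0 < s" "s \<le> r"
  then show ?thesis
    using laplace_heat_kernel_le[of s r] by (subst laplace_V_eq, simp, intro integrable_psi_mult(2)) auto
qed

lemma pd_V_le: "0 < s \<Longrightarrow> s \<le> r \<Longrightarrow> \<bar>pd i (V r) y\<bar> \<le> s powr (-3/2) * (LINT x|lborel. \<bar>\<psi> x\<bar>)"
  by (subst pd_V, simp, intro integrable_psi_mult measurable_pd_heat abs_pd_heat_kernel_le_const) auto

text \<open>Differentiability is needed jointly in time and space, because along the rescaled flow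
  both arguments of \<open>V\<close> move with the time variable.\<close>

lemma V_has_derivative:
  assumes r: "r > 0"
  shows "((\<lambda>p. V (fst p) (snd p)) has_derivative
    (\<lambda>k. fst k * laplace_V r y + (\<Sum>i\<in>UNIV. pd i (V r) y * snd k $ i))) (at (r, y))"
proof -
  let ?f' = "\<lambda>(p :: real \<times> plane) x (k :: real \<times> plane). \<psi> x * (heat_kernel (fst p) (snd p - x) * ((norm (snd p - x))\<^sup>2 / (4 * (fst p)\<^sup>2) - 1 / fst p) * fst k + 
     heat_kernel (fst p) (snd p - x) * (- ((snd p - x) \<bullet> snd k) / (2 * fst p)))"
  \<comment> \<open>Times above r / 2 form a neighbourhood of r on which the kernel bounds are
    uniform.\<close>
  define s where "s = r / 2"
  have s: "s > 0" using r by (simp add: s_def)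
  let ?K = "1 / s\<^sup>2 + s powr (-3/2)"
  have "((\<lambda>p. LINT x|lborel. \<psi> x * heat_kernel (fst p) (snd p - x)) has_derivative (\<lambda>k. LINT x|lborel. ?f' (r, y) x k)) (at (r, y))"
  proof (rule has_derivative_integral[where U="{s<..} \<times> UNIV" and B="\<lambda>x. \<bar>\<psi> x\<bar> * ?K"])
    show "open ({s<..} \<times> (UNIV :: plane set))" by (intro open_Times) auto
    show "(r, y) \<in> {s<..} \<times> UNIV" using r by (simp add: s_def)
    show "integrable lborel (\<lambda>x. \<psi> x * heat_kernel (fst p) (snd p - x))" if p: "p \<in> {s<..} \<times> UNIV" for p
    proof (rule integrable_psi_mult)
      show "\<bar>heat_kernel (fst p) (snd p - x)\<bar> \<le> 1 / (4 * pi * fst p)" for x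
        using p s heat_kernel_le[of "fst p" "snd p - x"] by (auto simp: mem_Times_iff)
    qed measurable
    fix p :: "real \<times> plane" and x :: plane and h :: "real \<times> plane"
    assume p: "p \<in> {s<..} \<times> UNIV"
    then have p0: "fst p > 0" "s \<le> fst p" using s by (auto simp: mem_Times_iff)
    show "((\<lambda>p. \<psi> x * heat_kernel (fst p) (snd p - x)) has_derivative ?f' p x) (at p)"
    proof -
      have "((\<lambda>p. (fst p, snd p - x)) has_derivative (\<lambda>k. k)) (at p)"
        by (auto intro!: derivative_eq_intros)
      from has_derivative_compose[OF this heat_kernel_has_derivative_joint[OF p0(1)]]
      show ?thesis by (intro has_derivative_mult_right) simp
    qed
    have "\<bar>heat_kernel (fst p) (snd p - x) * ((norm (snd p - x))\<^sup>2 / (4 * (fst p)\<^sup>2) - 1 / fst p) * fst h\<bar> \<le> 1 / s\<^sup>2 * norm h"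
      using laplace_heat_kernel_le[OF s p0(2), of "snd p - x"] norm_fst_le[of "fst h" "snd h"]
      unfolding abs_mult[of _ "fst h"] by (intro mult_mono) auto
    moreover have "\<bar>heat_kernel (fst p) (snd p - x) * (- ((snd p - x) \<bullet> snd h) / (2 * fst p))\<bar> \<le> s powr (-3/2) * norm h"
    proof -
      have "\<bar>heat_kernel (fst p) (snd p - x) * (- ((snd p - x) \<bullet> snd h) / (2 * fst p))\<bar> 
         = heat_kernel (fst p) (snd p - x) / (2 * fst p) * \<bar>(snd p - x) \<bullet> snd h\<bar>"
        using p0 by (simp add: abs_mult)
      also have "\<dots> \<le> heat_kernel (fst p) (snd p - x) / (2 * fst p) * (norm (snd p - x) * norm (snd h))"
        using p0 by (intro mult_left_mono Cauchy_Schwarz_ineq2) auto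
      also have "\<dots> = grad_heat_norm (fst p) (snd p - x) * norm (snd h)"
        by (simp add: grad_heat_norm_def)
      also have "\<dots> \<le> s powr (-3/2) * norm h"
        using grad_heat_norm_le_const[OF s p0(2)] norm_snd_le[of "snd h" "fst h"] by (intro mult_mono) auto
      finally show ?thesis .
    qed
    ultimately have "\<bar>heat_kernel (fst p) (snd p - x) * ((norm (snd p - x))\<^sup>2 / (4 * (fst p)\<^sup>2) - 1 / fst p) * fst h + 
     heat_kernel (fst p) (snd p - x) * (- ((snd p - x) \<bullet> snd h) / (2 * fst p))\<bar> \<le> ?K * norm h"
      unfolding distrib_right by linarith
    then show "\<bar>?f' p x h\<bar> \<le> \<bar>\<psi> x\<bar> * ?K * norm h"
      unfolding abs_mult[of "\<psi> x"] mult.assoc[of "\<bar>\<psi> x\<bar>"] by (intro mult_left_mono) auto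
  qed (use integrable_psi in auto)
  moreover have "(LINT x|lborel. ?f' (r, y) x k) = fst k * laplace_V r y + (\<Sum>i\<in>UNIV. pd i (V r) y * snd k $ i)" for k
  proof -
    have 1: "integrable lborel (\<lambda>x. \<psi> x * (heat_kernel r (y - x) * ((norm (y - x))\<^sup>2 / (4 * r\<^sup>2) - 1 / r)))"
      using laplace_heat_kernel_le[OF r order_refl] by (intro integrable_psi_mult[where C="1 / r\<^sup>2"]) auto
    have 2: "integrable lborel (\<lambda>x. \<psi> x * pd i (heat_kernel r) (y - x))" for i
      by (intro integrable_psi_mult[where C="r powr (-3/2)"] measurable_pd_heat abs_pd_heat_kernel_le_const r) auto
    have "?f' (r, y) x k = fst k * (\<psi> x * (heat_kernel r (y - x) * ((norm (y - x))\<^sup>2 / (4 * r\<^sup>2) - 1 / r)))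
       + (\<Sum>i\<in>UNIV. snd k $ i * (\<psi> x * pd i (heat_kernel r) (y - x)))" for x
    proof -
      have "heat_kernel r (y - x) * (- ((y - x) \<bullet> snd k) / (2 * r)) = (\<Sum>i\<in>UNIV. snd k $ i * pd i (heat_kernel r) (y - x))"
        using r by (simp add: pd_heat_kernel inner_vec_def sum_2 field_simps)
      then show ?thesis by (simp add: distrib_left sum_distrib_left mult_ac)
    qed
    then show ?thesis using 1 2
      by (simp add: laplace_V_eq[OF r] pd_V[OF r] mult.commute)
  qed
  ultimately show ?thesis by (simp add: V_eq)
qed

end

text \<open>The kernel is even, so differentiating in the variable of integration gives the kernel's
  own derivative at y - z; the minus sign is that of the distributional divergence.\<close>

lemma heat_div_distr:
  assumes "r > 0"
  shows "heat r (div_distr F) z = - (\<Sum>i\<in>UNIV. LINT y|lborel. F y $ i * pd i (heat_kernel r) (y - z))"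
proof -
  have "pd i (\<lambda>y. heat_kernel r (z - y)) y = pd i (heat_kernel r) (y - z)" for i y
  proof -
    have "(\<lambda>y. heat_kernel r (z - y)) = (\<lambda>y. heat_kernel r (y - z))"
      using heat_kernel_minus[of r z] by auto
    moreover have "((\<lambda>y. y - z) has_derivative (\<lambda>h. h)) (at y)" by (auto intro!: derivative_eq_intros)
    from has_derivative_compose[OF this heat_kernel_has_derivative[OF assms, of "y - z"]]
    have "((\<lambda>y. heat_kernel r (y - z)) has_derivative (\<lambda>h. heat_kernel r (y - z) * (- ((y - z) \<bullet> h) / (2 * r)))) (at y)" .
    ultimately show ?thesis
      using pd_eq[of "\<lambda>y. heat_kernel r (y - z)"] pd_eq[OF heat_kernel_has_derivative[OF assms, of "y - z"]] by metis
  qed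
  then show ?thesis by (simp add: heat_def div_distr_def)
qed

lemma fubini_dominated:
  fixes f :: "'a::euclidean_space \<Rightarrow> 'b::euclidean_space \<Rightarrow> real"
  assumes fm [measurable]: "(\<lambda>(x, y). f x y) \<in> borel_measurable (lborel \<Otimes>\<^sub>M lborel)"
    and le: "\<And>x y. \<bar>f x y\<bar> \<le> g x * h y" and g: "integrable lborel g" and h: "integrable lborel h"
  shows "(LINT x|lborel. LINT y|lborel. f x y) = (LINT y|lborel. LINT x|lborel. f x y)"
proof -
  have [measurable]: "g \<in> borel_measurable borel" "h \<in> borel_measurable borel" using g h by auto
  have "integrable (lborel \<Otimes>\<^sub>M lborel) (\<lambda>(x, y). g x * h y)"
  proof (rule lborel_pair.Fubini_integrable)
    show "integrable lborel (\<lambda>x. LINT y|lborel. norm (case (x, y) of (x, y) \<Rightarrow> g x * h y))"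
      using g by (simp add: abs_mult)
    show "AE x in lborel. integrable lborel (\<lambda>y. case (x, y) of (x, y) \<Rightarrow> g x * h y)"
      using h by simp
  qed measurable
  then have "integrable (lborel \<Otimes>\<^sub>M lborel) (\<lambda>(x, y). f x y)"
  proof (rule Bochner_Integration.integrable_bound)
    show "AE p in lborel \<Otimes>\<^sub>M lborel. norm (case p of (x, y) \<Rightarrow> f x y) \<le> norm (case p of (x, y) \<Rightarrow> g x * h y)"
      using le by (intro AE_I2) (auto simp: split_beta intro: order_trans[OF _ abs_ge_self])
  qed measurable
  then show ?thesis using lborel_pair.Fubini_integral[of f] by simp
qed

lemma integrable_heat:
  assumes \<psi>: "integrable lborel \<psi>" and s: "s > 0"
  shows "integrable lborel (heat s (distr_of \<psi>))"
proof -
  have [measurable]: "\<psi> \<in> borel_measurable borel" using \<psi> by auto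
  have "integrable (lborel \<Otimes>\<^sub>M lborel) (\<lambda>(x, z). \<psi> x * heat_kernel s (z - x))"
  proof (rule lborel_pair.Fubini_integrable)
    have "(\<lambda>x. LINT z|lborel. norm (case (x, z) of (x, z) \<Rightarrow> \<psi> x * heat_kernel s (z - x))) = (\<lambda>x. \<bar>\<psi> x\<bar>)"
      using integral_heat_kernel(1)[OF s] s by (auto simp: abs_mult)
    then show "integrable lborel (\<lambda>x. LINT z|lborel. norm (case (x, z) of (x, z) \<Rightarrow> \<psi> x * heat_kernel s (z - x)))"
      using \<psi> by simp
    show "AE x in lborel. integrable lborel (\<lambda>z. case (x, z) of (x, z) \<Rightarrow> \<psi> x * heat_kernel s (z - x))"
      using integrable_heat_kernel(1)[OF s] by simp
  qed measurable
  from lborel_pair.integrable_snd[OF this] show ?thesis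
    by (simp add: heat_distr_of)
qed

context test_function begin

lemma heat_V:
  assumes r: "r > 0" and s: "s > 0"
  shows "heat r (distr_of (V s)) = V (r + s)"
proof
  fix y
  have "heat r (distr_of (V s)) y = (LINT z|lborel. LINT x|lborel. heat_kernel r (y - z) * (\<psi> x * heat_kernel s (z - x)))"
    by (simp add: heat_distr_of V_eq mult.commute)
  also have "\<dots> = (LINT x|lborel. LINT z|lborel. heat_kernel r (y - z) * (\<psi> x * heat_kernel s (z - x)))"
  proof (rule fubini_dominated[where g="\<lambda>z. heat_kernel r (y - z)" and h="\<lambda>x. \<bar>\<psi> x\<bar> * (1 / (4 * pi * s))"])
    show "\<bar>heat_kernel r (y - z) * (\<psi> x * heat_kernel s (z - x))\<bar> \<le> heat_kernel r (y - z) * (\<bar>\<psi> x\<bar> * (1 / (4 * pi * s)))" for z x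
      using heat_kernel_le[OF s, of "z - x"] r s unfolding abs_mult by (intro mult_mono) auto
    show "integrable lborel (\<lambda>z. heat_kernel r (y - z))" by (rule integrable_heat_kernel(2)[OF r])
    show "integrable lborel (\<lambda>x. \<bar>\<psi> x\<bar> * (1 / (4 * pi * s)))" using integrable_psi by simp
  qed measurable
  also have "\<dots> = (LINT x|lborel. \<psi> x * (LINT z|lborel. heat_kernel r (y - z) * heat_kernel s (z - x)))"
    by (simp only: mult.left_commute[of "heat_kernel r _"] integral_mult_right_zero)
  also have "\<dots> = V (r + s) y"
    by (simp only: heat_kernel_semigroup[OF r s] V_eq)
  finally show "heat r (distr_of (V s)) y = V (r + s) y" .
qed

lemma integrable_V: "s > 0 \<Longrightarrow> integrable lborel (V s)"
  unfolding V_def by (rule integrable_heat[OF integrable_psi])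

lemma V_measurable [measurable]: "V s \<in> borel_measurable borel"
  unfolding V_def by measurable

text \<open>Both the divergence and the remaining heat flow are moved onto the test function, which
  leaves a flux in L^1 paired with a bounded gradient.\<close>

lemma heat_div_distr_pairing:
  assumes r: "r > 0" and s: "s > 0" and F: "\<And>i. integrable lborel (\<lambda>y. F y $ i)"
  shows "distr_of (heat r (div_distr F)) (V s) = - (\<Sum>i\<in>UNIV. LINT y|lborel. F y $ i * pd i (V (r + s)) y)"
proof -
  have [measurable]: "(\<lambda>y. F y $ i) \<in> borel_measurable borel" for i using F by auto
  have pm [measurable]: "pd i (heat_kernel r) \<in> borel_measurable borel" for i
    using borel_measurable_pds[OF heat_kernel_schwartz[OF r], of "[i]"] by (simp add: pds_def)
  have bd: "\<bar>pd i (heat_kernel r) y\<bar> \<le> r powr (-3/2)" for i y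
    by (rule abs_pd_heat_kernel_le_const[OF r order_refl])
  have "distr_of (heat r (div_distr F)) (V s)
      = - (\<Sum>i\<in>UNIV. LINT z|lborel. LINT y|lborel. F y $ i * pd i (heat_kernel r) (y - z) * V s z)"
  proof -
    have i: "integrable lborel (\<lambda>z. (LINT y|lborel. F y $ i * pd i (heat_kernel r) (y - z)) * V s z)" for i
    proof (rule Bochner_Integration.integrable_bound)
      show "integrable lborel (\<lambda>z. (LINT y|lborel. \<bar>F y $ i\<bar> * r powr (-3/2)) * V s z)"
        using integrable_V[OF s] by simp
      show "AE z in lborel. norm ((LINT y|lborel. F y $ i * pd i (heat_kernel r) (y - z)) * V s z)
          \<le> norm ((LINT y|lborel. \<bar>F y $ i\<bar> * r powr (-3/2)) * V s z)"
      proof (intro AE_I2)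
        fix z
        have "norm (LINT y|lborel. F y $ i * pd i (heat_kernel r) (y - z)) \<le> (LINT y|lborel. \<bar>F y $ i\<bar> * r powr (-3/2))"
        proof (rule Bochner_Integration.integral_norm_bound_integral)
          show I: "integrable lborel (\<lambda>y. \<bar>F y $ i\<bar> * r powr (-3/2))" using F by simp
          show n: "norm (F y $ i * pd i (heat_kernel r) (y - z)) \<le> \<bar>F y $ i\<bar> * r powr (-3/2)" for y
            using bd by (auto simp: abs_mult intro!: mult_left_mono)
          show "integrable lborel (\<lambda>y. F y $ i * pd i (heat_kernel r) (y - z))"
            by (rule Bochner_Integration.integrable_bound[OF I]) (use n in \<open>auto intro: order_trans[OF _ abs_ge_self]\<close>)
        qed
        then show "norm ((LINT y|lborel. F y $ i * pd i (heat_kernel r) (y - z)) * V s z)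
          \<le> norm ((LINT y|lborel. \<bar>F y $ i\<bar> * r powr (-3/2)) * V s z)"
          unfolding norm_mult by (intro mult_right_mono) auto
      qed
    qed measurable
    show ?thesis unfolding distr_of_def
      by (simp only: heat_div_distr[OF r] minus_mult_left[symmetric] integral_minus sum_distrib_right
          Bochner_Integration.integral_sum[OF i] integral_mult_left_zero)
  qed
  moreover have "(LINT z|lborel. LINT y|lborel. F y $ i * pd i (heat_kernel r) (y - z) * V s z)
     = (LINT y|lborel. F y $ i * pd i (V (r + s)) y)" for i
  proof -
    have "(LINT z|lborel. LINT y|lborel. F y $ i * pd i (heat_kernel r) (y - z) * V s z)
      = (LINT y|lborel. LINT z|lborel. F y $ i * pd i (heat_kernel r) (y - z) * V s z)"
    proof (rule fubini_dominated[where g="\<lambda>z. \<bar>V s z\<bar>" and h="\<lambda>y. \<bar>F y $ i\<bar> * r powr (-3/2)"])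
      show "\<bar>F y $ i * pd i (heat_kernel r) (y - z) * V s z\<bar> \<le> \<bar>V s z\<bar> * (\<bar>F y $ i\<bar> * r powr (-3/2))" for z y
        using bd by (simp add: abs_mult mult_left_mono mult.commute[of _ "\<bar>V s z\<bar>"])
    qed (use F integrable_V[OF s] in \<open>measurable, auto\<close>)
    also have "\<dots> = (LINT y|lborel. F y $ i * (LINT z|lborel. V s z * pd i (heat_kernel r) (y - z)))"
      by (simp only: mult.assoc mult.commute[of "pd i (heat_kernel r) _" "V s _"] integral_mult_right_zero)
    also have "\<dots> = (LINT y|lborel. F y $ i * pd i (V (r + s)) y)"
      using pds_convolution[OF heat_kernel_schwartz[OF r] integrable_V[OF s], of "[i]"]
      by (simp add: pds_def heat_V[OF r s, symmetric] heat_distr_of)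
    finally show ?thesis .
  qed
  ultimately show ?thesis by simp
qed

end

lemma grad_potential_measurable:
  fixes v :: "plane \<Rightarrow> real"
  assumes [measurable]: "v \<in> borel_measurable borel"
  shows "grad_potential v \<in> borel_measurable borel" "debye_flux v \<in> borel_measurable borel"
proof -
  show [measurable]: "grad_potential v \<in> borel_measurable borel"
    unfolding grad_potential_def[abs_def] by measurable
  show "debye_flux v \<in> borel_measurable borel"
    unfolding debye_flux_def[abs_def] by measurable
qed

section \<open>The Debye flux of the self-similar solution\<close>

context profile begin

text \<open>Freezes the density at time 1 and moves all time dependence into \<open>\<Phi>\<close>,
  so that differentiation in time never touches \<open>U\<close>.\<close>

lemma U_scale:
  assumes t: "t > 0" and [measurable]: "\<Phi> \<in> borel_measurable borel"
  shows "(LINT y|lborel. U t y * \<Phi> y) = (LINT z|lborel. U 1 z * \<Phi> (sqrt t *\<^sub>R z))"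
proof -
  note [measurable] = U_measurable[OF t]
  have "(LINT y|lborel. U t y * \<Phi> y) = (sqrt t)\<^sup>2 * (LINT z|lborel. U t (sqrt t *\<^sub>R z) * \<Phi> (sqrt t *\<^sub>R z))"
    using t by (intro integral_scale_plane) auto
  also have "\<dots> = (LINT z|lborel. t * (U t (sqrt t *\<^sub>R z) * \<Phi> (sqrt t *\<^sub>R z)))"
    using t by simp
  also have "\<dots> = (LINT z|lborel. U 1 z * \<Phi> (sqrt t *\<^sub>R z))"
    using t by (intro Bochner_Integration.integral_cong) (auto simp: U_def power_mult_distrib)
  finally show ?thesis .
qed

text \<open>Only the mass 2 pi \<xi>(|x|^2 / t) inside the disc acts at x, and the normalisation -1
  / (2 pi) of the potential removes the factor 2 pi.\<close>

lemma grad_potential_U: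
  assumes t: "t > 0" and x: "x \<noteq> 0"
  shows "grad_potential (U t) x = - (\<xi> ((norm x)\<^sup>2 / t) / (norm x)\<^sup>2) *\<^sub>R x"
proof -
  note [measurable] = U_measurable[OF t]
  have "(\<integral>\<^sup>+y. ennreal (U t y * indicator {y. norm y < norm x} y) \<partial>lborel)
     = (\<integral>\<^sup>+y. ennreal (U t y) * indicator {0..(norm x)\<^sup>2} ((norm y)\<^sup>2) \<partial>lborel)"
  proof (rule nn_integral_cong_AE)
    show "AE y in lborel. ennreal (U t y * indicator {y. norm y < norm x} y) = ennreal (U t y) * indicator {0..(norm x)\<^sup>2} ((norm y)\<^sup>2)"
      using AE_norm_neq[of "norm x"]
    proof eventually_elim
      case (elim y)
      have "(norm y)\<^sup>2 \<le> (norm x)\<^sup>2 \<longleftrightarrow> norm y < norm x"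
        using elim by (metis abs_le_square_iff abs_norm_cancel order_le_less)
      then show ?case by (auto simp: indicator_def)
    qed
  qed
  also have "\<dots> = ennreal (2 * pi * \<xi> ((norm x)\<^sup>2 / t))" by (rule U_disc[OF t]) simp
  finally have m: "(LINT y|lborel. U t y * indicator {y. norm y < norm x} y) = 2 * pi * \<xi> ((norm x)\<^sup>2 / t)"
    using U_nonneg[OF t] t xi_nonneg[of "(norm x)\<^sup>2 / t"] by (subst integral_eq_nn_integral) (auto simp: indicator_def)
  have "(LINT y|lborel. (U t y / (norm (x - y))\<^sup>2) *\<^sub>R (x - y))
      = ((LINT y|lborel. U t y * indicator {y. norm y < norm x} y) / (norm x)\<^sup>2) *\<^sub>R x"
    by (rule newton_plane[OF U_measurable[OF t] U_nonneg[OF t] U_le[OF t] U_integrable[OF t] _ x]) (simp add: U_def norm_rot)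
  then show ?thesis
    unfolding grad_potential_def m by simp
qed

lemma debye_flux_U:
  assumes t: "t > 0" and x: "x \<noteq> 0"
  shows "debye_flux (U t) x = - (grad_U t x + (U t x / (2 * t)) *\<^sub>R x)"
proof -
  let ?y = "(norm x)\<^sup>2 / t"
  have y: "?y \<noteq> 0" using t x by simp
  \<comment> \<open>The profile equation in disguise: as t times \<open>?y\<close> is |x|^2, the
    summand -1/4 in \<open>\<xi>2\<close> cancels the drift term U / (2 t).\<close>
  have "4 / t\<^sup>2 * \<xi>2 ?y + U t x / (2 * t) = U t x * (\<xi> ?y / (norm x)\<^sup>2)"
    using t x y by (simp add: \<xi>2_def U_def power2_eq_square field_simps)
  moreover have "grad_U t x + (U t x / (2 * t)) *\<^sub>R x = (4 / t\<^sup>2 * \<xi>2 ?y + U t x / (2 * t)) *\<^sub>R x"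
    by (simp add: grad_U_def scaleR_add_left)
  ultimately show ?thesis
    by (simp add: debye_flux_def grad_potential_U[OF t x])
qed

lemma debye_flux_U_AE:
  assumes t: "t > 0"
  shows "AE x in lborel. debye_flux (U t) x = - (grad_U t x + (U t x / (2 * t)) *\<^sub>R x)"
  using AE_norm_neq[of 0] by eventually_elim (simp add: debye_flux_U[OF t])

lemma debye_flux_U_integrable:
  assumes t: "t > 0"
  shows "integrable lborel (\<lambda>x. debye_flux (U t) x $ i)"
proof -
  note [measurable] = U_measurable[OF t] grad_U_measurable[OF t] grad_potential_measurable(2)[OF U_measurable[OF t]]
  have "integrable lborel (\<lambda>x. norm (grad_U t x) * 1 + U t x * (norm x / (2 * t)))"
    using U_poly_integrable(2)[OF t, of "\<lambda>_. 1" 1 0] U_poly_integrable(1)[OF t, of "\<lambda>x. norm x / (2 * t)" 0 "1 / (2 * t)"] t by simp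
  then show ?thesis
  proof (rule Bochner_Integration.integrable_bound)
    show "AE x in lborel. norm (debye_flux (U t) x $ i) \<le> norm (norm (grad_U t x) * 1 + U t x * (norm x / (2 * t)))"
      using debye_flux_U_AE[OF t]
    proof eventually_elim
      case (elim x)
      have "norm (debye_flux (U t) x $ i) \<le> norm (debye_flux (U t) x)" by (simp add: component_le_norm_cart)
      also have "\<dots> \<le> norm (grad_U t x) + norm ((U t x / (2 * t)) *\<^sub>R x)"
        unfolding elim norm_minus_cancel by (rule norm_triangle_ineq)
      also have "\<dots> = norm (grad_U t x) * 1 + U t x * (norm x / (2 * t))"
        using U_nonneg[OF t, of x] t by simp
      finally show ?case by (rule order_trans) simp
    qed
  qed measurable
qed

end

section \<open>The self-similar solution against a moving test function\<close>

locale profile_test = profile M \<xi> \<xi>' + test_function \<psi> R for M \<xi> \<xi>' \<psi> R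
begin

text \<open>For a = t + s this is minus the Duhamel integrand of \<open>U\<close> at time \<tau>,
  tested against \<open>V s\<close>.\<close>

definition flux_pairing :: "real \<Rightarrow> real \<Rightarrow> real" where
  "flux_pairing a \<tau> = (\<Sum>i\<in>UNIV. LINT y|lborel. debye_flux (U \<tau>) y $ i * pd i (V (a - \<tau>)) y)"

text \<open>The derivative in \<tau> of \<open>V (a - \<tau>) (sqrt \<tau> *\<^sub>R z)\<close>: the
  first term comes from the backward heat flow, the second from the dilation.\<close>

definition flow_rate :: "real \<Rightarrow> real \<Rightarrow> plane \<Rightarrow> real" where
  "flow_rate a \<tau> z = - laplace_V (a - \<tau>) (sqrt \<tau> *\<^sub>R z)
     + (\<Sum>i\<in>UNIV. pd i (V (a - \<tau>)) (sqrt \<tau> *\<^sub>R z) * z $ i) / (2 * sqrt \<tau>)"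

lemma measurable_pd_V: "r > 0 \<Longrightarrow> pd i (V r) \<in> borel_measurable borel"
  using borel_measurable_pds[OF V_schwartz, of r "[i]"] by (simp add: pds_def)

lemma measurable_laplace_V: "r > 0 \<Longrightarrow> laplace_V r \<in> borel_measurable borel"
  using borel_measurable_pds[OF V_schwartz, of r] unfolding laplace_V_def[abs_def] by simp

lemma flow_rate_measurable: "\<tau> < a \<Longrightarrow> flow_rate a \<tau> \<in> borel_measurable borel"
  using measurable_laplace_V[of "a - \<tau>"] measurable_pd_V[of "a - \<tau>"] unfolding flow_rate_def[abs_def]
  by measurable

lemma flow_rate_le:
  assumes s: "0 < s" "s \<le> a - \<tau>" and \<tau>: "0 < c" "c \<le> \<tau>"
  shows "\<bar>flow_rate a \<tau> z\<bar> \<le> (1 / s\<^sup>2 + s powr (-3/2) * norm z / sqrt c) * (LINT x|lborel. \<bar>\<psi> x\<bar>)"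
proof -
  let ?I = "LINT x|lborel. \<bar>\<psi> x\<bar>"
  have I: "?I \<ge> 0" by simp
  have "\<bar>pd i (V (a - \<tau>)) (sqrt \<tau> *\<^sub>R z) * z $ i\<bar> \<le> (s powr (-3/2) * ?I) * norm z" for i
    unfolding abs_mult by (intro mult_mono pd_V_le s component_le_norm_cart) auto
  then have "\<bar>\<Sum>i\<in>UNIV. pd i (V (a - \<tau>)) (sqrt \<tau> *\<^sub>R z) * z $ i\<bar> \<le> (\<Sum>i\<in>(UNIV::2 set). (s powr (-3/2) * ?I) * norm z)"
    by (intro sum_abs[THEN order_trans] sum_mono)
  then have le: "\<bar>\<Sum>i\<in>UNIV. pd i (V (a - \<tau>)) (sqrt \<tau> *\<^sub>R z) * z $ i\<bar> \<le> 2 * ((s powr (-3/2) * ?I) * norm z)"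
    by simp
  have "\<bar>(\<Sum>i\<in>UNIV. pd i (V (a - \<tau>)) (sqrt \<tau> *\<^sub>R z) * z $ i) / (2 * sqrt \<tau>)\<bar>
      = \<bar>\<Sum>i\<in>UNIV. pd i (V (a - \<tau>)) (sqrt \<tau> *\<^sub>R z) * z $ i\<bar> / (2 * sqrt \<tau>)"
    using \<tau> by simp
  also have "\<dots> \<le> (2 * ((s powr (-3/2) * ?I) * norm z)) / (2 * sqrt \<tau>)"
    using \<tau> by (intro divide_right_mono le) simp
  also have "\<dots> \<le> (2 * ((s powr (-3/2) * ?I) * norm z)) / (2 * sqrt c)"
    using \<tau> I by (intro divide_left_mono) auto
  finally have "\<bar>(\<Sum>i\<in>UNIV. pd i (V (a - \<tau>)) (sqrt \<tau> *\<^sub>R z) * z $ i) / (2 * sqrt \<tau>)\<bar> \<le> (s powr (-3/2) * norm z / sqrt c) * ?I"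
    by (simp add: mult_ac)
  moreover have "\<bar>laplace_V (a - \<tau>) (sqrt \<tau> *\<^sub>R z)\<bar> \<le> 1 / s\<^sup>2 * ?I" by (rule laplace_V_le[OF s])
  ultimately show ?thesis unfolding flow_rate_def distrib_right by linarith
qed

text \<open>Undoing the rescaling and integrating by parts turns the Laplacian into a pairing with
  the gradient of \<open>U\<close> and the dilation into one with x U / (2 \<tau>); together these
  are minus the flux.\<close>

lemma flow_rate_integral:
  assumes \<tau>: "0 < \<tau>" "\<tau> < a"
  shows "(LINT z|lborel. U 1 z * flow_rate a \<tau> z) = - flux_pairing a \<tau>"
proof -
  let ?V = "V (a - \<tau>)"
  have r: "a - \<tau> > 0" using \<tau> by simp
  note S = V_schwartz[OF r]
  note [measurable] = measurable_laplace_V[OF r] measurable_pd_V[OF r] U_measurable[OF \<tau>(1)]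
  let ?\<Phi> = "\<lambda>y. - laplace_V (a - \<tau>) y + (\<Sum>i\<in>UNIV. pd i ?V y * (y $ i / (2 * \<tau>)))"
  have "flow_rate a \<tau> z = ?\<Phi> (sqrt \<tau> *\<^sub>R z)" for z
  proof -
    have "sqrt \<tau> / (2 * \<tau>) = 1 / (2 * sqrt \<tau>)"
      using \<tau> real_sqrt_mult_self[of \<tau>] by (simp add: field_simps)
    then have "sqrt \<tau> * q / (2 * \<tau>) = q / (2 * sqrt \<tau>)" for q
      by (metis mult.commute times_divide_eq_right mult.right_neutral)
    then show ?thesis by (simp add: flow_rate_def sum_divide_distrib)
  qed
  then have "(LINT z|lborel. U 1 z * flow_rate a \<tau> z) = (LINT y|lborel. U \<tau> y * ?\<Phi> y)"
    using U_scale[OF \<tau>(1), of ?\<Phi>] by simp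
  also have "\<dots> = (LINT y|lborel. (\<Sum>i\<in>UNIV. - (U \<tau> y * pds [i, i] ?V y) + U \<tau> y * (pd i ?V y * (y $ i / (2 * \<tau>)))))"
    by (simp add: laplace_V_def sum_2 algebra_simps)
  finally have e0: "(LINT z|lborel. U 1 z * flow_rate a \<tau> z) = (LINT y|lborel. (\<Sum>i\<in>UNIV. - (U \<tau> y * pds [i, i] ?V y) + U \<tau> y * (pd i ?V y * (y $ i / (2 * \<tau>)))))" .
  have e1: "(LINT y|lborel. (\<Sum>i\<in>UNIV. - (U \<tau> y * pds [i, i] ?V y) + U \<tau> y * (pd i ?V y * (y $ i / (2 * \<tau>))))) = (\<Sum>i\<in>UNIV. LINT y|lborel. - (U \<tau> y * pds [i, i] ?V y) + U \<tau> y * (pd i ?V y * (y $ i / (2 * \<tau>))))"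
  and e2: "\<And>i. (LINT y|lborel. - (U \<tau> y * pds [i, i] ?V y) + U \<tau> y * (pd i ?V y * (y $ i / (2 * \<tau>))))
       = - (LINT y|lborel. debye_flux (U \<tau>) y $ i * pd i ?V y)"
  proof -
    have i2: "integrable lborel (\<lambda>y. U \<tau> y * (pd i ?V y * (y $ i / (2 * \<tau>))))" for i
    proof -
      obtain C where C: "C > 0" "\<And>y. \<bar>pd i ?V y\<bar> \<le> C"
        using schwartz_bounded[OF S, of "[i]"] by (auto simp: pds_def)
      show ?thesis
      proof (rule U_poly_integrable(1)[OF \<tau>(1), of _ 0 "C / (2 * \<tau>)"])
        show "\<bar>pd i ?V y * (y $ i / (2 * \<tau>))\<bar> \<le> 0 + C / (2 * \<tau>) * norm y" for y
        proof -
          have "\<bar>pd i ?V y\<bar> * (\<bar>y $ i\<bar> / (2 * \<tau>)) \<le> C * (norm y / (2 * \<tau>))"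
            using C \<tau> component_le_norm_cart[of y i] by (intro mult_mono divide_right_mono) auto
          then show ?thesis using \<tau> by (simp add: abs_mult)
        qed
      qed (use C \<tau> in auto)
    qed
    note ibp = U_integration_by_parts[OF \<tau>(1) S]
    show "(LINT y|lborel. (\<Sum>i\<in>UNIV. - (U \<tau> y * pds [i, i] ?V y) + U \<tau> y * (pd i ?V y * (y $ i / (2 * \<tau>)))))
      = (\<Sum>i\<in>UNIV. LINT y|lborel. - (U \<tau> y * pds [i, i] ?V y) + U \<tau> y * (pd i ?V y * (y $ i / (2 * \<tau>))))"
      by (intro Bochner_Integration.integral_sum Bochner_Integration.integrable_add integrable_minus ibp(2) i2)
    fix i
    have "(LINT y|lborel. - (U \<tau> y * pds [i, i] ?V y) + U \<tau> y * (pd i ?V y * (y $ i / (2 * \<tau>))))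
      = (LINT y|lborel. grad_U \<tau> y $ i * pd i ?V y) + (LINT y|lborel. U \<tau> y * (pd i ?V y * (y $ i / (2 * \<tau>))))"
      using ibp(2,3)[of i] i2[of i] by (subst Bochner_Integration.integral_add) auto
    also have "\<dots> = (LINT y|lborel. grad_U \<tau> y $ i * pd i ?V y + U \<tau> y * (pd i ?V y * (y $ i / (2 * \<tau>))))"
      using ibp(1)[of i] i2[of i] by simp
    also have "\<dots> = (LINT y|lborel. - (debye_flux (U \<tau>) y $ i * pd i ?V y))"
    proof (rule integral_cong_AE)
      show "(\<lambda>y. - (debye_flux (U \<tau>) y $ i * pd i ?V y)) \<in> borel_measurable lborel"
        using grad_potential_measurable(2)[OF U_measurable[OF \<tau>(1)]] by measurable
      show "(\<lambda>y. grad_U \<tau> y $ i * pd i ?V y + U \<tau> y * (pd i ?V y * (y $ i / (2 * \<tau>)))) \<in> borel_measurable lborel"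
        using grad_U_measurable[OF \<tau>(1)] by measurable
      show "AE y in lborel. grad_U \<tau> y $ i * pd i ?V y + U \<tau> y * (pd i ?V y * (y $ i / (2 * \<tau>))) = - (debye_flux (U \<tau>) y $ i * pd i ?V y)"
        using debye_flux_U_AE[OF \<tau>(1)]
      proof eventually_elim
        case (elim y)
        show ?case unfolding elim by (simp add: algebra_simps)
      qed
    qed
    finally show "(LINT y|lborel. - (U \<tau> y * pds [i, i] ?V y) + U \<tau> y * (pd i ?V y * (y $ i / (2 * \<tau>))))
       = - (LINT y|lborel. debye_flux (U \<tau>) y $ i * pd i ?V y)" by simp
  qed
  show ?thesis unfolding e0 e1 e2 by (simp add: flux_pairing_def sum_negf)
qed

lemma flow_has_derivative:
  assumes s: "s > 0" and \<tau>: "0 < \<tau>" "\<tau> < t"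
  shows "((\<lambda>\<tau>. LINT z|lborel. U 1 z * V (t + s - \<tau>) (sqrt \<tau> *\<^sub>R z)) has_real_derivative - flux_pairing (t + s) \<tau>) (at \<tau>)"
proof -
  let ?a = "t + s" and ?I = "LINT x|lborel. \<bar>\<psi> x\<bar>"
  have I: "?I \<ge> 0" by simp
  note [measurable] = U_measurable[of 1, simplified]
  define K where "K z = (1 / s\<^sup>2 + s powr (-3/2) * norm z / sqrt (\<tau> / 2)) * ?I" for z :: plane
  have "((\<lambda>\<tau>. LINT z|lborel. U 1 z * V (?a - \<tau>) (sqrt \<tau> *\<^sub>R z)) has_derivative
     (\<lambda>k. LINT z|lborel. U 1 z * (k * flow_rate ?a \<tau> z))) (at \<tau>)"
  \<comment> \<open>On this interval the time is bounded away from 0 and the time left for the test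
    function exceeds s, so one majorant \<open>K\<close> of linear growth serves throughout.\<close>
  proof (rule has_derivative_integral[where U="{\<tau>/2<..<t}" and B="\<lambda>z. U 1 z * K z" and f'="\<lambda>\<sigma> z k. U 1 z * (k * flow_rate ?a \<sigma> z)"])
    show "integrable lborel (\<lambda>z. U 1 z * K z)"
    proof (rule U_poly_integrable(1)[of _ _ "1 / s\<^sup>2 * ?I" "s powr (-3/2) / sqrt (\<tau> / 2) * ?I"])
      show "\<bar>K z\<bar> \<le> 1 / s\<^sup>2 * ?I + s powr (-3/2) / sqrt (\<tau> / 2) * ?I * norm z" for z
      proof -
        have "K z \<ge> 0" unfolding K_def using I \<tau> by (intro mult_nonneg_nonneg add_nonneg_nonneg) auto
        moreover have "K z = 1 / s\<^sup>2 * ?I + s powr (-3/2) / sqrt (\<tau> / 2) * ?I * norm z"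
          by (simp add: K_def algebra_simps)
        ultimately show ?thesis by simp
      qed
    qed (use \<tau> s I in \<open>auto simp: K_def\<close>)
    fix \<sigma> assume "\<sigma> \<in> {\<tau>/2<..<t}"
    then have \<sigma>: "0 < \<tau> / 2" "\<tau> / 2 \<le> \<sigma>" "0 < \<sigma>" "s \<le> ?a - \<sigma>" "0 < ?a - \<sigma>" using \<tau> s by auto
    show "integrable lborel (\<lambda>z. U 1 z * V (?a - \<sigma>) (sqrt \<sigma> *\<^sub>R z))"
      by (rule U_poly_integrable(1)[of _ _ "1 / s * ?I" 0]) (use V_le[OF s \<sigma>(4)] s I in auto)
    fix z
    show "((\<lambda>\<sigma>. U 1 z * V (?a - \<sigma>) (sqrt \<sigma> *\<^sub>R z)) has_derivative (\<lambda>k. U 1 z * (k * flow_rate ?a \<sigma> z))) (at \<sigma>)"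
    proof -
      have "((\<lambda>\<sigma>. (?a - \<sigma>, sqrt \<sigma> *\<^sub>R z)) has_derivative (\<lambda>k. (- k, (k / (2 * sqrt \<sigma>)) *\<^sub>R z))) (at \<sigma>)"
        using \<sigma>(3) by (auto intro!: derivative_eq_intros simp: field_simps)
      from has_derivative_compose[OF this V_has_derivative[OF \<sigma>(5)]]
      have "((\<lambda>\<sigma>. V (?a - \<sigma>) (sqrt \<sigma> *\<^sub>R z)) has_derivative
        (\<lambda>k. - k * laplace_V (?a - \<sigma>) (sqrt \<sigma> *\<^sub>R z) + (\<Sum>i\<in>UNIV. pd i (V (?a - \<sigma>)) (sqrt \<sigma> *\<^sub>R z) * ((k / (2 * sqrt \<sigma>)) *\<^sub>R z) $ i))) (at \<sigma>)"
        by simp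
      moreover have "- k * laplace_V (?a - \<sigma>) (sqrt \<sigma> *\<^sub>R z) + (\<Sum>i\<in>UNIV. pd i (V (?a - \<sigma>)) (sqrt \<sigma> *\<^sub>R z) * ((k / (2 * sqrt \<sigma>)) *\<^sub>R z) $ i)
         = k * flow_rate ?a \<sigma> z" for k
        by (simp add: flow_rate_def sum_2 add_divide_distrib algebra_simps)
      ultimately show ?thesis by (intro has_derivative_mult_right) simp
    qed
    show "\<bar>U 1 z * (h * flow_rate ?a \<sigma> z)\<bar> \<le> U 1 z * K z * norm h" for h
    proof -
      have "\<bar>flow_rate ?a \<sigma> z\<bar> \<le> K z"
        unfolding K_def by (rule flow_rate_le[OF s \<sigma>(4,1,2)])
      then have "U 1 z * (\<bar>h\<bar> * \<bar>flow_rate ?a \<sigma> z\<bar>) \<le> U 1 z * (\<bar>h\<bar> * K z)"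
        using U_nonneg[of 1 z] by (intro mult_left_mono) auto
      then show ?thesis using U_nonneg[of 1 z] by (simp add: abs_mult mult_ac)
    qed
  qed (use \<tau> s flow_rate_measurable[of \<tau> ?a] in auto)
  moreover have "(LINT z|lborel. U 1 z * (k * flow_rate ?a \<tau> z)) = - flux_pairing ?a \<tau> * k" for k
  proof -
    have "(LINT z|lborel. U 1 z * (k * flow_rate ?a \<tau> z)) = k * (LINT z|lborel. U 1 z * flow_rate ?a \<tau> z)"
      by (simp only: mult.left_commute[of "U 1 _"] integral_mult_right_zero)
    then show ?thesis using flow_rate_integral[of \<tau> ?a] \<tau> s by simp
  qed
  ultimately have "((\<lambda>\<tau>. LINT z|lborel. U 1 z * V (?a - \<tau>) (sqrt \<tau> *\<^sub>R z)) has_derivative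
     (\<lambda>k. - flux_pairing ?a \<tau> * k)) (at \<tau>)" by (simp only:)
  then show ?thesis unfolding has_field_derivative_def .
qed

text \<open>The power \<tau>^(-1/2) stems from the dilation and is integrable at 0, which makes the
  Duhamel integral of \<open>U\<close> absolutely convergent.\<close>

lemma flux_pairing_le:
  assumes s: "s > 0" and \<tau>: "0 < \<tau>" "\<tau> < t"
  shows "\<bar>flux_pairing (t + s) \<tau>\<bar> \<le> 
    (1 / s\<^sup>2 * M + s powr (-3/2) * (LINT z|lborel. U 1 z * norm z) * \<tau> powr (-1/2)) * (LINT x|lborel. \<bar>\<psi> x\<bar>)"
proof -
  let ?a = "t + s" and ?I = "LINT x|lborel. \<bar>\<psi> x\<bar>"
  note [measurable] = U_measurable[of 1, simplified]
  have i1: "integrable lborel (\<lambda>z. U 1 z * norm z)" by (rule U_poly_integrable(1)[of _ _ 0 1]) auto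
  have i0: "integrable lborel (U 1)" by (rule U_integrable) simp
  have I: "?I \<ge> 0" by simp
  have "norm (LINT z|lborel. U 1 z * flow_rate ?a \<tau> z) \<le> (LINT z|lborel. (1 / s\<^sup>2 * ?I) * U 1 z + (s powr (-3/2) / sqrt \<tau> * ?I) * (U 1 z * norm z))"
  proof (rule Bochner_Integration.integral_norm_bound_integral)
    show J: "integrable lborel (\<lambda>z. (1 / s\<^sup>2 * ?I) * U 1 z + (s powr (-3/2) / sqrt \<tau> * ?I) * (U 1 z * norm z))"
      using i0 i1 by simp
    show b: "norm (U 1 z * flow_rate ?a \<tau> z) \<le> (1 / s\<^sup>2 * ?I) * U 1 z + (s powr (-3/2) / sqrt \<tau> * ?I) * (U 1 z * norm z)" for z
    proof -
      have "\<bar>flow_rate ?a \<tau> z\<bar> \<le> (1 / s\<^sup>2 + s powr (-3/2) * norm z / sqrt \<tau>) * ?I"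
        by (rule flow_rate_le) (use s \<tau> in auto)
      then have "U 1 z * \<bar>flow_rate ?a \<tau> z\<bar> \<le> U 1 z * ((1 / s\<^sup>2 + s powr (-3/2) * norm z / sqrt \<tau>) * ?I)"
        using U_nonneg[of 1 z] by (intro mult_left_mono) auto
      then show ?thesis using U_nonneg[of 1 z] by (simp add: abs_mult algebra_simps)
    qed
    show "integrable lborel (\<lambda>z. U 1 z * flow_rate ?a \<tau> z)"
    proof (rule Bochner_Integration.integrable_bound[OF J])
      show "(\<lambda>z. U 1 z * flow_rate ?a \<tau> z) \<in> borel_measurable lborel"
        using flow_rate_measurable[of \<tau> ?a] \<tau> s by simp
    qed (use b in \<open>auto intro: order_trans[OF _ abs_ge_self]\<close>)
  qed
  also have "\<dots> = (1 / s\<^sup>2 * ?I) * M + (s powr (-3/2) / sqrt \<tau> * ?I) * (LINT z|lborel. U 1 z * norm z)"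
    using i0 i1 U_integral[of 1] by simp
  also have "\<dots> = (1 / s\<^sup>2 * M + s powr (-3/2) * (LINT z|lborel. U 1 z * norm z) * \<tau> powr (-1/2)) * ?I"
  proof -
    have "\<tau> powr (-1/2) = 1 / sqrt \<tau>"
      using \<tau> powr_minus_divide[of \<tau> "1/2"] by (simp add: powr_half_sqrt)
    then show ?thesis by (simp add: algebra_simps)
  qed
  finally show ?thesis using flow_rate_integral[of \<tau> ?a] \<tau> s by simp
qed

text \<open>Continuity includes \<tau> = 0, where the rescaled density concentrates at the origin;
  this endpoint encodes the datum M delta_0.\<close>

lemma flow_continuous:
  assumes s: "s > 0"
  shows "continuous_on {0..t} (\<lambda>\<tau>. LINT z|lborel. U 1 z * V (t + s - \<tau>) (sqrt \<tau> *\<^sub>R z))"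
  unfolding continuous_on_sequentially
proof safe
  fix X \<tau> assume \<tau>: "\<tau> \<in> {0..t}" and X: "\<forall>n. X n \<in> {0..t}" "X \<longlonglongrightarrow> \<tau>"
  note [measurable] = U_measurable[of 1, simplified]
  let ?a = "t + s" and ?I = "LINT x|lborel. \<bar>\<psi> x\<bar>"
  show "((\<lambda>\<tau>. LINT z|lborel. U 1 z * V (?a - \<tau>) (sqrt \<tau> *\<^sub>R z)) \<circ> X) \<longlonglongrightarrow> (LINT z|lborel. U 1 z * V (?a - \<tau>) (sqrt \<tau> *\<^sub>R z))"
    unfolding o_def
  proof (rule integral_dominated_convergence[where w="\<lambda>z. U 1 z * (1 / s * ?I)"])
    show "integrable lborel (\<lambda>z. U 1 z * (1 / s * ?I))" using U_integrable[of 1] by simp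
    show "AE z in lborel. (\<lambda>n. U 1 z * V (?a - X n) (sqrt (X n) *\<^sub>R z)) \<longlonglongrightarrow> U 1 z * V (?a - \<tau>) (sqrt \<tau> *\<^sub>R z)"
    proof (intro AE_I2 tendsto_mult_left)
      fix z
      have "isCont (\<lambda>p. V (fst p) (snd p)) (?a - \<tau>, sqrt \<tau> *\<^sub>R z)"
        by (rule has_derivative_continuous[OF V_has_derivative]) (use \<tau> s in auto)
      moreover have "(\<lambda>n. (?a - X n, sqrt (X n) *\<^sub>R z)) \<longlonglongrightarrow> (?a - \<tau>, sqrt \<tau> *\<^sub>R z)"
        by (intro tendsto_intros X)
      ultimately show "(\<lambda>n. V (?a - X n) (sqrt (X n) *\<^sub>R z)) \<longlonglongrightarrow> V (?a - \<tau>) (sqrt \<tau> *\<^sub>R z)"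
        using isCont_tendsto_compose by fastforce
    qed
    show "AE z in lborel. norm (U 1 z * V (?a - X n) (sqrt (X n) *\<^sub>R z)) \<le> U 1 z * (1 / s * ?I)" for n
    proof (intro AE_I2)
      fix z
      have "\<bar>V (?a - X n) (sqrt (X n) *\<^sub>R z)\<bar> \<le> 1 / s * ?I"
        by (rule V_le[OF s]) (use X in \<open>auto\<close>)
      then show "norm (U 1 z * V (?a - X n) (sqrt (X n) *\<^sub>R z)) \<le> U 1 z * (1 / s * ?I)"
        using U_nonneg[of 1 z] unfolding norm_mult by (intro mult_mono) auto
    qed
  qed measurable
qed

text \<open>The fundamental theorem of calculus for the rescaled pairing \<open>g\<close>: it runs
  from the linear evolution of M delta_0 at \<tau> = 0 to the tested value of \<open>U t\<close> at
  \<tau> = t.\<close>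

lemma U_duhamel:
  assumes s: "s > 0" and t: "t > 0"
  defines "D \<equiv> \<lambda>\<tau>. distr_of (heat (t - \<tau>) (div_distr (debye_flux (U \<tau>)))) (V s)"
  shows "set_integrable lebesgue {0<..<t} D"
    "(LINT y|lborel. U t y * V s y) = M * (LINT y|lborel. heat_kernel t y * V s y) + (LINT \<tau>:{0<..<t}|lebesgue. D \<tau>)"
proof -
  let ?a = "t + s"
  define g where "g \<tau> = (LINT z|lborel. U 1 z * V (?a - \<tau>) (sqrt \<tau> *\<^sub>R z))" for \<tau>
  define f where "f \<tau> = (if \<tau> \<in> {0<..<t} then - flux_pairing ?a \<tau> else 0)" for \<tau>
  have D: "D \<tau> = - flux_pairing ?a \<tau>" if "\<tau> \<in> {0<..<t}" for \<tau>
  proof -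
    have eq: "t - \<tau> + s = ?a - \<tau>" by simp
    show ?thesis
      unfolding flux_pairing_def eq[symmetric]
      using heat_div_distr_pairing[of "t - \<tau>" s "debye_flux (U \<tau>)"] debye_flux_U_integrable[of \<tau>] that s
      by (simp add: D_def)
  qed
  have fi: "(f has_integral g t - g 0) {0..t}"
  proof (rule fundamental_theorem_of_calculus_interior)
    show "continuous_on {0..t} g" unfolding g_def by (rule flow_continuous[OF s])
    show "(g has_vector_derivative f \<tau>) (at \<tau>)" if "\<tau> \<in> {0<..<t}" for \<tau>
      using flow_has_derivative[OF s, of \<tau> t] that
      unfolding has_real_derivative_iff_has_vector_derivative[symmetric] g_def f_def by simp
  qed (use t in auto)
  \<comment> \<open>The fundamental theorem yields a gauge integral only; the majorant upgrades it
    to the Lebesgue integral of the mild formulation.\<close>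
  have fa: "f absolutely_integrable_on {0..t}"
  proof (rule absolutely_integrable_integrable_bound)
    let ?K1 = "1 / s\<^sup>2 * M" and ?K2 = "s powr (-3/2) * (LINT z|lborel. U 1 z * norm z)" and ?I = "LINT x|lborel. \<bar>\<psi> x\<bar>"
    have N: "(LINT z|lborel. U 1 z * norm z) \<ge> 0" using U_nonneg[of 1] by (intro Bochner_Integration.integral_nonneg) auto
    show "norm (f \<tau>) \<le> (?K1 + ?K2 * \<tau> powr (-1/2)) * ?I" if "\<tau> \<in> {0..t}" for \<tau>
    proof (cases "\<tau> \<in> {0<..<t}")
      case True
      then show ?thesis using flux_pairing_le[OF s, of \<tau> t] by (simp add: f_def)
    next
      case False
      have "0 \<le> (?K1 + ?K2 * \<tau> powr (-1/2)) * ?I" using N M_pos by (intro mult_nonneg_nonneg add_nonneg_nonneg) auto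
      then show ?thesis using False by (auto simp: f_def)
    qed
    show "f integrable_on {0..t}" using fi by blast
    have "(\<lambda>\<tau>. \<tau> powr (-1/2)) integrable_on {0..t}"
      using has_integral_powr_from_0[of "-1/2" t] t by auto
    then show "(\<lambda>\<tau>. (?K1 + ?K2 * \<tau> powr (-1/2)) * ?I) integrable_on {0..t}"
      by (intro integrable_on_mult_left integrable_add integrable_on_mult_right) auto
  qed
  have eq: "(\<lambda>\<tau>. indicator {0<..<t} \<tau> *\<^sub>R D \<tau>) = (\<lambda>\<tau>. indicator {0..t} \<tau> *\<^sub>R f \<tau>)"
    using D by (auto simp: f_def indicator_def)
  show "set_integrable lebesgue {0<..<t} D"
    using fa unfolding set_integrable_def eq .
  have "(LINT \<tau>:{0<..<t}|lebesgue. D \<tau>) = integral {0..t} f"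
    using set_lebesgue_integral_eq_integral(2)[OF fa] unfolding set_lebesgue_integral_def eq .
  also have "\<dots> = g t - g 0" using fi by (rule integral_unique)
  also have "g t = (LINT y|lborel. U t y * V s y)"
    using U_scale[OF t V_measurable] by (simp add: g_def)
  also have "g 0 = M * (LINT y|lborel. heat_kernel t y * V s y)"
  proof -
    \<comment> \<open>At \<tau> = 0 the test function is evaluated at the origin for every z, so the
      whole mass factors out.\<close>
    have "g 0 = M * V ?a 0" using U_integral[of 1] by (simp add: g_def)
    also have "V ?a 0 = heat t (distr_of (V s)) 0" using heat_V[OF t s] by simp
    also have "\<dots> = (LINT y|lborel. heat_kernel t y * V s y)"
      using heat_kernel_minus[of t 0] by (simp add: heat_distr_of mult.commute)
    finally show ?thesis .
  qed
  finally show "(LINT y|lborel. U t y * V s y) = M * (LINT y|lborel. heat_kernel t y * V s y) + (LINT \<tau>:{0<..<t}|lebesgue. D \<tau>)"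
    by simp
qed

end

section \<open>Stability and decay\<close>

lemma Lp_norm_le_imp_L43:
  assumes "Lp_norm (4/3) g \<le> ennreal A" "A \<ge> 0"
  shows "L43_bound g A" "integrable lborel (\<lambda>x. \<bar>g x\<bar> powr (4/3))" "g \<in> borel_measurable borel"
proof -
  let ?I = "LINT x|lborel. \<bar>g x\<bar> powr (4/3)"
  show m: "g \<in> borel_measurable borel" and i: "integrable lborel (\<lambda>x. \<bar>g x\<bar> powr (4/3))"
    using assms(1) by (auto simp: Lp_norm_def top_unique split: if_splits)
  then have "ennreal (?I powr (1 / (4/3))) \<le> ennreal A"
    using assms(1) by (simp add: Lp_norm_def)
  then have "?I powr (1 / (4/3)) \<le> A" using assms(2) by (simp add: ennreal_le_iff)
  then have "(?I powr (3/4)) powr (4/3) \<le> A powr (4/3)" by (intro powr_mono2) auto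
  moreover have "(?I powr (3/4)) powr (4/3) = ?I" by (simp add: powr_powr)
  ultimately show "L43_bound g A" using m i by (intro L43_boundI) auto
qed

lemma L43_imp_Lp_norm_le:
  assumes "L43_bound g A" "A \<ge> 0"
  shows "Lp_norm (4/3) g \<le> ennreal A"
proof -
  let ?I = "LINT x|lborel. \<bar>g x\<bar> powr (4/3)"
  have "?I powr (3/4) \<le> (A powr (4/3)) powr (3/4)"
    using L43_bound_integrable(2)[OF assms] by (intro powr_mono2) auto
  also have "\<dots> = A" using assms(2) by (simp add: powr_powr)
  finally show ?thesis
    using L43_bound_integrable(1)[OF assms(1)] assms(1) by (simp add: Lp_norm_def L43_bound_def ennreal_leI)
qed

lemma ennreal_mult_le_imp_le:
  assumes "ennreal c * X \<le> ennreal d" "c > 0" "d \<ge> 0"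
  shows "X \<le> ennreal (d / c)"
proof (cases X)
  case (real x)
  then have "c * x \<le> d" using assms by (simp add: ennreal_le_iff flip: ennreal_mult)
  then show ?thesis using real assms by (simp add: field_simps ennreal_leI)
next
  case top
  then show ?thesis using assms by (simp add: ennreal_mult_top top_unique)
qed

lemma L43_bound_mono:
  assumes "L43_bound f A" "0 \<le> A" "A \<le> B"
  shows "L43_bound f B"
  using assms powr_mono2[of "4/3" A B] unfolding L43_bound_def by (auto intro: order_trans ennreal_leI)

text \<open>The bound |f - g| <= 2 max |f| |g| replaces Minkowski's inequality; the crude factor 4
  affects only the starting value of the iteration.\<close>

lemma L43_bound_diff:
  assumes "L43_bound f A" "L43_bound g A" "A \<ge> 0"
  shows "L43_bound (\<lambda>x. f x - g x) (4 * A)"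
proof -
  have [measurable]: "f \<in> borel_measurable borel" "g \<in> borel_measurable borel"
    using assms by (auto simp: L43_bound_def)
  have "(\<integral>\<^sup>+x. ennreal (\<bar>f x - g x\<bar> powr (4/3)) \<partial>lborel)
     \<le> (\<integral>\<^sup>+x. ennreal (2 powr (4/3)) * (ennreal (\<bar>f x\<bar> powr (4/3)) + ennreal (\<bar>g x\<bar> powr (4/3))) \<partial>lborel)"
  proof (rule nn_integral_mono)
    fix x
    have "\<bar>f x - g x\<bar> powr (4/3) \<le> (2 * max \<bar>f x\<bar> \<bar>g x\<bar>) powr (4/3)"
      by (intro powr_mono2) auto
    also have "\<dots> = 2 powr (4/3) * max \<bar>f x\<bar> \<bar>g x\<bar> powr (4/3)" by (simp add: powr_mult)
    also have "\<dots> \<le> 2 powr (4/3) * (\<bar>f x\<bar> powr (4/3) + \<bar>g x\<bar> powr (4/3))"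
      by (intro mult_left_mono) (auto simp: max_def)
    finally show "ennreal (\<bar>f x - g x\<bar> powr (4/3)) \<le> ennreal (2 powr (4/3)) * (ennreal (\<bar>f x\<bar> powr (4/3)) + ennreal (\<bar>g x\<bar> powr (4/3)))"
      by (simp add: ennreal_leI flip: ennreal_mult ennreal_plus)
  qed
  also have "\<dots> = ennreal (2 powr (4/3)) * ((\<integral>\<^sup>+x. ennreal (\<bar>f x\<bar> powr (4/3)) \<partial>lborel) + (\<integral>\<^sup>+x. ennreal (\<bar>g x\<bar> powr (4/3)) \<partial>lborel))"
    by (simp add: nn_integral_cmult nn_integral_add)
  also have "\<dots> \<le> ennreal (2 powr (4/3)) * (ennreal (A powr (4/3)) + ennreal (A powr (4/3)))"
    using assms by (intro mult_left_mono add_mono) (auto simp: L43_bound_def)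
  also have "\<dots> = ennreal (2 powr (4/3) * (2 * A powr (4/3)))"
    by (simp flip: ennreal_mult ennreal_plus)
  also have "\<dots> \<le> ennreal ((4 * A) powr (4/3))"
  proof (rule ennreal_leI)
    have "(2::real) powr 1 \<le> 2 powr (4/3)" by (intro powr_mono) auto
    then have "2 powr (4/3) * (2 * A powr (4/3)) \<le> 2 powr (4/3) * (2 powr (4/3) * A powr (4/3))"
      by (intro mult_left_mono mult_right_mono) auto
    also have "\<dots> = (2 * (2 * A)) powr (4/3)" using assms(3) by (simp only: powr_mult)
    finally show "2 powr (4/3) * (2 * A powr (4/3)) \<le> (4 * A) powr (4/3)" by simp
  qed
  finally show ?thesis by (simp add: L43_bound_def)
qed

section \<open>The Debye flux in L^1\<close>

lemma AE_riesz_finite: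
  assumes f: "L43_bound f A" "A > 0"
  shows "AE x in lborel. integrable lborel (\<lambda>y. f y / norm (x - y))"
proof -
  have [measurable]: "f \<in> borel_measurable borel" using f by (auto simp: L43_bound_def)
  \<comment> \<open>A strictly positive Gaussian in L^(4/3): the Hardy-Littlewood-Sobolev inequality
    makes the potential integrable against it, and dividing by \<open>e x\<close> gives finiteness
    at almost every x.\<close>
  define e where "e x = exp (- 1 * (norm (x - 0))\<^sup>2)" for x :: plane
  have [measurable]: "e \<in> borel_measurable borel" unfolding e_def by measurable
  have "L43_bound e 27"
  proof -
    have "(\<integral>\<^sup>+x. ennreal (\<bar>e x\<bar> powr (4/3)) \<partial>lborel) = (\<integral>\<^sup>+x. ennreal (exp (- (4/3) * (norm (x - 0 :: plane))\<^sup>2)) \<partial>lborel)"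
      by (simp add: e_def exp_powr_real mult.commute)
    also have "\<dots> = ennreal (pi / (4/3))" by (rule nn_integral_gaussian) simp
    also have "\<dots> \<le> ennreal (27 powr (4/3))"
    proof (rule ennreal_leI)
      have "(27::real) powr 1 \<le> 27 powr (4/3)" by (intro powr_mono) auto
      then show "pi / (4/3) \<le> 27 powr (4/3)" using pi_less_4 by simp
    qed
    finally show ?thesis by (simp add: L43_bound_def)
  qed
  then have "hls_form e f \<le> ennreal ((3/4 + 3 * pi) * 27 * A)"
    using f by (intro hardy_littlewood_sobolev) auto
  then have "hls_form e f \<noteq> \<infinity>" by (auto simp: top_unique)
  then have "AE x in lborel. (\<integral>\<^sup>+y. ennreal (\<bar>e x\<bar> * \<bar>f y\<bar> / norm (x - y)) \<partial>lborel) \<noteq> \<infinity>"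
    unfolding hls_form_def by (intro nn_integral_PInf_AE) measurable
  then show ?thesis
  proof eventually_elim
    case (elim x)
    have "(\<integral>\<^sup>+y. ennreal (\<bar>f y\<bar> / norm (x - y)) \<partial>lborel)
       = (\<integral>\<^sup>+y. ennreal (1 / e x) * ennreal (\<bar>e x\<bar> * \<bar>f y\<bar> / norm (x - y)) \<partial>lborel)"
      by (intro nn_integral_cong) (simp add: e_def flip: ennreal_mult)
    also have "\<dots> = ennreal (1 / e x) * (\<integral>\<^sup>+y. ennreal (\<bar>e x\<bar> * \<bar>f y\<bar> / norm (x - y)) \<partial>lborel)"
      by (rule nn_integral_cmult) measurable
    also have "\<dots> < \<infinity>" using elim by (simp add: ennreal_mult_less_top less_top)
    finally show ?case by (intro integrableI_bounded) auto
  qed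
qed

lemma grad_potential_bound:
  assumes "integrable lborel (\<lambda>y. f y / norm (x - y))" and [measurable]: "f \<in> borel_measurable borel"
  shows "integrable lborel (\<lambda>y. (f y / (norm (x - y))\<^sup>2) *\<^sub>R (x - y))"
    "ennreal (norm (grad_potential f x)) \<le> ennreal (1 / (2 * pi)) * (\<integral>\<^sup>+y. ennreal (\<bar>f y\<bar> / norm (x - y)) \<partial>lborel)"
proof -
  have n: "norm ((f y / (norm (x - y))\<^sup>2) *\<^sub>R (x - y)) = \<bar>f y\<bar> / norm (x - y)" for y
    by (simp add: power2_eq_square)
  show i: "integrable lborel (\<lambda>y. (f y / (norm (x - y))\<^sup>2) *\<^sub>R (x - y))"
  proof (rule Bochner_Integration.integrable_bound[OF assms(1)])
    show "AE y in lborel. norm ((f y / (norm (x - y))\<^sup>2) *\<^sub>R (x - y)) \<le> norm (f y / norm (x - y))"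
      unfolding n by simp
  qed measurable
  have "norm (grad_potential f x) = 1 / (2 * pi) * norm (LINT y|lborel. (f y / (norm (x - y))\<^sup>2) *\<^sub>R (x - y))"
    by (simp add: grad_potential_def)
  then have "ennreal (norm (grad_potential f x)) = ennreal (1 / (2 * pi)) * ennreal (norm (LINT y|lborel. (f y / (norm (x - y))\<^sup>2) *\<^sub>R (x - y)))"
    by (simp only:) (rule ennreal_mult, auto)
  also have "\<dots> \<le> ennreal (1 / (2 * pi)) * (\<integral>\<^sup>+y. ennreal (\<bar>f y\<bar> / norm (x - y)) \<partial>lborel)"
    using integral_norm_bound_ennreal[OF i] unfolding n by (intro mult_left_mono) auto
  finally show "ennreal (norm (grad_potential f x)) \<le> ennreal (1 / (2 * pi)) * (\<integral>\<^sup>+y. ennreal (\<bar>f y\<bar> / norm (x - y)) \<partial>lborel)" .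
qed

text \<open>Combines the normalisation 1 / (2 pi) of the potential with the Hardy-Littlewood-Sobolev
  constant, so that the flux estimates carry the plain constant 2.\<close>

lemma hls_constant_le: "1 / (2 * pi) * (3/4 + 3 * pi) \<le> 2"
  using pi_ge_two by (simp add: field_simps)

lemma nn_integral_mult_grad_potential:
  assumes f: "L43_bound f A" "A > 0" and g: "L43_bound g B" "B > 0"
  shows "(\<integral>\<^sup>+x. ennreal (\<bar>f x\<bar> * norm (grad_potential g x)) \<partial>lborel) \<le> ennreal (2 * A * B)"
proof -
  have [measurable]: "f \<in> borel_measurable borel" "g \<in> borel_measurable borel"
    using f g by (auto simp: L43_bound_def)
  have "(\<integral>\<^sup>+x. ennreal (\<bar>f x\<bar> * norm (grad_potential g x)) \<partial>lborel)
     \<le> (\<integral>\<^sup>+x. ennreal (1 / (2 * pi)) * (\<integral>\<^sup>+y. ennreal (\<bar>f x\<bar> * \<bar>g y\<bar> / norm (x - y)) \<partial>lborel) \<partial>lborel)"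
  proof (rule nn_integral_mono_AE)
    show "AE x in lborel. ennreal (\<bar>f x\<bar> * norm (grad_potential g x))
        \<le> ennreal (1 / (2 * pi)) * (\<integral>\<^sup>+y. ennreal (\<bar>f x\<bar> * \<bar>g y\<bar> / norm (x - y)) \<partial>lborel)"
      using AE_riesz_finite[OF g]
    proof eventually_elim
      case (elim x)
      have "ennreal (\<bar>f x\<bar> * norm (grad_potential g x)) = ennreal \<bar>f x\<bar> * ennreal (norm (grad_potential g x))"
        by (simp add: ennreal_mult)
      also have "\<dots> \<le> ennreal \<bar>f x\<bar> * (ennreal (1 / (2 * pi)) * (\<integral>\<^sup>+y. ennreal (\<bar>g y\<bar> / norm (x - y)) \<partial>lborel))"
        using grad_potential_bound(2)[OF elim] by (intro mult_left_mono) auto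
      also have "\<dots> = ennreal (1 / (2 * pi)) * (ennreal \<bar>f x\<bar> * (\<integral>\<^sup>+y. ennreal (\<bar>g y\<bar> / norm (x - y)) \<partial>lborel))"
        by (simp add: mult_ac)
      also have "ennreal \<bar>f x\<bar> * (\<integral>\<^sup>+y. ennreal (\<bar>g y\<bar> / norm (x - y)) \<partial>lborel) = (\<integral>\<^sup>+y. ennreal \<bar>f x\<bar> * ennreal (\<bar>g y\<bar> / norm (x - y)) \<partial>lborel)"
        by (rule nn_integral_cmult[symmetric]) measurable
      also have "\<dots> = (\<integral>\<^sup>+y. ennreal (\<bar>f x\<bar> * \<bar>g y\<bar> / norm (x - y)) \<partial>lborel)"
        by (intro nn_integral_cong) (simp flip: ennreal_mult)
      finally show ?case .
    qed
  qed
  also have "\<dots> = ennreal (1 / (2 * pi)) * hls_form f g"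
    unfolding hls_form_def by (rule nn_integral_cmult) measurable
  also have "\<dots> \<le> ennreal (1 / (2 * pi)) * ennreal ((3/4 + 3 * pi) * A * B)"
    using f g by (intro mult_left_mono hardy_littlewood_sobolev) auto
  also have "\<dots> = ennreal (1 / (2 * pi) * (3/4 + 3 * pi) * (A * B))"
    using f g by (subst ennreal_mult[symmetric]) (auto simp: mult_ac)
  also have "\<dots> \<le> ennreal (2 * (A * B))"
    using f g hls_constant_le by (intro ennreal_leI mult_right_mono) auto
  finally show ?thesis by (simp add: mult.assoc)
qed

lemma debye_flux_integrable:
  assumes f: "L43_bound f A" "A > 0"
  shows "integrable lborel (debye_flux f)"
proof (rule integrableI_bounded)
  have "f \<in> borel_measurable borel" using f by (auto simp: L43_bound_def)
  then show "debye_flux f \<in> borel_measurable lborel" using grad_potential_measurable by simp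
  have "(\<integral>\<^sup>+x. ennreal (norm (debye_flux f x)) \<partial>lborel) \<le> ennreal (2 * A * A)"
    using nn_integral_mult_grad_potential[OF f f] by (simp add: debye_flux_def)
  then show "(\<integral>\<^sup>+x. ennreal (norm (debye_flux f x)) \<partial>lborel) < \<infinity>" by (auto intro: le_less_trans)
qed

text \<open>Bilinearity writes the difference with one factor w = f - g in each term: w times the
  field of \<open>f\<close>, plus \<open>g\<close> times the field of w.\<close>

lemma debye_flux_diff:
  assumes f: "L43_bound f A" "A > 0" and g: "L43_bound g B" "B > 0" and w: "L43_bound (\<lambda>x. f x - g x) W" "W > 0"
  shows "(LINT x|lborel. norm (debye_flux f x - debye_flux g x)) \<le> 2 * (A + B) * W"
proof -
  let ?w = "\<lambda>x. f x - g x"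
  have [measurable]: "f \<in> borel_measurable borel" "g \<in> borel_measurable borel"
    using f g by (auto simp: L43_bound_def)
  note [measurable] = grad_potential_measurable
  have "(\<integral>\<^sup>+x. ennreal (norm (debye_flux f x - debye_flux g x)) \<partial>lborel)
     \<le> (\<integral>\<^sup>+x. ennreal (\<bar>?w x\<bar> * norm (grad_potential f x)) + ennreal (\<bar>g x\<bar> * norm (grad_potential ?w x)) \<partial>lborel)"
  proof (rule nn_integral_mono_AE)
    show "AE x in lborel. ennreal (norm (debye_flux f x - debye_flux g x))
      \<le> ennreal (\<bar>?w x\<bar> * norm (grad_potential f x)) + ennreal (\<bar>g x\<bar> * norm (grad_potential ?w x))"
      \<comment> \<open>Linearity of the potential uses the convergence of both singular integrals,
        which is available almost everywhere.\<close>
      using AE_riesz_finite[OF f] AE_riesz_finite[OF g]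
    proof eventually_elim
      case (elim x)
      have gw: "grad_potential ?w x = grad_potential f x - grad_potential g x"
      proof -
        have "(LINT y|lborel. (?w y / (norm (x - y))\<^sup>2) *\<^sub>R (x - y))
           = (LINT y|lborel. (f y / (norm (x - y))\<^sup>2) *\<^sub>R (x - y)) - (LINT y|lborel. (g y / (norm (x - y))\<^sup>2) *\<^sub>R (x - y))"
          unfolding diff_divide_distrib scaleR_diff_left
          using grad_potential_bound(1)[OF elim(1)] grad_potential_bound(1)[OF elim(2)]
          by (intro Bochner_Integration.integral_diff) auto
        then show ?thesis unfolding grad_potential_def by (simp add: scaleR_diff_right)
      qed
      have "debye_flux f x - debye_flux g x = ?w x *\<^sub>R grad_potential f x + g x *\<^sub>R grad_potential ?w x"
        unfolding debye_flux_def gw by (simp add: scaleR_diff_left scaleR_diff_right)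
      then have "norm (debye_flux f x - debye_flux g x) \<le> \<bar>?w x\<bar> * norm (grad_potential f x) + \<bar>g x\<bar> * norm (grad_potential ?w x)"
        using norm_triangle_ineq[of "?w x *\<^sub>R grad_potential f x" "g x *\<^sub>R grad_potential ?w x"] by simp
      then show ?case by (simp add: ennreal_leI flip: ennreal_plus)
    qed
  qed
  also have "\<dots> = (\<integral>\<^sup>+x. ennreal (\<bar>?w x\<bar> * norm (grad_potential f x)) \<partial>lborel) + (\<integral>\<^sup>+x. ennreal (\<bar>g x\<bar> * norm (grad_potential ?w x)) \<partial>lborel)"
    by (rule nn_integral_add) measurable
  also have "\<dots> \<le> ennreal (2 * W * A) + ennreal (2 * B * W)"
    by (intro add_mono nn_integral_mult_grad_potential f g w)
  also have "\<dots> = ennreal (2 * (A + B) * W)"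
    using f g w by (subst ennreal_plus[symmetric]) (auto simp: algebra_simps)
  finally have "(\<integral>\<^sup>+x. ennreal (norm (debye_flux f x - debye_flux g x)) \<partial>lborel) \<le> ennreal (2 * (A + B) * W)" .
  moreover have "integrable lborel (\<lambda>x. norm (debye_flux f x - debye_flux g x))"
    using debye_flux_integrable[OF f] debye_flux_integrable[OF g] by (intro integrable_norm Bochner_Integration.integrable_diff)
  ultimately show ?thesis
    using f g w by (simp add: nn_integral_eq_integral ennreal_le_iff)
qed

lemma integrable_vec_nth: "integrable M F \<Longrightarrow> integrable M (\<lambda>x. (F x :: plane) $ i)"
  by (rule Bochner_Integration.integrable_bound[of M F]) (auto simp: component_le_norm_cart)

section \<open>Large-time asymptotics of the linear flow\<close>

definition heat_shift :: "real \<Rightarrow> plane \<Rightarrow> plane \<Rightarrow> real" where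
  "heat_shift t y z = heat_kernel t (z - y) - heat_kernel t z"

text \<open>The 1 added to |y| keeps the weight positive at y = 0, since \<open>holder_heat\<close>
  asks for a strictly positive bound.\<close>

definition shift_weight :: "real \<Rightarrow> plane \<Rightarrow> real" where
  "shift_weight t y = min 1 ((norm y + 1) / sqrt t)"

lemma shift_weight_pos: "t > 0 \<Longrightarrow> shift_weight t y > 0"
  by (auto simp: shift_weight_def add_nonneg_pos)

text \<open>Two competing bounds: the sup of the kernel, valid for all y, and the mean value
  inequality with gradient bound t^(-3/2), which makes the weight small for fixed y and large
  t.\<close>

lemma abs_heat_shift_le:
  assumes t: "t > 0"
  shows "\<bar>heat_shift t y z\<bar> \<le> shift_weight t y / t"
proof -
  have "\<bar>heat_shift t y z\<bar> \<le> 1 / t"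
  proof -
    have "1 / (4 * pi * t) \<le> 1 / t" using t pi_ge_two by (intro divide_left_mono) auto
    moreover have "0 \<le> heat_kernel t z" "0 \<le> heat_kernel t (z - y)" using t by auto
    ultimately show ?thesis
      using heat_kernel_le[OF t, of z] heat_kernel_le[OF t, of "z - y"] unfolding heat_shift_def by linarith
  qed
  moreover have "\<bar>heat_shift t y z\<bar> \<le> (norm y + 1) / sqrt t / t"
  proof -
    have "norm (heat_kernel t (z - y) - heat_kernel t z) \<le> t powr (-3/2) * norm (z - y - z)"
    proof (rule differentiable_bound[where S=UNIV])
      fix x :: plane
      show "(heat_kernel t has_derivative (\<lambda>h. heat_kernel t x * (- (x \<bullet> h) / (2 * t)))) (at x within UNIV)"
        using heat_kernel_has_derivative[OF t] by simp
      show "onorm (\<lambda>h. heat_kernel t x * (- (x \<bullet> h) / (2 * t))) \<le> t powr (-3/2)"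
      proof (rule onorm_bound)
        fix h :: plane
        have "norm (heat_kernel t x * (- (x \<bullet> h) / (2 * t))) = heat_kernel t x / (2 * t) * \<bar>x \<bullet> h\<bar>"
          using t by (simp add: abs_mult)
        also have "\<dots> \<le> heat_kernel t x / (2 * t) * (norm x * norm h)"
          using t by (intro mult_left_mono Cauchy_Schwarz_ineq2) auto
        also have "\<dots> = grad_heat_norm t x * norm h" by (simp add: grad_heat_norm_def)
        also have "\<dots> \<le> t powr (-3/2) * norm h"
          by (intro mult_right_mono grad_heat_norm_le_const t) auto
        finally show "norm (heat_kernel t x * (- (x \<bullet> h) / (2 * t))) \<le> t powr (-3/2) * norm h" .
      qed simp
    qed auto
    also have "\<dots> \<le> t powr (-3/2) * (norm y + 1)" by (intro mult_left_mono) auto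
    also have "t powr (-3/2) = 1 / sqrt t / t"
    proof -
      have "t powr (-3/2) = t powr (-1/2) * t powr (-1)" unfolding powr_add[symmetric] by simp
      also have "\<dots> = 1 / sqrt t / t"
        using t powr_minus_divide[of t "1/2"] powr_minus_divide[of t 1] by (simp add: powr_half_sqrt)
      finally show ?thesis .
    qed
    finally show ?thesis by (simp add: heat_shift_def)
  qed
  ultimately show ?thesis using t by (simp add: shift_weight_def min_def)
qed

text \<open>Interpolates between the sup bound of \<open>abs_heat_shift_le\<close> and the total
  mass 2 of the two kernels.\<close>

lemma L43_heat_shift:
  assumes t: "t > 0"
  shows "L43_bound (heat_shift t y) (2 * (shift_weight t y / t) powr (1/4))"
proof -
  let ?m = "shift_weight t y / t"
  have [measurable]: "heat_shift t y \<in> borel_measurable borel"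
    unfolding heat_shift_def[abs_def] by measurable
  have m: "?m > 0" using t shift_weight_pos by simp
  have "(\<integral>\<^sup>+z. ennreal (\<bar>heat_shift t y z\<bar> powr (4/3)) \<partial>lborel)
     \<le> (\<integral>\<^sup>+z. ennreal (?m powr (1/3)) * (ennreal (heat_kernel t (z - y)) + ennreal (heat_kernel t (z - 0))) \<partial>lborel)"
  proof (rule nn_integral_mono)
    fix z
    have "\<bar>heat_shift t y z\<bar> powr (4/3) = \<bar>heat_shift t y z\<bar> powr (1/3) * \<bar>heat_shift t y z\<bar>"
      using powr_mult_base[of "\<bar>heat_shift t y z\<bar>" "1/3"] by (simp add: mult.commute)
    also have "\<dots> \<le> ?m powr (1/3) * (heat_kernel t (z - y) + heat_kernel t (z - 0))"
    proof (intro mult_mono powr_mono2)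
      show "\<bar>heat_shift t y z\<bar> \<le> heat_kernel t (z - y) + heat_kernel t (z - 0)"
        using heat_kernel_nonneg[OF t, of z] heat_kernel_nonneg[OF t, of "z - y"] by (simp add: heat_shift_def)
    qed (use abs_heat_shift_le[OF t] in auto)
    finally show "ennreal (\<bar>heat_shift t y z\<bar> powr (4/3)) \<le> ennreal (?m powr (1/3)) * (ennreal (heat_kernel t (z - y)) + ennreal (heat_kernel t (z - 0)))"
      using t by (simp add: ennreal_leI flip: ennreal_mult ennreal_plus)
  qed
  also have "\<dots> = ennreal (?m powr (1/3)) * (\<integral>\<^sup>+z. ennreal (heat_kernel t (z - y)) + ennreal (heat_kernel t (z - 0)) \<partial>lborel)"
    by (rule nn_integral_cmult) measurable
  also have "(\<integral>\<^sup>+z. ennreal (heat_kernel t (z - y)) + ennreal (heat_kernel t (z - 0)) \<partial>lborel) = 1 + 1"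
    by (subst nn_integral_add, measurable, simp only: nn_integral_heat_kernel[OF t])
  also have "ennreal (?m powr (1/3)) * (1 + 1) = ennreal (2 * ?m powr (1/3))"
    by (simp add: ennreal_mult mult.commute)
  also have "\<dots> \<le> ennreal ((2 * ?m powr (1/4)) powr (4/3))"
  proof (rule ennreal_leI)
    have "(2::real) powr 1 \<le> 2 powr (4/3)" by (intro powr_mono) auto
    then have "2 * ?m powr (1/3) \<le> 2 powr (4/3) * ?m powr (1/3)" by (intro mult_right_mono) auto
    also have "\<dots> = (2 * ?m powr (1/4)) powr (4/3)" by (simp add: powr_mult powr_powr)
    finally show "2 * ?m powr (1/3) \<le> (2 * ?m powr (1/4)) powr (4/3)" .
  qed
  finally show ?thesis by (simp add: L43_bound_def)
qed

text \<open>In tested form, a majorant of t^(1/4) times the L^(4/3) norm of S(t) u0 - M G_t.\<close>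

definition heat_defect :: "(plane \<Rightarrow> real) \<Rightarrow> real \<Rightarrow> real" where
  "heat_defect u0 t = (LINT y|lborel. \<bar>u0 y\<bar> * (2 * shift_weight t y powr (1/4)))"

lemma heat_defect_integrable:
  assumes u0: "integrable lborel u0" and t: "t > 0"
  shows "integrable lborel (\<lambda>y. \<bar>u0 y\<bar> * (2 * shift_weight t y powr (1/4)))"
proof (rule Bochner_Integration.integrable_bound)
  have [measurable]: "u0 \<in> borel_measurable borel" using u0 by auto
  have [measurable]: "shift_weight t \<in> borel_measurable borel" unfolding shift_weight_def[abs_def] by measurable
  show "integrable lborel (\<lambda>y. u0 y * 2)" using u0 by simp
  show "(\<lambda>y. \<bar>u0 y\<bar> * (2 * shift_weight t y powr (1/4))) \<in> borel_measurable lborel" by measurable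
  show "AE y in lborel. norm (\<bar>u0 y\<bar> * (2 * shift_weight t y powr (1/4))) \<le> norm (u0 y * 2)"
  proof (intro AE_I2)
    fix y
    have "shift_weight t y powr (1/4) \<le> 1 powr (1/4)"
      using shift_weight_pos[OF t, of y] by (intro powr_mono2) (auto simp: shift_weight_def)
    then show "norm (\<bar>u0 y\<bar> * (2 * shift_weight t y powr (1/4))) \<le> norm (u0 y * 2)"
      by (auto simp: abs_mult intro!: mult_left_le)
  qed
qed

lemma heat_defect_nonneg: "heat_defect u0 t \<ge> 0"
  unfolding heat_defect_def by (intro Bochner_Integration.integral_nonneg) auto

text \<open>For fixed y the weight tends to 0 and it never exceeds 1, so dominated convergence
  applies with majorant 2 |u0|, and no moment of \<open>u0\<close> enters.\<close>

lemma heat_defect_tendsto: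
  assumes u0: "integrable lborel u0"
  shows "(heat_defect u0 \<longlongrightarrow> 0) at_top"
proof -
  have [measurable]: "u0 \<in> borel_measurable borel" using u0 by auto
  have "((\<lambda>t. LINT y|lborel. \<bar>u0 y\<bar> * (2 * shift_weight t y powr (1/4))) \<longlongrightarrow> (LINT y|(lborel :: plane measure). 0)) at_top"
  proof (rule integral_dominated_convergence_at_top[where w="\<lambda>y. \<bar>u0 y\<bar> * 2"])
    show "integrable lborel (\<lambda>y. \<bar>u0 y\<bar> * 2)" using u0 by simp
    have [measurable]: "shift_weight t \<in> borel_measurable borel" for t unfolding shift_weight_def[abs_def] by measurable
    show "(\<lambda>y. \<bar>u0 y\<bar> * (2 * shift_weight t y powr (1/4))) \<in> borel_measurable lborel" for t by measurable
    show "\<forall>\<^sub>F t in at_top. AE y in lborel. norm (\<bar>u0 y\<bar> * (2 * shift_weight t y powr (1/4))) \<le> \<bar>u0 y\<bar> * 2"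
      using eventually_gt_at_top[of 0]
    proof eventually_elim
      case (elim t)
      have "shift_weight t y powr (1/4) \<le> 1 powr (1/4)" for y
        using shift_weight_pos[OF elim, of y] by (intro powr_mono2) (auto simp: shift_weight_def)
      then show ?case by (intro AE_I2) (auto simp: abs_mult intro!: mult_left_le)
    qed
    show "AE y in lborel. ((\<lambda>t. \<bar>u0 y\<bar> * (2 * shift_weight t y powr (1/4))) \<longlongrightarrow> 0) at_top"
    proof (intro AE_I2)
      fix y :: plane
      define c where "c = norm y + 1"
      have c: "c > 0" by (simp add: c_def add_nonneg_pos)
      have "((\<lambda>t. min 1 (c / sqrt t) powr (1/4)) \<longlongrightarrow> 0) at_top" using c by real_asymp
      then have "((\<lambda>t. \<bar>u0 y\<bar> * (2 * (min 1 (c / sqrt t) powr (1/4)))) \<longlongrightarrow> \<bar>u0 y\<bar> * (2 * 0)) at_top"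
        by (intro tendsto_intros)
      then show "((\<lambda>t. \<bar>u0 y\<bar> * (2 * shift_weight t y powr (1/4))) \<longlongrightarrow> 0) at_top"
        by (simp add: shift_weight_def c_def)
    qed
  qed simp
  then show ?thesis by (simp add: heat_defect_def[abs_def])
qed

text \<open>M G_t(z) is the integral of u0(y) G_t(z) over y, so the difference is a superposition of
  the shifts \<open>heat_shift t y\<close> with weights u0(y), each of them controlled by
  \<open>holder_heat\<close>.\<close>

lemma heat_asymptotics:
  assumes u0: "integrable lborel u0" and M: "(LINT x|lborel. u0 x) = M" and t: "t > 0"
    and [measurable]: "\<psi> \<in> borel_measurable borel" and s: "s > 0" and B: "B > 0" "(\<integral>\<^sup>+x. ennreal (\<psi> x ^ 4) \<partial>lborel) \<le> ennreal (B ^ 4)"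
  shows "(\<integral>\<^sup>+z. ennreal (\<bar>heat t (distr_of u0) z - M * heat_kernel t z\<bar> * \<bar>heat s (distr_of \<psi>) z\<bar>) \<partial>lborel)
    \<le> ennreal (heat_defect u0 t * t powr (-1/4) * B)"
proof -
  have [measurable]: "u0 \<in> borel_measurable borel" using u0 by auto
  have [measurable]: "heat_shift t y \<in> borel_measurable borel" for y
    unfolding heat_shift_def[abs_def] by measurable
  let ?\<phi> = "heat s (distr_of \<psi>)"
  have i1: "integrable lborel (\<lambda>y. u0 y * heat_kernel t (z - y))" for z
  proof (rule Bochner_Integration.integrable_bound)
    show "integrable lborel (\<lambda>y. u0 y * (1 / (4 * pi * t)))" using u0 by simp
    show "AE y in lborel. norm (u0 y * heat_kernel t (z - y)) \<le> norm (u0 y * (1 / (4 * pi * t)))"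
    proof (intro AE_I2)
      fix y
      have "\<bar>u0 y\<bar> * heat_kernel t (z - y) \<le> \<bar>u0 y\<bar> * (1 / (4 * pi * t))"
        by (intro mult_left_mono heat_kernel_le t) auto
      then show "norm (u0 y * heat_kernel t (z - y)) \<le> norm (u0 y * (1 / (4 * pi * t)))"
        using t by (simp add: abs_mult)
    qed
  qed measurable
  have eq: "heat t (distr_of u0) z - M * heat_kernel t z = (LINT y|lborel. u0 y * heat_shift t y z)" for z
  proof -
    have "(LINT y|lborel. u0 y * heat_shift t y z) = (LINT y|lborel. u0 y * heat_kernel t (z - y) - u0 y * heat_kernel t z)"
      by (simp add: heat_shift_def right_diff_distrib)
    also have "\<dots> = (LINT y|lborel. u0 y * heat_kernel t (z - y)) - (LINT y|lborel. u0 y * heat_kernel t z)"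
      using i1 u0 by (intro Bochner_Integration.integral_diff) auto
    finally show ?thesis by (simp add: heat_distr_of M)
  qed
  have "(\<integral>\<^sup>+z. ennreal (\<bar>heat t (distr_of u0) z - M * heat_kernel t z\<bar> * \<bar>?\<phi> z\<bar>) \<partial>lborel)
     \<le> (\<integral>\<^sup>+z. \<integral>\<^sup>+y. ennreal \<bar>u0 y\<bar> * ennreal (\<bar>heat_shift t y z\<bar> * \<bar>?\<phi> z\<bar>) \<partial>lborel \<partial>lborel)"
  proof (rule nn_integral_mono)
    fix z
    have i2: "integrable lborel (\<lambda>y. u0 y * heat_shift t y z)"
      using i1 u0 by (simp add: heat_shift_def right_diff_distrib)
    have "ennreal (\<bar>heat t (distr_of u0) z - M * heat_kernel t z\<bar> * \<bar>?\<phi> z\<bar>)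
       = ennreal (norm (LINT y|lborel. u0 y * heat_shift t y z)) * ennreal \<bar>?\<phi> z\<bar>"
      unfolding eq by (simp add: ennreal_mult)
    also have "\<dots> \<le> (\<integral>\<^sup>+y. ennreal (norm (u0 y * heat_shift t y z)) \<partial>lborel) * ennreal \<bar>?\<phi> z\<bar>"
      by (intro mult_right_mono integral_norm_bound_ennreal i2) auto
    also have "\<dots> = (\<integral>\<^sup>+y. ennreal (norm (u0 y * heat_shift t y z)) * ennreal \<bar>?\<phi> z\<bar> \<partial>lborel)"
      by (rule nn_integral_multc[symmetric]) (simp add: heat_shift_def)
    also have "\<dots> = (\<integral>\<^sup>+y. ennreal \<bar>u0 y\<bar> * ennreal (\<bar>heat_shift t y z\<bar> * \<bar>?\<phi> z\<bar>) \<partial>lborel)"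
      by (intro nn_integral_cong) (simp add: abs_mult ennreal_mult mult.assoc)
    finally show "ennreal (\<bar>heat t (distr_of u0) z - M * heat_kernel t z\<bar> * \<bar>?\<phi> z\<bar>)
       \<le> (\<integral>\<^sup>+y. ennreal \<bar>u0 y\<bar> * ennreal (\<bar>heat_shift t y z\<bar> * \<bar>?\<phi> z\<bar>) \<partial>lborel)" .
  qed
  also have "\<dots> = (\<integral>\<^sup>+y. \<integral>\<^sup>+z. ennreal \<bar>u0 y\<bar> * ennreal (\<bar>heat_shift t y z\<bar> * \<bar>?\<phi> z\<bar>) \<partial>lborel \<partial>lborel)"
    by (rule lborel_pair.Fubini') (unfold heat_shift_def, measurable)
  also have "\<dots> \<le> (\<integral>\<^sup>+y. ennreal (\<bar>u0 y\<bar> * (2 * shift_weight t y powr (1/4)) * (t powr (-1/4) * B)) \<partial>lborel)"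
  proof (rule nn_integral_mono)
    fix y
    have "(\<integral>\<^sup>+z. ennreal \<bar>u0 y\<bar> * ennreal (\<bar>heat_shift t y z\<bar> * \<bar>?\<phi> z\<bar>) \<partial>lborel)
      = ennreal \<bar>u0 y\<bar> * (\<integral>\<^sup>+z. ennreal (\<bar>heat_shift t y z\<bar> * \<bar>?\<phi> z\<bar>) \<partial>lborel)"
      by (rule nn_integral_cmult) measurable
    also have "\<dots> \<le> ennreal \<bar>u0 y\<bar> * ennreal (2 * (shift_weight t y / t) powr (1/4) * B)"
      using shift_weight_pos[OF t, of y] t
      by (intro mult_left_mono holder_heat[OF L43_heat_shift[OF t]] B s) auto
    also have "\<dots> = ennreal (\<bar>u0 y\<bar> * (2 * (shift_weight t y / t) powr (1/4) * B))"
      using B by (intro ennreal_mult[symmetric]) auto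
    also have "(shift_weight t y / t) powr (1/4) = shift_weight t y powr (1/4) * t powr (-1/4)"
      using t shift_weight_pos[OF t, of y] powr_minus_divide[of t "1/4"] by (simp add: powr_divide)
    finally show "(\<integral>\<^sup>+z. ennreal \<bar>u0 y\<bar> * ennreal (\<bar>heat_shift t y z\<bar> * \<bar>?\<phi> z\<bar>) \<partial>lborel)
       \<le> ennreal (\<bar>u0 y\<bar> * (2 * shift_weight t y powr (1/4)) * (t powr (-1/4) * B))"
      by (simp add: mult_ac)
  qed
  also have "\<dots> = ennreal (LINT y|lborel. \<bar>u0 y\<bar> * (2 * shift_weight t y powr (1/4)) * (t powr (-1/4) * B))"
    using B by (intro nn_integral_eq_integral integrable_mult_left heat_defect_integrable[OF u0 t]) auto
  also have "\<dots> = ennreal (heat_defect u0 t * t powr (-1/4) * B)"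
    unfolding integral_mult_left_zero heat_defect_def by (simp add: mult.assoc)
  finally show ?thesis .
qed

text \<open>Testing against \<open>G\<^sub>t = S(t/2) G\<^bsub>t/2\<^esub>\<close>.\<close>

lemma mass_le:
  assumes u0: "integrable lborel u0" and M: "(LINT x|lborel. u0 x) = M" "M > 0"
    and \<epsilon>: "\<epsilon> > 0" "\<And>t. t > 0 \<Longrightarrow> L43_bound (heat t (distr_of u0)) (\<epsilon> * t powr (-1/4))"
  shows "M \<le> 8 * \<epsilon>"
proof (rule tendsto_lowerbound)
  show "((\<lambda>t. 8 * (\<epsilon> + heat_defect u0 t)) \<longlongrightarrow> 8 * \<epsilon>) at_top"
    using heat_defect_tendsto[OF u0] by (auto intro!: tendsto_eq_intros)
  show "\<forall>\<^sub>F t in at_top. M \<le> 8 * (\<epsilon> + heat_defect u0 t)"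
    using eventually_gt_at_top[of 0]
  proof eventually_elim
    case (elim t)
    then have t: "t > 0" "t / 2 > 0" by auto
    have [measurable]: "u0 \<in> borel_measurable borel" using u0 by auto
    define \<psi> where "\<psi> = heat_kernel (t / 2)"
    have [measurable]: "\<psi> \<in> borel_measurable borel" by (simp add: \<psi>_def)
    have \<phi>: "heat (t / 2) (distr_of \<psi>) = heat_kernel t"
    proof
      fix x
      show "heat (t / 2) (distr_of \<psi>) x = heat_kernel t x"
        using heat_kernel_semigroup[OF t(2) t(2), of x 0] by (simp add: heat_distr_of \<psi>_def mult.commute)
    qed
    \<comment> \<open>An upper bound for the L^4 norm of G_(t/2): the exact fourth power has an
      additional factor pi / 32, which is dropped.\<close>
    define B where "B = t powr (-3/4) / pi"
    have B: "B > 0" using t by (simp add: B_def)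
    have \<psi>4: "(\<integral>\<^sup>+x. ennreal (\<psi> x ^ 4) \<partial>lborel) \<le> ennreal (B ^ 4)"
    proof -
      have "\<psi> x ^ 4 = 1 / (2 * pi * t) ^ 4 * exp (- (2 / t) * (norm (x - 0))\<^sup>2)" for x
        using t by (simp add: \<psi>_def heat_kernel_def power_divide power_mult_distrib flip: exp_of_nat_mult)
      then have "(\<integral>\<^sup>+x. ennreal (\<psi> x ^ 4) \<partial>lborel) = (\<integral>\<^sup>+x. ennreal (1 / (2 * pi * t) ^ 4) * ennreal (exp (- (2 / t) * (norm (x - 0 :: plane))\<^sup>2)) \<partial>lborel)"
        using t by (intro nn_integral_cong) (simp flip: ennreal_mult)
      also have "\<dots> = ennreal (1 / (2 * pi * t) ^ 4) * ennreal (pi / (2 / t))"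
        using t nn_integral_gaussian[of "2 / t" 0] by (subst nn_integral_cmult) auto
      also have "\<dots> = ennreal (1 / (2 * pi * t) ^ 4 * (pi / (2 / t)))"
        using t by (intro ennreal_mult[symmetric]) auto
      also have "\<dots> \<le> ennreal (B ^ 4)"
      proof (rule ennreal_leI)
        have "(t powr (-3/4)) ^ 4 = t powr (-3)" using t by (simp add: powr_powr flip: powr_numeral)
        also have "\<dots> = 1 / t ^ 3" using t powr_minus_divide[of t 3] by (simp add: powr_numeral)
        finally have "B ^ 4 = 1 / t ^ 3 / pi ^ 4" by (simp add: B_def power_divide)
        moreover have "1 / (2 * pi * t) ^ 4 * (pi / (2 / t)) = pi / 32 * (1 / t ^ 3 / pi ^ 4)"
          using t by (simp add: power_mult_distrib field_simps eval_nat_numeral)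
        moreover have "pi / 32 * (1 / t ^ 3 / pi ^ 4) \<le> 1 * (1 / t ^ 3 / pi ^ 4)"
          using t pi_less_4 by (intro mult_right_mono) auto
        ultimately show "1 / (2 * pi * t) ^ 4 * (pi / (2 / t)) \<le> B ^ 4" by simp
      qed
      finally show ?thesis .
    qed
    have neg: "heat_kernel t (- x) = heat_kernel t x" for x by (simp add: heat_kernel_def)
    \<comment> \<open>By evenness and the semigroup law this is G_(2t)(0). Compared with t^(-1/4) B
      = 1 / (pi t), it leaves the factor 8 of the claim.\<close>
    have GG: "(\<integral>\<^sup>+z. ennreal (heat_kernel t z * heat_kernel t z) \<partial>lborel) = ennreal (1 / (8 * pi * t))"
    proof -
      have "integrable lborel (\<lambda>z. heat_kernel t z * heat_kernel t z)"
        using integrable_mult_heat_kernel[of "heat_kernel t" "1 / (4 * pi * t)" t 0] heat_kernel_le[OF t(1)] t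
        by (simp add: neg)
      then have "(\<integral>\<^sup>+z. ennreal (heat_kernel t z * heat_kernel t z) \<partial>lborel) = ennreal (LINT z|lborel. heat_kernel t z * heat_kernel t z)"
        using t by (intro nn_integral_eq_integral) auto
      also have "(LINT z|lborel. heat_kernel t z * heat_kernel t z) = heat_kernel (t + t) (0 - 0)"
        using heat_kernel_semigroup[OF t(1) t(1), of 0 0] by (simp add: neg)
      also have "heat_kernel (t + t) (0 - 0) = 1 / (8 * pi * t)" by (simp add: heat_kernel_def)
      finally show ?thesis .
    qed
    let ?h = "heat t (distr_of u0)"
    have "ennreal (M / (8 * pi * t)) = ennreal M * (\<integral>\<^sup>+z. ennreal (heat_kernel t z * heat_kernel t z) \<partial>lborel)"
      unfolding GG using M t by (simp flip: ennreal_mult)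
    also have "\<dots> = (\<integral>\<^sup>+z. ennreal M * ennreal (heat_kernel t z * heat_kernel t z) \<partial>lborel)"
      by (rule nn_integral_cmult[symmetric]) measurable
    also have "\<dots> \<le> (\<integral>\<^sup>+z. ennreal (\<bar>?h z\<bar> * \<bar>heat_kernel t z\<bar>) + ennreal (\<bar>?h z - M * heat_kernel t z\<bar> * \<bar>heat_kernel t z\<bar>) \<partial>lborel)"
    proof (rule nn_integral_mono)
      fix z
      have "M * heat_kernel t z \<le> \<bar>?h z\<bar> + \<bar>?h z - M * heat_kernel t z\<bar>" by linarith
      then have "M * heat_kernel t z * heat_kernel t z \<le> (\<bar>?h z\<bar> + \<bar>?h z - M * heat_kernel t z\<bar>) * heat_kernel t z"
        using t by (intro mult_right_mono) auto
      then show "ennreal M * ennreal (heat_kernel t z * heat_kernel t z)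
         \<le> ennreal (\<bar>?h z\<bar> * \<bar>heat_kernel t z\<bar>) + ennreal (\<bar>?h z - M * heat_kernel t z\<bar> * \<bar>heat_kernel t z\<bar>)"
        using t M by (simp add: ennreal_leI distrib_right mult.assoc flip: ennreal_mult ennreal_plus)
    qed
    also have "\<dots> = (\<integral>\<^sup>+z. ennreal (\<bar>?h z\<bar> * \<bar>heat_kernel t z\<bar>) \<partial>lborel) + (\<integral>\<^sup>+z. ennreal (\<bar>?h z - M * heat_kernel t z\<bar> * \<bar>heat_kernel t z\<bar>) \<partial>lborel)"
      by (rule nn_integral_add) measurable
    also have "\<dots> \<le> ennreal (\<epsilon> * t powr (-1/4) * B) + ennreal (heat_defect u0 t * t powr (-1/4) * B)"
    proof (rule add_mono)
      show "(\<integral>\<^sup>+z. ennreal (\<bar>?h z\<bar> * \<bar>heat_kernel t z\<bar>) \<partial>lborel) \<le> ennreal (\<epsilon> * t powr (-1/4) * B)"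
        using holder_heat[OF \<epsilon>(2)[OF t(1)], of \<psi> "t / 2" B] t \<epsilon>(1) B \<psi>4 unfolding \<phi> by simp
      show "(\<integral>\<^sup>+z. ennreal (\<bar>?h z - M * heat_kernel t z\<bar> * \<bar>heat_kernel t z\<bar>) \<partial>lborel) \<le> ennreal (heat_defect u0 t * t powr (-1/4) * B)"
        using heat_asymptotics[OF u0 M(1) t(1) _ t(2) B \<psi>4] unfolding \<phi> by simp
    qed
    also have "\<dots> = ennreal ((\<epsilon> + heat_defect u0 t) * (t powr (-1/4) * B))"
      using \<epsilon> B heat_defect_nonneg[of u0 t] by (subst ennreal_plus[symmetric]) (auto simp: algebra_simps)
    also have "t powr (-1/4) * B = 1 / (pi * t)"
    proof -
      have "t powr (-1/4) * t powr (-3/4) = t powr (-1)" unfolding powr_add[symmetric] by simp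
      then show ?thesis using t powr_minus_divide[of t 1] by (simp add: B_def)
    qed
    finally have "M / (8 * pi * t) \<le> (\<epsilon> + heat_defect u0 t) * (1 / (pi * t))"
      using \<epsilon> t heat_defect_nonneg[of u0 t] by (subst (asm) ennreal_le_iff) auto
    then show ?case using t by (simp add: field_simps)
  qed
qed simp

section \<open>Flux estimates with test functions measured in L^4\<close>

context test_function begin

lemma psi_power4: "integrable lborel (\<lambda>x. \<psi> x ^ 4)"
proof -
  obtain C where C: "C > 0" "\<And>x. \<bar>\<psi> x\<bar> \<le> C" using psi_bounded by blast
  show ?thesis
  proof (rule Bochner_Integration.integrable_bound)
    show "integrable lborel (\<lambda>x. C ^ 3 * \<psi> x)" using integrable_psi by simp
    show "AE x in lborel. norm (\<psi> x ^ 4) \<le> norm (C ^ 3 * \<psi> x)"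
    proof (intro AE_I2)
      fix x
      have "\<bar>\<psi> x\<bar> ^ 3 * \<bar>\<psi> x\<bar> \<le> C ^ 3 * \<bar>\<psi> x\<bar>" using C by (intro mult_right_mono power_mono) auto
      then show "norm (\<psi> x ^ 4) \<le> norm (C ^ 3 * \<psi> x)"
        using C(1) by (simp add: abs_mult power_abs power_Suc2[symmetric] eval_nat_numeral mult_ac)
    qed
  qed measurable
qed

lemma nn_psi_power4: "(LINT x|lborel. \<psi> x ^ 4) \<le> B ^ 4 \<Longrightarrow> (\<integral>\<^sup>+x. ennreal (\<psi> x ^ 4) \<partial>lborel) \<le> ennreal (B ^ 4)"
  using psi_power4 by (simp add: nn_integral_eq_integral ennreal_leI)

lemma L43_mult_V_integrable:
  assumes f: "L43_bound f A" "A > 0" and s: "s > 0"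
  shows "integrable lborel (\<lambda>x. f x * V s x)"
proof (rule integrableI_bounded)
  have [measurable]: "f \<in> borel_measurable borel" using f by (simp add: L43_bound_def)
  show "(\<lambda>x. f x * V s x) \<in> borel_measurable lborel" by measurable
  define I where "I = (LINT x|lborel. \<psi> x ^ 4)"
  have I: "I \<ge> 0" unfolding I_def by (intro Bochner_Integration.integral_nonneg) auto
  \<comment> \<open>\<open>holder_heat\<close> wants a positive number whose fourth power is at
    least I; 1 + I also covers I = 0.\<close>
  have "I \<le> (1 + I) ^ 1" by simp
  also have "\<dots> \<le> (1 + I) ^ 4" using I by (intro power_increasing) auto
  finally have "(\<integral>\<^sup>+x. ennreal (\<psi> x ^ 4) \<partial>lborel) \<le> ennreal ((1 + I) ^ 4)"
    unfolding I_def by (rule nn_psi_power4)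
  then have "(\<integral>\<^sup>+x. ennreal (\<bar>f x\<bar> * \<bar>heat s (distr_of \<psi>) x\<bar>) \<partial>lborel) \<le> ennreal (A * (1 + I))"
    using I by (intro holder_heat f s) auto
  then show "(\<integral>\<^sup>+x. ennreal (norm (f x * V s x)) \<partial>lborel) < \<infinity>"
    by (auto simp: V_def abs_mult intro: le_less_trans)
qed

text \<open>Splitting the time r + s lets G_r take the derivative and \<open>V s\<close> the test
  function, so the L^(4/3) norm of the kernel gradient meets the L^4 norm of \<open>\<psi>\<close>;
  the bound is then uniform in \<open>s\<close>.\<close>

lemma abs_pd_V_le:
  assumes r: "r > 0" and s: "s > 0" and B: "B > 0" "(\<integral>\<^sup>+x. ennreal (\<psi> x ^ 4) \<partial>lborel) \<le> ennreal (B ^ 4)"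
  shows "\<bar>pd i (V (r + s)) y\<bar> \<le> 27 * r powr (-3/4) * B"
proof -
  have pm [measurable]: "pd i (heat_kernel r) \<in> borel_measurable borel"
    using borel_measurable_pds[OF heat_kernel_schwartz[OF r], of "[i]"] by (simp add: pds_def)
  have pdV: "pd i (V (r + s)) y = (LINT z|lborel. V s z * pd i (heat_kernel r) (y - z))"
    using pds_convolution[OF heat_kernel_schwartz[OF r] integrable_V[OF s], of "[i]"]
    by (simp add: pds_def heat_V[OF r s, symmetric] heat_distr_of)
  have int: "integrable lborel (\<lambda>z. V s z * pd i (heat_kernel r) (y - z))"
  proof (rule Bochner_Integration.integrable_bound)
    show "integrable lborel (\<lambda>z. V s z * r powr (-3/2))" using integrable_V[OF s] by simp
    show "AE z in lborel. norm (V s z * pd i (heat_kernel r) (y - z)) \<le> norm (V s z * r powr (-3/2))"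
    proof (intro AE_I2)
      fix z
      have "\<bar>V s z\<bar> * \<bar>pd i (heat_kernel r) (y - z)\<bar> \<le> \<bar>V s z\<bar> * r powr (-3/2)"
        by (intro mult_left_mono abs_pd_heat_kernel_le_const r) auto
      then show "norm (V s z * pd i (heat_kernel r) (y - z)) \<le> norm (V s z * r powr (-3/2))" by (simp add: abs_mult)
    qed
  qed measurable
  have "ennreal \<bar>pd i (V (r + s)) y\<bar> \<le> (\<integral>\<^sup>+z. ennreal (norm (V s z * pd i (heat_kernel r) (y - z))) \<partial>lborel)"
    unfolding pdV using integral_norm_bound_ennreal[OF int] by simp
  also have "\<dots> \<le> (\<integral>\<^sup>+z. ennreal (\<bar>grad_heat_norm r (z - y)\<bar> * \<bar>heat s (distr_of \<psi>) z\<bar>) \<partial>lborel)"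
  proof (rule nn_integral_mono)
    fix z
    have "\<bar>pd i (heat_kernel r) (y - z)\<bar> \<le> grad_heat_norm r (y - z)" by (rule abs_pd_heat_kernel_le[OF r])
    also have "\<dots> = \<bar>grad_heat_norm r (z - y)\<bar>"
      using r by (simp add: grad_heat_norm_def norm_minus_commute heat_kernel_minus[of r y z])
    finally have "\<bar>pd i (heat_kernel r) (y - z)\<bar> * \<bar>V s z\<bar> \<le> \<bar>grad_heat_norm r (z - y)\<bar> * \<bar>V s z\<bar>"
      by (intro mult_right_mono) auto
    then show "ennreal (norm (V s z * pd i (heat_kernel r) (y - z))) \<le> ennreal (\<bar>grad_heat_norm r (z - y)\<bar> * \<bar>heat s (distr_of \<psi>) z\<bar>)"
      by (simp add: abs_mult mult.commute V_def ennreal_leI)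
  qed
  also have "\<dots> \<le> ennreal (27 * r powr (-3/4) * B)"
    using r by (intro holder_heat L43_bound_grad_heat r s B) auto
  finally show ?thesis using B r by (simp add: ennreal_le_iff)
qed

text \<open>The constant 108 is the product of the two components of the flux, the constant 2 of
  \<open>debye_flux_diff\<close> and the gradient constant 27.\<close>

lemma flux_pairing_diff:
  assumes r: "r > 0" and s: "s > 0" and B: "B > 0" "(\<integral>\<^sup>+x. ennreal (\<psi> x ^ 4) \<partial>lborel) \<le> ennreal (B ^ 4)"
    and f: "L43_bound f A" "A > 0" and g: "L43_bound g A'" "A' > 0" and w: "L43_bound (\<lambda>x. f x - g x) W" "W > 0"
  shows "\<bar>distr_of (heat r (div_distr (debye_flux f))) (V s) - distr_of (heat r (div_distr (debye_flux g))) (V s)\<bar>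
    \<le> 108 * r powr (-3/4) * B * (A + A') * W"
proof -
  let ?F = "debye_flux f" and ?G = "debye_flux g" and ?k = "27 * r powr (-3/4) * B"
  have k: "?k \<ge> 0" using B by simp
  note iF = debye_flux_integrable[OF f] and iG = debye_flux_integrable[OF g]
  have rs: "r + s > 0" using r s by simp
  have [measurable]: "pd i (V (r + s)) \<in> borel_measurable borel" for i
    using borel_measurable_pds[OF V_schwartz[OF rs], of "[i]"] by (simp add: pds_def)
  have iH: "integrable lborel (\<lambda>y. H y $ i * pd i (V (r + s)) y)" if H: "integrable lborel H" for H :: "plane \<Rightarrow> plane" and i
  proof (rule Bochner_Integration.integrable_bound)
    show "integrable lborel (\<lambda>y. H y $ i * ?k)" using integrable_vec_nth[OF H] by simp
    have [measurable]: "H \<in> borel_measurable borel" using H by auto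
    show "(\<lambda>y. H y $ i * pd i (V (r + s)) y) \<in> borel_measurable lborel" by measurable
    show "AE y in lborel. norm (H y $ i * pd i (V (r + s)) y) \<le> norm (H y $ i * ?k)"
    proof (intro AE_I2)
      fix y
      have "\<bar>H y $ i\<bar> * \<bar>pd i (V (r + s)) y\<bar> \<le> \<bar>H y $ i\<bar> * ?k"
        by (intro mult_left_mono abs_pd_V_le r s B) auto
      then show "norm (H y $ i * pd i (V (r + s)) y) \<le> norm (H y $ i * ?k)"
        using B by (simp add: abs_mult)
    qed
  qed
  have one: "\<bar>(LINT y|lborel. ?G y $ i * pd i (V (r + s)) y) - (LINT y|lborel. ?F y $ i * pd i (V (r + s)) y)\<bar> \<le> 2 * (A + A') * W * ?k" for i
  proof -
    have "(LINT y|lborel. ?G y $ i * pd i (V (r + s)) y) - (LINT y|lborel. ?F y $ i * pd i (V (r + s)) y)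
      = (LINT y|lborel. ?G y $ i * pd i (V (r + s)) y - ?F y $ i * pd i (V (r + s)) y)"
      using iH[OF iF] iH[OF iG] by simp
    also have "norm \<dots> \<le> (LINT y|lborel. norm (?F y - ?G y) * ?k)"
    proof (rule Bochner_Integration.integral_norm_bound_integral)
      show "integrable lborel (\<lambda>y. ?G y $ i * pd i (V (r + s)) y - ?F y $ i * pd i (V (r + s)) y)"
        using iH[OF iF] iH[OF iG] by simp
      show "integrable lborel (\<lambda>y. norm (?F y - ?G y) * ?k)" using iF iG by simp
      fix y
      have "\<bar>(?F y - ?G y) $ i\<bar> * \<bar>pd i (V (r + s)) y\<bar> \<le> norm (?F y - ?G y) * ?k"
        using B by (intro mult_mono abs_pd_V_le r s B component_le_norm_cart) auto
      then show "norm (?G y $ i * pd i (V (r + s)) y - ?F y $ i * pd i (V (r + s)) y) \<le> norm (?F y - ?G y) * ?k"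
      proof -
        have "?G y $ i * pd i (V (r + s)) y - ?F y $ i * pd i (V (r + s)) y = - ((?F y - ?G y) $ i * pd i (V (r + s)) y)"
          by (simp add: left_diff_distrib)
        then have "norm (?G y $ i * pd i (V (r + s)) y - ?F y $ i * pd i (V (r + s)) y) = \<bar>(?F y - ?G y) $ i\<bar> * \<bar>pd i (V (r + s)) y\<bar>"
          by (simp only: real_norm_def abs_minus_cancel abs_mult)
        then show ?thesis using \<open>\<bar>(?F y - ?G y) $ i\<bar> * \<bar>pd i (V (r + s)) y\<bar> \<le> norm (?F y - ?G y) * ?k\<close> by (simp only:)
      qed
    qed
    also have "\<dots> = (LINT y|lborel. norm (?F y - ?G y)) * ?k" by simp
    also have "\<dots> \<le> 2 * (A + A') * W * ?k"
      by (intro mult_right_mono debye_flux_diff f g w k)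
    finally show ?thesis by simp
  qed
  have eq: "distr_of (heat r (div_distr ?F)) (V s) - distr_of (heat r (div_distr ?G)) (V s)
    = (\<Sum>i\<in>UNIV. (LINT y|lborel. ?G y $ i * pd i (V (r + s)) y) - (LINT y|lborel. ?F y $ i * pd i (V (r + s)) y))"
    using heat_div_distr_pairing[OF r s integrable_vec_nth[OF iF]] heat_div_distr_pairing[OF r s integrable_vec_nth[OF iG]]
    by (simp add: sum_subtractf)
  have "\<bar>distr_of (heat r (div_distr ?F)) (V s) - distr_of (heat r (div_distr ?G)) (V s)\<bar> \<le> (\<Sum>i\<in>(UNIV :: 2 set). 2 * (A + A') * W * ?k)"
    unfolding eq by (intro sum_abs[THEN order_trans] sum_mono one)
  then show ?thesis by (simp add: algebra_simps)
qed

end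

section \<open>The singular time integral\<close>

lemma singular_kernel_le:
  fixes t :: real
  assumes "0 < \<tau>" "\<tau> < t"
  shows "(t - \<tau>) powr (-3/4) * \<tau> powr (-1/2) \<le> (t/2) powr (-3/4) * \<tau> powr (-1/2) + (t/2) powr (-1/2) * (t - \<tau>) powr (-3/4)"
\<comment> \<open>In each half of the interval only one factor is singular and the other is bounded
  by its value at t / 2. The resulting sum has an explicit integral, which avoids the Beta
  function.\<close>
proof (cases "\<tau> \<le> t / 2")
  case True
  then have "(t - \<tau>) powr (-3/4) \<le> (t/2) powr (-3/4)" using assms by (intro powr_mono2') auto
  then have "(t - \<tau>) powr (-3/4) * \<tau> powr (-1/2) \<le> (t/2) powr (-3/4) * \<tau> powr (-1/2)" by (intro mult_right_mono) auto
  then show ?thesis by (intro add_increasing2) auto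
next
  case False
  then have "\<tau> powr (-1/2) \<le> (t/2) powr (-1/2)" using assms by (intro powr_mono2') auto
  then have "(t - \<tau>) powr (-3/4) * \<tau> powr (-1/2) \<le> (t - \<tau>) powr (-3/4) * (t/2) powr (-1/2)" by (intro mult_left_mono) auto
  then show ?thesis by (intro add_increasing) (auto simp: mult.commute)
qed

lemma has_integral_powr_reflected:
  fixes t :: real
  assumes t: "t > 0"
  shows "((\<lambda>\<tau>. (t - \<tau>) powr (-3/4)) has_integral 4 * t powr (1/4)) {0..t}"
proof -
  have "((\<lambda>\<tau>. (t - \<tau>) powr (-3/4)) has_integral (- 4 * (t - t) powr (1/4)) - (- 4 * (t - 0) powr (1/4))) {0..t}"
  proof (rule fundamental_theorem_of_calculus_interior)
    show "continuous_on {0..t} (\<lambda>\<tau>. - 4 * (t - \<tau>) powr (1/4))"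
      by (intro continuous_intros continuous_on_powr') auto
    fix \<tau> assume "\<tau> \<in> {0<..<t}"
    then have "((\<lambda>\<tau>. - 4 * (t - \<tau>) powr (1/4)) has_real_derivative (t - \<tau>) powr (-3/4)) (at \<tau>)"
      by (auto intro!: derivative_eq_intros)
    then show "((\<lambda>\<tau>. - 4 * (t - \<tau>) powr (1/4)) has_vector_derivative (t - \<tau>) powr (-3/4)) (at \<tau>)"
      by (simp add: has_real_derivative_iff_has_vector_derivative)
  qed (use t in auto)
  then show ?thesis by simp
qed

text \<open>The \<open>b\<close> term spends the eventual bound at all times; the \<open>w\<close>
  term adds the crude bound, required up to time \<open>T\<close> only.\<close>

lemma majorant_has_integral:
  fixes t :: real
  assumes t: "t > 0" and T: "0 \<le> T" "T \<le> t"
  shows "((\<lambda>\<tau>. c * (b * ((t/2) powr (-3/4) * \<tau> powr (-1/2) + (t/2) powr (-1/2) * (t - \<tau>) powr (-3/4))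
      + w * ((t/2) powr (-3/4) * (if \<tau> \<in> {0..T} then \<tau> powr (-1/2) else 0)))) has_integral
     c * (b * ((t/2) powr (-3/4) * (2 * t powr (1/2)) + (t/2) powr (-1/2) * (4 * t powr (1/4)))
      + w * ((t/2) powr (-3/4) * (2 * T powr (1/2))))) {0..t}"
proof -
  have 1: "((\<lambda>\<tau>. \<tau> powr (-1/2)) has_integral 2 * a powr (1/2)) {0..a}" if "a \<ge> 0" for a :: real
    using has_integral_powr_from_0[of "-1/2" a] that by (simp add: mult.commute)
  have "((\<lambda>\<tau>. if \<tau> \<in> {0..T} then \<tau> powr (-1/2) else 0) has_integral 2 * T powr (1/2)) {0..t}"
    using T 1[of T] by (subst has_integral_restrict) auto
  then show ?thesis
    using 1[of t] t has_integral_powr_reflected[OF t]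
    by (intro has_integral_mult_right has_integral_add) auto
qed

lemma half_powr_le:
  fixes t :: real
  assumes t: "t > 0" and a: "0 \<le> a" "a \<le> 1"
  shows "(t/2) powr (-a) \<le> 2 * t powr (-a)"
proof -
  have "(t/2) powr (-a) = t powr (-a) * 2 powr a"
    using t by (simp add: powr_divide powr_minus field_simps)
  also have "\<dots> \<le> t powr (-a) * 2 powr 1" using a by (intro mult_left_mono powr_mono) auto
  finally show ?thesis by (simp add: mult.commute)
qed

text \<open>Both halves of the interval scale like t^(-1/4), with constants 4 and 8 that add up to
  12; the term from times before \<open>T\<close> gains the extra decay t^(-1/2).\<close>

lemma majorant_integral_le:
  fixes t :: real
  assumes t: "t > 0" and T: "0 \<le> T" and bw: "b \<ge> 0" "w \<ge> 0"
  shows "b * ((t/2) powr (-3/4) * (2 * t powr (1/2)) + (t/2) powr (-1/2) * (4 * t powr (1/4))) + w * ((t/2) powr (-3/4) * (2 * T powr (1/2)))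
    \<le> (12 * b + 4 * w * T powr (1/2) * t powr (-1/2)) * t powr (-1/4)"
proof -
  have h: "(t/2) powr (-3/4) \<le> 2 * t powr (-3/4)" "(t/2) powr (-1/2) \<le> 2 * t powr (-1/2)"
    using half_powr_le[OF t, of "3/4"] half_powr_le[OF t, of "1/2"] by auto
  have p: "t powr (-3/4) * t powr (1/2) = t powr (-1/4)" "t powr (-1/2) * t powr (1/4) = t powr (-1/4)" 
    "t powr (-1/2) * t powr (-1/4) = t powr (-3/4)"
    by (simp_all only: powr_add[symmetric]) simp_all
  have "b * ((t/2) powr (-3/4) * (2 * t powr (1/2)) + (t/2) powr (-1/2) * (4 * t powr (1/4))) + w * ((t/2) powr (-3/4) * (2 * T powr (1/2)))
     \<le> b * ((2 * t powr (-3/4)) * (2 * t powr (1/2)) + (2 * t powr (-1/2)) * (4 * t powr (1/4))) + w * ((2 * t powr (-3/4)) * (2 * T powr (1/2)))"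
    using h bw by (intro add_mono mult_left_mono mult_right_mono) auto
  also have "\<dots> = b * (4 * (t powr (-3/4) * t powr (1/2)) + 8 * (t powr (-1/2) * t powr (1/4))) + 4 * w * T powr (1/2) * t powr (-3/4)"
    by (simp add: algebra_simps)
  also have "\<dots> = b * (12 * t powr (-1/4)) + 4 * w * T powr (1/2) * (t powr (-1/2) * t powr (-1/4))"
    unfolding p by simp
  also have "\<dots> = (12 * b + 4 * w * T powr (1/2) * t powr (-1/2)) * t powr (-1/4)" by (simp add: algebra_simps)
  finally show ?thesis .
qed

section \<open>Contraction of the eventual bound\<close>

context profile begin

text \<open>Times before the threshold \<open>T\<close> of the bound \<open>b\<close> become
  negligible relative to t^(-1/4), so for large t only \<open>b\<close> is fed back, multiplied by a
  small constant. Of the factor 3/4, the linear flow takes 1/8 and the flux 5/8.\<close>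

lemma decay_step:
  fixes u0 :: "plane \<Rightarrow> real" and v :: "real \<Rightarrow> plane \<Rightarrow> real"
  assumes u0: "integrable lborel u0" and mass: "(LINT x|lborel. u0 x) = M" and M8: "M \<le> 8 * \<epsilon>" and \<epsilon>: "\<epsilon> = 1 / 30000"
    and heat0: "\<And>t. t > 0 \<Longrightarrow> L43_bound (heat t (distr_of u0)) (\<epsilon> * t powr (-1/4))"
    and v: "\<And>t. t > 0 \<Longrightarrow> L43_bound (v t) (2 * \<epsilon> * t powr (-1/4))"
    and duhamel: "\<And>\<phi> t. t > 0 \<Longrightarrow> \<phi> \<in> schwartz \<Longrightarrow>
       set_integrable lebesgue {0<..<t} (\<lambda>\<tau>. distr_of (heat (t - \<tau>) (div_distr (debye_flux (v \<tau>)))) \<phi>) \<and>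
       (LINT x|lborel. v t x * \<phi> x) = distr_of (heat t (distr_of u0)) \<phi>
         + (LINT \<tau>:{0<..<t}|lebesgue. distr_of (heat (t - \<tau>) (div_distr (debye_flux (v \<tau>)))) \<phi>)"
    and w0: "w0 > 0" "\<And>t. t > 0 \<Longrightarrow> L43_bound (\<lambda>x. v t x - U t x) (w0 * t powr (-1/4))"
    and b: "b > 0" "\<forall>\<^sub>F t in at_top. L43_bound (\<lambda>x. v t x - U t x) (b * t powr (-1/4))"
  shows "\<forall>\<^sub>F t in at_top. L43_bound (\<lambda>x. v t x - U t x) (3/4 * b * t powr (-1/4))"
proof -
  obtain T0 where T0: "\<And>t. t \<ge> T0 \<Longrightarrow> L43_bound (\<lambda>x. v t x - U t x) (b * t powr (-1/4))"
    using b(2) by (auto simp: eventually_at_top_linorder)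
  define T where "T = max 1 T0"
  have T: "T > 0" "\<And>t. t \<ge> T \<Longrightarrow> L43_bound (\<lambda>x. v t x - U t x) (b * t powr (-1/4))"
    using T0 by (auto simp: T_def)
  have e1: "\<forall>\<^sub>F t in at_top. heat_defect u0 t < b / 8"
    using heat_defect_tendsto[OF u0] b(1) by (intro order_tendstoD(2)) auto
  have "((\<lambda>t. 4 * w0 * T powr (1/2) * t powr (-1/2)) \<longlongrightarrow> 0) at_top"
    by real_asymp
  then have e2: "\<forall>\<^sub>F t in at_top. 4 * w0 * T powr (1/2) * t powr (-1/2) < b / 8"
    using b(1) by (intro order_tendstoD(2)) auto
  show ?thesis
    using e1 e2 eventually_ge_at_top[of "2 * T"]
  proof eventually_elim
    case (elim t)
    have t: "t > 0" using elim T by simp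
    show ?case
    proof (rule L43_bound_by_duality)
      show "(\<lambda>x. v t x - U t x) \<in> borel_measurable borel" using w0(2)[OF t] by (simp add: L43_bound_def)
      show "integrable lborel (\<lambda>x. \<bar>v t x - U t x\<bar> powr (4/3))" by (rule L43_bound_integrable(1)[OF w0(2)[OF t]])
      show "3/4 * b * t powr (-1/4) > 0" using b t by simp
      fix \<psi> :: "plane \<Rightarrow> real" and s B :: real
      assume \<psi>: "continuous_on UNIV \<psi>" "\<exists>R. \<forall>x. norm x > R \<longrightarrow> \<psi> x = 0" and s: "0 < s" "s \<le> 1"
        and B: "0 < B" "(LINT x|lborel. \<psi> x ^ 4) \<le> B ^ 4"
      then obtain R where R: "\<And>x. norm x > R \<Longrightarrow> \<psi> x = 0" by blast
      interpret profile_test M \<xi> \<xi>' \<psi> R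
        by unfold_locales (use \<psi> R in auto)
      note B4 = nn_psi_power4[OF B(2)]
      let ?Dv = "\<lambda>\<tau>. distr_of (heat (t - \<tau>) (div_distr (debye_flux (v \<tau>)))) (V s)"
      let ?DU = "\<lambda>\<tau>. distr_of (heat (t - \<tau>) (div_distr (debye_flux (U \<tau>)))) (V s)"
      note dv = duhamel[OF t V_schwartz[OF s(1)]]
      note dU = U_duhamel[OF s(1) t]
      have iv: "integrable lborel (\<lambda>x. v t x * V s x)" by (rule L43_mult_V_integrable[OF v[OF t] _ s(1)]) (use t \<epsilon> in auto)
      have iU: "integrable lborel (\<lambda>x. U t x * V s x)" by (rule L43_mult_V_integrable[OF U_L43[OF t] _ s(1)]) (use t M_pos in auto)
      have ih: "integrable lborel (\<lambda>x. heat t (distr_of u0) x * V s x)" by (rule L43_mult_V_integrable[OF heat0[OF t] _ s(1)]) (use t \<epsilon> in auto)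
      have iG: "integrable lborel (\<lambda>x. heat_kernel t x * V s x)"
      proof (rule Bochner_Integration.integrable_bound)
        show "integrable lborel (\<lambda>x. 1 / (4 * pi * t) * V s x)" using integrable_V[OF s(1)] by simp
        show "AE x in lborel. norm (heat_kernel t x * V s x) \<le> norm (1 / (4 * pi * t) * V s x)"
        proof (intro AE_I2)
          fix x
          have "heat_kernel t x * \<bar>V s x\<bar> \<le> 1 / (4 * pi * t) * \<bar>V s x\<bar>"
            by (intro mult_right_mono heat_kernel_le t) auto
          then show "norm (heat_kernel t x * V s x) \<le> norm (1 / (4 * pi * t) * V s x)"
            using t by (simp add: abs_mult)
        qed
      qed measurable
      have split: "(LINT x|lborel. (v t x - U t x) * V s x)
         = (LINT x|lborel. (heat t (distr_of u0) x - M * heat_kernel t x) * V s x)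
           + (LINT \<tau>:{0<..<t}|lebesgue. ?Dv \<tau> - ?DU \<tau>)"
      proof -
        have "(LINT x|lborel. (v t x - U t x) * V s x) = (LINT x|lborel. v t x * V s x) - (LINT x|lborel. U t x * V s x)"
          using iv iU by (simp add: left_diff_distrib)
        moreover have "(LINT x|lborel. (heat t (distr_of u0) x - M * heat_kernel t x) * V s x)
           = distr_of (heat t (distr_of u0)) (V s) - M * (LINT x|lborel. heat_kernel t x * V s x)"
          using ih iG by (simp add: left_diff_distrib distr_of_def mult.assoc)
        moreover have "(LINT \<tau>:{0<..<t}|lebesgue. ?Dv \<tau> - ?DU \<tau>) = (LINT \<tau>:{0<..<t}|lebesgue. ?Dv \<tau>) - (LINT \<tau>:{0<..<t}|lebesgue. ?DU \<tau>)"
          using dv dU(1) by (intro set_integral_diff(2)) auto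
        ultimately show ?thesis using dv dU(2) by simp
      qed
      have first: "\<bar>LINT x|lborel. (heat t (distr_of u0) x - M * heat_kernel t x) * V s x\<bar> \<le> heat_defect u0 t * t powr (-1/4) * B"
      proof -
        have i: "integrable lborel (\<lambda>x. (heat t (distr_of u0) x - M * heat_kernel t x) * V s x)"
          using ih iG by (simp add: left_diff_distrib mult.assoc)
        have "ennreal (norm (LINT x|lborel. (heat t (distr_of u0) x - M * heat_kernel t x) * V s x))
          \<le> (\<integral>\<^sup>+x. ennreal (\<bar>heat t (distr_of u0) x - M * heat_kernel t x\<bar> * \<bar>heat s (distr_of \<psi>) x\<bar>) \<partial>lborel)"
          using integral_norm_bound_ennreal[OF i] by (simp add: V_def abs_mult)
        also have "\<dots> \<le> ennreal (heat_defect u0 t * t powr (-1/4) * B)"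
          by (rule heat_asymptotics[OF u0 mass t measurable_psi s(1) B(1) B4])
        finally show ?thesis
          using B heat_defect_nonneg[of u0 t] by (simp add: ennreal_le_iff)
      qed
      \<comment> \<open>108 from \<open>flux_pairing_diff\<close> times 2 \<epsilon> + 8 \<epsilon>,
        the sizes of \<open>v\<close> and of \<open>U\<close>.\<close>
      define c where "c = 1080 * \<epsilon> * B"
      have c: "c > 0" using B \<epsilon> by (simp add: c_def)
      define H where "H \<tau> = c * (b * ((t/2) powr (-3/4) * \<tau> powr (-1/2) + (t/2) powr (-1/2) * (t - \<tau>) powr (-3/4))
        + w0 * ((t/2) powr (-3/4) * (if \<tau> \<in> {0..T} then \<tau> powr (-1/2) else 0)))" for \<tau>
      have DH: "\<bar>?Dv \<tau> - ?DU \<tau>\<bar> \<le> H \<tau>" if \<tau>: "\<tau> \<in> {0<..<t}" for \<tau>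
      proof -
        have \<tau>0: "0 < \<tau>" "\<tau> < t" "0 < t - \<tau>" using \<tau> by auto
        have D: "\<bar>?Dv \<tau> - ?DU \<tau>\<bar> \<le> c * (W * ((t - \<tau>) powr (-3/4) * \<tau> powr (-1/2)))"
          if W: "W > 0" "L43_bound (\<lambda>x. v \<tau> x - U \<tau> x) (W * \<tau> powr (-1/4))" for W
        proof -
          have U8: "L43_bound (U \<tau>) (8 * \<epsilon> * \<tau> powr (-1/4))"
            by (rule L43_bound_mono[OF U_L43[OF \<tau>0(1)]]) (use M_pos M8 in \<open>auto intro!: mult_right_mono\<close>)
          have "\<bar>?Dv \<tau> - ?DU \<tau>\<bar> \<le> 108 * (t - \<tau>) powr (-3/4) * B * (2 * \<epsilon> * \<tau> powr (-1/4) + 8 * \<epsilon> * \<tau> powr (-1/4)) * (W * \<tau> powr (-1/4))"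
            by (rule flux_pairing_diff[OF \<tau>0(3) s(1) B(1) B4 v[OF \<tau>0(1)] _ U8 _ W(2)]) (use \<tau>0 \<epsilon> W in auto)
          also have "\<dots> = c * (W * ((t - \<tau>) powr (-3/4) * (\<tau> powr (-1/4) * \<tau> powr (-1/4))))"
            by (simp add: c_def algebra_simps)
          also have "\<tau> powr (-1/4) * \<tau> powr (-1/4) = \<tau> powr (-1/2)"
            unfolding powr_add[symmetric] by simp
          finally show ?thesis .
        qed
        show ?thesis
        \<comment> \<open>Late times use the bound with \<open>b\<close>. For early times t >= 2 T
          keeps t - \<tau> above t / 2, so the kernel is singular at \<tau> = 0 only.\<close>
        proof (cases "\<tau> \<ge> T")
          case True
          have "\<bar>?Dv \<tau> - ?DU \<tau>\<bar> \<le> c * (b * ((t - \<tau>) powr (-3/4) * \<tau> powr (-1/2)))"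
            by (rule D[OF b(1) T(2)[OF True]])
          also have "\<dots> \<le> c * (b * ((t/2) powr (-3/4) * \<tau> powr (-1/2) + (t/2) powr (-1/2) * (t - \<tau>) powr (-3/4)))"
            using c b by (intro mult_left_mono singular_kernel_le \<tau>0) auto
          also have "\<dots> \<le> H \<tau>"
            unfolding H_def using c w0(1) by (intro mult_left_mono) auto
          finally show ?thesis .
        next
          case False
          have "\<bar>?Dv \<tau> - ?DU \<tau>\<bar> \<le> c * (w0 * ((t - \<tau>) powr (-3/4) * \<tau> powr (-1/2)))"
            by (rule D[OF w0(1) w0(2)[OF \<tau>0(1)]])
          also have "\<dots> \<le> c * (w0 * ((t/2) powr (-3/4) * \<tau> powr (-1/2)))"
            using c w0 False elim(3) \<tau>0 by (intro mult_left_mono mult_right_mono powr_mono2') auto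
          also have "\<dots> = c * (w0 * ((t/2) powr (-3/4) * (if \<tau> \<in> {0..T} then \<tau> powr (-1/2) else 0)))"
            using False \<tau>0 by auto
          also have "\<dots> \<le> H \<tau>"
            unfolding H_def using c b w0(1) by (intro mult_left_mono add_increasing) auto
          finally show ?thesis .
        qed
      qed
      let ?I = "c * (b * ((t/2) powr (-3/4) * (2 * t powr (1/2)) + (t/2) powr (-1/2) * (4 * t powr (1/4)))
        + w0 * ((t/2) powr (-3/4) * (2 * T powr (1/2))))"
      have HI: "(H has_integral ?I) {0<..<t}"
        using majorant_has_integral[of t T c b w0] t T elim(3)
        unfolding H_def[abs_def] has_integral_Icc_iff_Ioo[symmetric] by simp
      have second: "\<bar>LINT \<tau>:{0<..<t}|lebesgue. ?Dv \<tau> - ?DU \<tau>\<bar> \<le> ?I"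
      proof -
        have si: "set_integrable lebesgue {0<..<t} (\<lambda>\<tau>. ?Dv \<tau> - ?DU \<tau>)"
          using dv dU(1) by (intro set_integral_diff(1)) auto
        \<comment> \<open>The majorant \<open>H\<close> is known through its gauge integral, so the
          comparison is made there and then carried back to the Lebesgue integral.\<close>
        have "norm (integral {0<..<t} (\<lambda>\<tau>. ?Dv \<tau> - ?DU \<tau>)) \<le> integral {0<..<t} H"
          using set_lebesgue_integral_eq_integral(1)[OF si] HI DH
          by (intro Henstock_Kurzweil_Integration.integral_norm_bound_integral) auto
        then show ?thesis
          using set_lebesgue_integral_eq_integral(2)[OF si] integral_unique[OF HI] by simp
      qed
      have "?I \<le> c * ((12 * b + 4 * w0 * T powr (1/2) * t powr (-1/2)) * t powr (-1/4))"
        using c b w0 T t by (intro mult_left_mono majorant_integral_le) auto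
      also have "\<dots> \<le> c * ((12 * b + b / 8) * t powr (-1/4))"
        using c elim(2) by (intro mult_left_mono mult_right_mono) auto
      also have "\<dots> \<le> (5/8 * b) * t powr (-1/4) * B"
      proof -
        \<comment> \<open>Numerically 1080 (12 + 1/8) = 13095, below 5/8 of 30000: here the size of
          \<epsilon> is used.\<close>
        have "c * (12 * b + b / 8) \<le> 5/8 * b * B"
          using B b(1) by (simp add: c_def \<epsilon>)
        then have "c * (12 * b + b / 8) * t powr (-1/4) \<le> 5/8 * b * B * t powr (-1/4)" by (intro mult_right_mono) auto
        then show ?thesis by (simp add: mult_ac)
      qed
      finally have "?I \<le> (5/8 * b) * t powr (-1/4) * B" .
      moreover have "heat_defect u0 t * t powr (-1/4) * B \<le> b / 8 * t powr (-1/4) * B"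
        using elim(1) B by (intro mult_right_mono) auto
      moreover have "3/4 * b * t powr (-1/4) * B = b / 8 * t powr (-1/4) * B + (5/8 * b) * t powr (-1/4) * B"
        by (simp add: algebra_simps)
      ultimately have "\<bar>LINT x|lborel. (v t x - U t x) * V s x\<bar> \<le> 3/4 * b * t powr (-1/4) * B"
        using first second unfolding split by linarith
      then show "\<bar>LINT x|lborel. (v t x - U t x) * heat s (distr_of \<psi>) x\<bar> \<le> 3/4 * b * t powr (-1/4) * B"
        by (simp add: V_def)
    qed
  qed
qed

end

text \<open>The contraction acts on bounds that hold eventually in time, and each round brings its
  own threshold; finitely many rounds reach any prescribed level, which gives the limit but no
  rate.\<close>

theorem corollary5p3:
  shows "\<exists>\<epsilon>::real. \<epsilon> > 0 \<and>
    (\<forall>(u0 :: plane \<Rightarrow> real) (M :: real) (u :: real \<Rightarrow> distr) (UM :: real \<Rightarrow> plane \<Rightarrow> real).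
       integrable lborel u0 \<longrightarrow>
       distr_of u0 \<in> BX \<longrightarrow>
       BX_norm (distr_of u0) < ennreal \<epsilon> \<longrightarrow>
       (LINT x|lborel. u0 x) = M \<longrightarrow>
       M > 0 \<longrightarrow>
       u \<in> solution_space (distr_of u0) \<longrightarrow>
       mild_solution (distr_of u0) u \<longrightarrow>
       L43_decay_norm u < ennreal (2 * \<epsilon>) \<longrightarrow>
       debye_self_similar M UM \<longrightarrow>
       ((\<lambda>t. ennreal (t powr (1/4)) * Lp_norm (4/3) (\<lambda>x. density_of (u t) x - UM t x)) \<longlongrightarrow> 0) at_top)"
proof (intro exI[of _ "1/30000 :: real"] conjI allI impI)
  fix u0 :: "plane \<Rightarrow> real" and M :: real and u :: "real \<Rightarrow> distr" and UM :: "real \<Rightarrow> plane \<Rightarrow> real"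
  define \<epsilon> :: real where "\<epsilon> = 1/30000"
  assume u0: "integrable lborel u0" and BX: "BX_norm (distr_of u0) < ennreal (1/30000)"
    and mass: "(LINT x|lborel. u0 x) = M" and M: "M > 0"
    and u: "u \<in> solution_space (distr_of u0)" and mild: "mild_solution (distr_of u0) u"
    and dec: "L43_decay_norm u < ennreal (2 * (1/30000))" and ss: "debye_self_similar M UM"
  have \<epsilon>0: "\<epsilon> > 0" by (simp add: \<epsilon>_def)
  obtain \<xi> \<xi>' where \<xi>: "debye_profile M \<xi> \<xi>'" and UM: "\<And>t x. t > 0 \<Longrightarrow> UM t x = 2 / t * \<xi>' ((norm x)\<^sup>2 / t)"
    using ss by (auto simp: debye_self_similar_def)
  interpret profile M \<xi> \<xi>' by unfold_locales (use \<xi> M in auto)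
  define v where "v t = density_of (u t)" for t
  have quarter: "c / t powr (1/4) = c * t powr (-1/4)" if "t > 0" for c t :: real
    using that powr_minus_divide[of t "1/4"] by simp
  have v: "L43_bound (v t) (2 * \<epsilon> * t powr (-1/4))" if t: "t > 0" for t
  proof -
    have "ennreal (t powr (1/4)) * Lp_norm (4/3) (v t) \<le> L43_decay_norm u"
      unfolding L43_decay_norm_def v_def by (rule SUP_upper) (use t in auto)
    also have "\<dots> \<le> ennreal (2 * \<epsilon>)" using dec by (simp add: \<epsilon>_def)
    finally have "Lp_norm (4/3) (v t) \<le> ennreal (2 * \<epsilon> / t powr (1/4))"
      by (rule ennreal_mult_le_imp_le) (use t \<epsilon>0 in auto)
    then show ?thesis
      unfolding quarter[OF t] by (rule Lp_norm_le_imp_L43(1)) (use \<epsilon>0 in auto)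
  qed
  have heat0: "L43_bound (heat t (distr_of u0)) (\<epsilon> * t powr (-1/4))" if t: "t > 0" for t
  proof -
    have "ennreal (t powr (1/4)) * Lp_norm (4/3) (heat t (distr_of u0)) \<le> BX_norm (distr_of u0)"
      unfolding BX_norm_def by (rule SUP_upper) (use t in auto)
    also have "\<dots> \<le> ennreal \<epsilon>" using BX by (simp add: \<epsilon>_def)
    finally have "Lp_norm (4/3) (heat t (distr_of u0)) \<le> ennreal (\<epsilon> / t powr (1/4))"
      by (rule ennreal_mult_le_imp_le) (use t \<epsilon>0 in auto)
    then show ?thesis
      unfolding quarter[OF t] by (rule Lp_norm_le_imp_L43(1)) (use \<epsilon>0 in auto)
  qed
  have M8: "M \<le> 8 * \<epsilon>" by (rule mass_le[OF u0 mass M \<epsilon>0 heat0])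
  \<comment> \<open>The choice behind \<open>density_of\<close> yields a genuine density because
    membership in \<open>solution_space\<close> provides one at each positive time.\<close>
  have dens: "has_density (u t) (v t)" if "t > 0" for t
  proof -
    have "\<exists>g. has_density (u t) g" using u that by (auto simp: solution_space_def)
    then show ?thesis unfolding v_def density_of_def by (rule someI_ex)
  qed
  have duhamel: "set_integrable lebesgue {0<..<t} (\<lambda>\<tau>. distr_of (heat (t - \<tau>) (div_distr (debye_flux (v \<tau>)))) \<phi>) \<and>
       (LINT x|lborel. v t x * \<phi> x) = distr_of (heat t (distr_of u0)) \<phi>
         + (LINT \<tau>:{0<..<t}|lebesgue. distr_of (heat (t - \<tau>) (div_distr (debye_flux (v \<tau>)))) \<phi>)"
    if "t > 0" "\<phi> \<in> schwartz" for \<phi> t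
    using mild dens[OF that(1)] that
    by (simp add: mild_solution_def duhamel_integrand_def v_def has_density_def distr_of_def)
  \<comment> \<open>The factor 4 of \<open>L43_bound_diff\<close> times the common bound 8
    \<epsilon> of both functions.\<close>
  define w0 where "w0 = 32 * \<epsilon>"
  have w0: "w0 > 0" using \<epsilon>0 by (simp add: w0_def)
  have w0': "L43_bound (\<lambda>x. v t x - U t x) (w0 * t powr (-1/4))" if t: "t > 0" for t
  proof -
    have "L43_bound (v t) (8 * \<epsilon> * t powr (-1/4))"
      by (rule L43_bound_mono[OF v[OF t]]) (use \<epsilon>0 in \<open>auto intro!: mult_right_mono\<close>)
    moreover have "L43_bound (U t) (8 * \<epsilon> * t powr (-1/4))"
      by (rule L43_bound_mono[OF U_L43[OF t]]) (use M M8 in \<open>auto intro!: mult_right_mono\<close>)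
    ultimately have "L43_bound (\<lambda>x. v t x - U t x) (4 * (8 * \<epsilon> * t powr (-1/4)))"
      by (rule L43_bound_diff) (use \<epsilon>0 in auto)
    then show ?thesis by (simp add: w0_def mult_ac)
  qed
  have iter: "\<forall>\<^sub>F t in at_top. L43_bound (\<lambda>x. v t x - U t x) ((3/4) ^ n * w0 * t powr (-1/4))" for n
  proof (induction n)
    case 0
    show ?case
      using eventually_gt_at_top[of 0]
    proof eventually_elim
      case (elim t)
      then show ?case using w0'[of t] by simp
    qed
  next
    case (Suc n)
    have "\<forall>\<^sub>F t in at_top. L43_bound (\<lambda>x. v t x - U t x) (3/4 * ((3/4) ^ n * w0) * t powr (-1/4))"
    proof (rule decay_step[OF u0 mass M8 \<epsilon>_def heat0 v duhamel w0 _ _ Suc])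
      show "L43_bound (\<lambda>x. v t x - U t x) (w0 * t powr (-1/4))" if "t > 0" for t
        by (rule w0'[OF that])
    qed (use w0 in auto)
    then show ?case by (simp add: mult.assoc)
  qed
  show "((\<lambda>t. ennreal (t powr (1/4)) * Lp_norm (4/3) (\<lambda>x. density_of (u t) x - UM t x)) \<longlongrightarrow> 0) at_top"
  proof (rule order_tendstoI)
    fix a :: ennreal assume "0 < a"
    \<comment> \<open>The level \<open>a\<close> may be infinite, so a finite positive number below
      it is chosen first.\<close>
    then obtain r where r: "0 < r" "r < a" using dense by blast
    then obtain e where e: "r = ennreal e" "e > 0"
      by (cases r) (auto simp: less_top)
    have "(\<lambda>n. (3/4) ^ n * w0) \<longlonglongrightarrow> 0 * w0"
      by (intro tendsto_mult_right LIMSEQ_power_zero) simp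
    then have "\<forall>\<^sub>F n in sequentially. (3/4) ^ n * w0 < e" using e by (intro order_tendstoD(2)) auto
    then obtain n where n: "(3/4) ^ n * w0 < e" by (auto simp: eventually_sequentially)
    show "\<forall>\<^sub>F t in at_top. ennreal (t powr (1/4)) * Lp_norm (4/3) (\<lambda>x. density_of (u t) x - UM t x) < a"
      using iter[of n] eventually_gt_at_top[of 0]
    proof eventually_elim
      case (elim t)
      have "(\<lambda>x. density_of (u t) x - UM t x) = (\<lambda>x. v t x - U t x)"
        using elim by (simp add: v_def U_def UM)
      then have "Lp_norm (4/3) (\<lambda>x. density_of (u t) x - UM t x) \<le> ennreal ((3/4) ^ n * w0 * t powr (-1/4))"
        using L43_imp_Lp_norm_le[OF elim(1)] w0 by simp
      then have "ennreal (t powr (1/4)) * Lp_norm (4/3) (\<lambda>x. density_of (u t) x - UM t x)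
          \<le> ennreal (t powr (1/4)) * ennreal ((3/4) ^ n * w0 * t powr (-1/4))"
        by (intro mult_left_mono) auto
      also have "\<dots> = ennreal (t powr (1/4) * ((3/4) ^ n * w0 * t powr (-1/4)))"
        using w0 by (intro ennreal_mult[symmetric]) auto
      also have "t powr (1/4) * ((3/4) ^ n * w0 * t powr (-1/4)) = (3/4) ^ n * w0"
      proof -
        have "t powr (1/4) * t powr (-1/4) = 1" unfolding powr_add[symmetric] using elim by simp
        then show ?thesis by (simp add: mult.left_commute)
      qed
      also have "ennreal ((3/4) ^ n * w0) \<le> r" using n by (simp add: e ennreal_leI)
      also have "r < a" by (rule r)
      finally show ?case .
    qed
  qed auto
qed simp

end
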